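(* Let $n\ge4$ and $r$ be integers, and let $u=n/r$. (i) If $1\le r\le n$ and $x=x(n,r)$ is the positive solution to the equation $\sum_{j=1}^r x^j=n$, then $$\nu(n,r)=\frac{\exp\left\{\sum_{j=1}^r x^j/j\right\}}{x^n\sqrt{2\pi\sum_{j=1}^r jx^j}}\left(1+O\left(\frac rn\right)\right).$$ (ii) If $n^{1/3}(\log n)^{2/3}\le r\le n$, then $$\nu(n,r)=\varrho(u)\exp\left\{\frac{u\,\xi(u)}{2r}\right\}\left(1+O\left(\frac{u\log^2(u+1)}{r^2}+\frac1u\right)\right).$$
   Context: $S_n$ is the symmetric group on $n$ symbols and $k_j(\sigma)$ is the number of cycles of length $j$ in $\sigma\in S_n$. For $1\le r\le n$, $$\nu(n,r)=\frac1{n!}\left|\{\sigma\in S_n:\ k_j(\sigma)=0 \text{ for all } r+1\le j\le n\}\right|.$$ $\varrho$ is the Dickman function: the continuous function on $[0,\infty)$ with $\varrho(v)=1$ for $v\in[0,1]$ and $v\varrho'(v)+\varrho(v-1)=0$ for $v>1$. For $v>1$, $\xi(v)$ is the positive solution to $e^{\xi(v)}=1+v\xi(v)$, and $\xi(1)=0$. The implied constants in $O(\cdot)$ are absolute (uniform over all $n,r$ in the stated ranges). $\log$ is the natural logarithm. *)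

theory Defs
  imports "HOL-Analysis.Analysis" "HOL-Combinatorics.Combinatorics"
begin

text \<open>
  Cycles are identified with the orbits of the permutation on \<open>{1..n}\<close>, so fixed points
  are cycles of length 1. The name \<open>orbit\<close> is qualified because the theory
  \<open>Perm\<close> defines another constant of that name.
\<close>

definition cycle_count :: "nat \<Rightarrow> nat \<Rightarrow> (nat \<Rightarrow> nat) \<Rightarrow> nat" where
  "cycle_count n j \<sigma> = card {c \<in> Orbits.orbit \<sigma> ` {1..n}. card c = j}"

definition \<nu> :: "nat \<Rightarrow> nat \<Rightarrow> real" where
  "\<nu> n r = real (card {\<sigma>. \<sigma> permutes {1..n} \<and> (\<forall>j\<in>{r+1..n}. cycle_count n j \<sigma> = 0)}) / fact n"

text \<open>Only the values at \<open>v \<ge> 1\<close> are meaningful.\<close>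

definition \<xi> :: "real \<Rightarrow> real" where
  "\<xi> v = (if v = 1 then 0 else (THE y. y > 0 \<and> exp y = 1 + v * y))"

lemma xi_ex1:
  assumes v: "(v::real) > 1"
  shows "\<exists>!y. y > 0 \<and> exp y = 1 + v * y"
proof -
  define g where "g = (\<lambda>y::real. exp y - 1 - v * y)"
  have der: "(g has_real_derivative exp y - v) (at y)" for y
    unfolding g_def by (auto intro!: derivative_eq_intros)
  have cont: "continuous_on A g" for A
    unfolding g_def by (intro continuous_intros)
  have lnv: "ln v > 0" using v by simp
  have a: "g (ln v) \<le> 0"
  proof -
    have "ln (1 / v) \<le> 1 / v - 1" using v by (intro ln_le_minus_one) auto
    then have "1 - 1 / v \<le> ln v" using v by (simp add: ln_div)
    then have "v * (1 - 1 / v) \<le> v * ln v" using v by (intro mult_left_mono) auto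
    then show ?thesis using v by (simp add: g_def algebra_simps)
  qed
  have b: "g (2 * v) \<ge> 0"
  proof -
    have "1 + 2 * v + (2 * v)\<^sup>2 / 2 \<le> exp (2 * v)"
      using v by (intro exp_lower_Taylor_quadratic) auto
    moreover have "(2 * v)\<^sup>2 / 2 = v * (2 * v)" by (simp add: power2_eq_square)
    ultimately show ?thesis using v by (simp add: g_def)
  qed
  have "ln v \<le> 2 * v" using v ln_le_minus_one[of v] by simp
  from IVT'[of g, OF a b this cont] obtain y where y: "y \<ge> ln v" "g y = 0" by auto
  have uniq: False if ys: "0 < y1" "y1 < y2" "g y1 = 0" "g y2 = 0" for y1 y2
  proof -
    have g0: "g 0 = 0" by (simp add: g_def)
    obtain c1 where c1: "0 < c1" "c1 < y1" "exp c1 = v"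
      using MVT2[of 0 y1 g "\<lambda>y. exp y - v"] ys g0 der by auto
    obtain c2 where c2: "y1 < c2" "exp c2 = v"
      using MVT2[of y1 y2 g "\<lambda>y. exp y - v"] ys der by auto
    have "c1 < c2" using c1 c2 by linarith
    then have "exp c1 < exp c2" by simp
    then show False using c1 c2 by simp
  qed
  show ?thesis
  proof (rule ex1I[of _ y])
    show "y > 0 \<and> exp y = 1 + v * y" using y lnv by (auto simp: g_def)
  next
    fix z assume z: "z > 0 \<and> exp z = 1 + v * z"
    then have "g z = 0" by (simp add: g_def)
    moreover have "y > 0" using y(1) lnv by linarith
    ultimately show "z = y" using z y(2) uniq[of z y] uniq[of y z] by (cases z y rule: linorder_cases) auto
  qed
qed

lemma xi_props:
  assumes "v > 1"
  shows "\<xi> v > 0" "exp (\<xi> v) = 1 + v * \<xi> v"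
  using theI'[OF xi_ex1[OF assms]] assms by (auto simp: \<xi>_def)

lemma xi_1: "\<xi> 1 = 0"
  by (simp add: \<xi>_def)

definition is_dickman :: "(real \<Rightarrow> real) \<Rightarrow> bool" where
  "is_dickman f \<longleftrightarrow>
     continuous_on {0..} f \<and>
     (\<forall>v\<in>{0..1}. f v = 1) \<and>
     (\<forall>v>1. f differentiable (at v) \<and> v * deriv f v + f (v - 1) = 0)"

text \<open>The conditions determine the function on \<open>[0, \<infinity>)\<close>; the value 0 on the negative
  numbers is a convention that makes it unique as a total function.\<close>

definition \<rho> :: "real \<Rightarrow> real" where
  "\<rho> = (THE f. is_dickman f \<and> (\<forall>v<0. f v = 0))"

lemma is_dickman_unique:
  assumes f: "is_dickman f" and g: "is_dickman g" and v: "v \<ge> 0"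
  shows "f v = g v"
proof -
  have "\<forall>v\<in>{0..real (Suc k)}. f v = g v" for k
  proof (induction k)
    case 0
    then show ?case using f g by (auto simp: is_dickman_def)
  next
    case (Suc k)
    show ?case
    proof
      fix w assume w: "w \<in> {0..real (Suc (Suc k))}"
      show "f w = g w"
      proof (cases "w \<le> real (Suc k)")
        case True
        then show ?thesis using Suc w by auto
      next
        case False
        let ?d = "\<lambda>v. f v - g v" and ?a = "real (Suc k)"
        have "?d w = ?d ?a"
        proof (rule DERIV_isconst2[where a = ?a and b = w])
          show "continuous_on {?a..w} ?d"
            using f g by (intro continuous_on_diff) (auto simp: is_dickman_def elim!: continuous_on_subset)
        next
          fix x assume x: "?a < x" "x < w"
          have x1: "x > 1" using x(1) by linarith
          have "f (x - 1) = g (x - 1)" using Suc x x1 w by auto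
          moreover have "x * deriv f x + f (x - 1) = 0" "x * deriv g x + g (x - 1) = 0"
            using f g x1 by (auto simp: is_dickman_def)
          ultimately have "x * (deriv f x - deriv g x) = 0" unfolding right_diff_distrib by linarith
          then have eq: "deriv f x - deriv g x = 0" using x1 by auto
          have "(f has_real_derivative deriv f x) (at x)" "(g has_real_derivative deriv g x) (at x)"
            using f g x1 by (auto simp: is_dickman_def DERIV_deriv_iff_real_differentiable)
          from DERIV_diff[OF this] show "(?d has_real_derivative 0) (at x)" by (simp add: eq)
        qed (use False in auto)
        moreover have "?d ?a = 0" using Suc by auto
        ultimately show ?thesis by simp
      qed
    qed
  qed
  moreover have "v \<le> real (Suc (nat \<lceil>v\<rceil>))" by linarith
  ultimately show ?thesis using v by (meson atLeastAtMost_iff)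
qed

text \<open>Picard iteration for the integral equation: the \<open>k\<close>-th iterate is correct up to
  \<open>k + 1\<close>.\<close>

primrec dickman_iter :: "nat \<Rightarrow> real \<Rightarrow> real" where
  "dickman_iter 0 v = 1"
| "dickman_iter (Suc k) v = 1 - integral {1..v} (\<lambda>t. dickman_iter k (t - 1) / t)"

lemma dickman_iter_le_1: "v \<le> 1 \<Longrightarrow> dickman_iter k v = 1"
  by (cases k; cases "v = 1") auto

lemma dickman_iter_cont: "continuous_on A (dickman_iter k)"
proof (induction k arbitrary: A)
  case 0
  show ?case by (simp add: continuous_on_const cong: continuous_on_cong)
next
  case (Suc k)
  have h: "continuous_on {1..b} (\<lambda>t. dickman_iter k (t - 1) / t)" for b
    by (intro continuous_on_divide continuous_on_id continuous_on_compose2[OF Suc[of UNIV]]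
        continuous_intros) auto
  have "isCont (dickman_iter (Suc k)) v" for v
  proof -
    have c2: "continuous_on {1..v+1} (dickman_iter (Suc k))"
      using indefinite_integral_continuous_1[OF integrable_continuous_interval[OF h[of "v+1"]]]
      by (simp, intro continuous_intros) auto
    have c1: "continuous_on {..1} (dickman_iter (Suc k))"
      using dickman_iter_le_1[of _ "Suc k"]
      by (subst continuous_on_cong[OF refl, of _ _ "\<lambda>_. 1"]) (auto simp del: dickman_iter.simps)
    have "continuous_on ({..1} \<union> {1..v+1}) (dickman_iter (Suc k))"
      by (rule continuous_on_closed_Un[OF _ _ c1 c2]) auto
    then have "continuous_on {..<v+1} (dickman_iter (Suc k))"
      by (rule continuous_on_subset) auto
    then show ?thesis by (rule continuous_on_interior) (simp add: interior_open)
  qed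
  then show ?case by (meson continuous_at_imp_continuous_on)
qed

lemma dickman_iter_deriv:
  assumes v: "v > 1"
  shows "(dickman_iter (Suc k) has_real_derivative - (dickman_iter k (v - 1) / v)) (at v)"
proof -
  have h: "continuous_on {1..v+1} (\<lambda>t. dickman_iter k (t - 1) / t)"
    by (intro continuous_on_divide continuous_on_id
        continuous_on_compose2[OF dickman_iter_cont[of UNIV]] continuous_intros) auto
  have "((\<lambda>x. integral {1..x} (\<lambda>t. dickman_iter k (t - 1) / t)) has_real_derivative
        dickman_iter k (v - 1) / v) (at v within {1..v+1})"
    by (rule integral_has_real_derivative[OF h]) (use v in auto)
  moreover have "at v within {1..v+1} = at v"
    using v by (intro at_within_interior) auto
  ultimately have "((\<lambda>x. 1 - integral {1..x} (\<lambda>t. dickman_iter k (t - 1) / t))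
        has_real_derivative 0 - dickman_iter k (v - 1) / v) (at v)"
    by (intro DERIV_diff DERIV_const) auto
  moreover have "dickman_iter (Suc k) = (\<lambda>x. 1 - integral {1..x} (\<lambda>t. dickman_iter k (t - 1) / t))"
    by (rule ext) (rule dickman_iter.simps)
  ultimately show ?thesis by simp
qed

lemma dickman_iter_step: "v \<le> real k + 1 \<Longrightarrow> dickman_iter (Suc k) v = dickman_iter k v"
proof (induction k arbitrary: v)
  case 0
  then show ?case using dickman_iter_le_1[of v] by simp
next
  case (Suc k)
  have "integral {1..v} (\<lambda>t. dickman_iter (Suc k) (t - 1) / t) =
        integral {1..v} (\<lambda>t. dickman_iter k (t - 1) / t)"
  proof (rule integral_cong)
    fix t assume "t \<in> {1..v}"
    then have "dickman_iter (Suc k) (t - 1) = dickman_iter k (t - 1)"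
      using Suc.prems by (intro Suc.IH) auto
    then show "dickman_iter (Suc k) (t - 1) / t = dickman_iter k (t - 1) / t" by simp
  qed
  then show ?case by (simp only: dickman_iter.simps)
qed

lemma dickman_iter_stable:
  assumes "k \<le> m" "v \<le> real k + 1"
  shows "dickman_iter m v = dickman_iter k v"
  using assms(1)
proof (induction m rule: dec_induct)
  case (step m)
  have "dickman_iter (Suc m) v = dickman_iter m v"
    using step assms by (intro dickman_iter_step) linarith
  with step show ?case by simp
qed simp

lemma is_dickman_ex: "\<exists>f. is_dickman f \<and> (\<forall>v<0. f v = 0)"
proof -
  define F where "F = (\<lambda>v. dickman_iter (nat \<lceil>v\<rceil>) v)"
  have F: "F v = dickman_iter k v" if "v \<le> real k" for v k
    unfolding F_def using that by (intro dickman_iter_stable[symmetric]) linarith+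
  define f where "f = (\<lambda>v. if v < 0 then 0 else F v)"
  have "isCont F v" for v
  proof -
    define k where "k = Suc (nat \<lceil>v\<rceil>)"
    have k: "v < real k" unfolding k_def by linarith
    have "continuous_on {..<real k} F"
      using dickman_iter_cont[of "{..<real k}" k] F[of _ k] by (subst continuous_on_cong) auto
    then show ?thesis using k by (simp add: continuous_on_eq_continuous_at)
  qed
  then have "continuous_on {0..} F" by (simp add: continuous_at_imp_continuous_on)
  then have "continuous_on {0..} f"
    by (subst continuous_on_cong[OF refl, of _ _ F]) (auto simp: f_def)
  moreover have "f v = 1" if "v \<in> {0..1}" for v
    using that F[of v 1] dickman_iter_le_1[of v 1] by (auto simp: f_def simp del: dickman_iter.simps)
  moreover have "f differentiable (at v) \<and> v * deriv f v + f (v - 1) = 0" if v: "v > 1" for v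
  proof -
    define k where "k = Suc (nat \<lceil>v\<rceil>)"
    have k: "v < real k" unfolding k_def by linarith
    have eq: "dickman_iter (Suc k) w = f w" if "w \<in> {0<..<real k}" for w
      using that F[of w "Suc k"] by (auto simp: f_def simp del: dickman_iter.simps)
    have "(f has_real_derivative - (dickman_iter k (v - 1) / v)) (at v)"
      by (rule has_field_derivative_transform_within_open[OF dickman_iter_deriv[OF v, of k],
            of "{0<..<real k}"]) (use v k eq in auto)
    moreover have "dickman_iter k (v - 1) = f (v - 1)"
      using v k F[of "v - 1" k] by (auto simp: f_def)
    ultimately have "(f has_real_derivative - (f (v - 1) / v)) (at v)" by simp
    then show ?thesis using v by (auto simp: DERIV_imp_deriv real_differentiable_def)
  qed
  ultimately have "is_dickman f" unfolding is_dickman_def by blast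
  then show ?thesis by (intro exI[of _ f]) (auto simp: f_def)
qed

lemma is_dickman_rho: "is_dickman \<rho>" and rho_neg: "v < 0 \<Longrightarrow> \<rho> v = 0"
proof -
  have "\<exists>!f. is_dickman f \<and> (\<forall>v<0. f v = 0)"
  proof (rule ex_ex1I[OF is_dickman_ex])
    fix f g :: "real \<Rightarrow> real"
    assume a: "is_dickman f \<and> (\<forall>v<0. f v = 0)" "is_dickman g \<and> (\<forall>v<0. g v = 0)"
    show "f = g"
    proof
      fix v show "f v = g v"
        using a is_dickman_unique[of f g v] by (cases "v < 0") auto
    qed
  qed
  from theI'[OF this] show "is_dickman \<rho>" "v < 0 \<Longrightarrow> \<rho> v = 0"
    unfolding \<rho>_def by auto
qed

end

theory Submission
  imports
    Defs
    "HOL-Complex_Analysis.Complex_Analysis"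
    "HOL-Probability.Distributions"
begin

text \<open>
  Write P(z) for the sum of z^j/j over 1 \<le> j \<le> r. The numbers \<nu> n r (for fixed r) are the Taylor
  coefficients of exp(P(z)), because removing the cycle of a marked element gives
  n \<nu>(n,r) = \<nu>(n-1,r) + ... + \<nu>(n-r,r) (\<open>nu_rec\<close>). Both parts of the theorem come out of one
  saddle-point estimate that is uniform in r.

  For the first part, Cauchy's formula is applied on the circle of radius x, where zP'(z) takes the
  value n at z = x. The coefficient that is integrated is not that of exp(P(z)) but that of
  zP'(z) exp(P(z)), which is n \<nu>(n,r) (\<open>nu_integral\<close>). The additional factor zP'(z) is harmless near
  z = x, and away from it decays relative to n like 1/(rt), where t is the angle. Without this factor
  the absolute value of the integrand decays only like 1/(rt) when r is enormous compared with
  u = n/r, and the integral of the absolute value would lose a factor log r. For |t| \<le> \<pi>/r a Taylor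
  expansion is used; its terms of odd order are imaginary, so that the relative error is O(r/n)
  (\<open>integrand_near_0\<close>). For larger t two lower bounds for P(x) - Re P(z) are averaged: a power of u, and
  log(rt), each up to constants (\<open>integrand_tail\<close>). When u is bounded, a bounded
  error is allowed and crude estimates suffice (\<open>saddle_estimate_small_u\<close>). The result is
  \<open>nu_saddle_point_estimate\<close>.

  The second part needs the asymptotic behaviour of the Dickman function with relative error O(1/u).
  It is not obtained by inverting a Laplace transform, but from the first part: comparing the
  difference equation of \<nu> with the delay differential equation of \<rho> shows that \<nu>(kn,kr) tends to
  \<rho>(n/r) for k \<rightarrow> \<infinity> (\<open>nu_scaled_tendsto_rho\<close>), and the first part, with the same u, applies to both
  (n,r) and (kn,kr). It remains to compare the two saddle-point approximations
  (\<open>ln_saddle_value_scaling\<close>). Their logarithms are evaluated at the approximate saddle point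
  exp(\<xi>(u)/r) instead of x; as the saddle point is a stationary point, this costs only the square of
  the difference. Replacing sums by sums over a k times finer grid then leaves the difference of
  u\<xi>(u)/(2r) and u\<xi>(u)/(2kr), together with terms of size log(u+1)/r and u log(u+1)^2/r^2. The
  first of these sizes is the geometric mean of the second and 1/u. Letting k tend to infinity gives the
  estimate for large u; for bounded u it is enough that \<rho> is bounded below by a positive constant
  (\<open>rho_lower\<close>).
\<close>

section \<open>Counting permutations without long cycles\<close>

definition bounded_perms :: "nat \<Rightarrow> 'a set \<Rightarrow> ('a \<Rightarrow> 'a) set" where
  "bounded_perms r A = {\<sigma>. \<sigma> permutes A \<and> (\<forall>x\<in>A. card (Orbits.orbit \<sigma> x) \<le> r)}"

text \<open>
  The cycle through the marked element a has prescribed length j, which may exceed r. Fixing this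
  length makes it possible to shrink that cycle one element at a time.
\<close>

definition pointed_perms :: "nat \<Rightarrow> 'a set \<Rightarrow> 'a \<Rightarrow> nat \<Rightarrow> ('a \<Rightarrow> 'a) set" where
  "pointed_perms r A a j = {\<sigma>. \<sigma> permutes A \<and> card (Orbits.orbit \<sigma> a) = j \<and>
     (\<forall>x\<in>A. x \<notin> Orbits.orbit \<sigma> a \<longrightarrow> card (Orbits.orbit \<sigma> x) \<le> r)}"

text \<open>
  Composing with the transposition of a and c splices the fixed point c of p into the cycle of a,
  directly after a. All other cycles stay as they are.
\<close>

lemma orbit_insert:
  assumes "p c = c" "a \<noteq> c"
  shows "Orbits.orbit (p \<circ> Transposition.transpose a c) a = insert c (Orbits.orbit p a)"
proof (intro equalityI subsetI)
  let ?s = "p \<circ> Transposition.transpose a c"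
  have s: "?s a = c" "?s c = p a" "\<And>x. x \<noteq> a \<Longrightarrow> x \<noteq> c \<Longrightarrow> ?s x = p x"
    using assms by auto
  fix y
  { assume "y \<in> Orbits.orbit ?s a"
    then show "y \<in> insert c (Orbits.orbit p a)"
    proof induction
      case base
      then show ?case using s by simp
    next
      case (step y)
      then show ?case using s by (metis insert_iff Orbits.orbit.intros)
    qed }
  have c: "c \<in> Orbits.orbit ?s a" using Orbits.orbit.base[of ?s a] s by simp
  assume "y \<in> insert c (Orbits.orbit p a)"
  moreover have "y \<in> Orbits.orbit ?s a" if "y \<in> Orbits.orbit p a" for y
    using that
  proof induction
    case base
    then show ?case using s c by (metis Orbits.orbit.step)
  next
    case (step y)
    then show ?case using s c assms by (metis Orbits.orbit.step)
  qed
  ultimately show "y \<in> Orbits.orbit ?s a" using c by auto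
qed

lemma orbit_insert_other:
  assumes p: "p permutes (A - {c})" and A: "finite A" and x: "x \<in> A - {c}" "x \<notin> Orbits.orbit p a" "a \<noteq> c"
  shows "Orbits.orbit (p \<circ> Transposition.transpose a c) x = Orbits.orbit p x"
proof (rule orbit_cong)
  have perm: "permutation p" using p A permutation_permutes by (metis finite_Diff)
  show "x \<in> Orbits.orbit p x" using permutation_self_in_orbit[OF perm] .
  have "c \<notin> Orbits.orbit p x" using permutes_orbit_subset[OF p x(1)] by auto
  moreover have "a \<notin> Orbits.orbit p x"
    using orbit_swap[of x p a] permutation_self_in_orbit[OF perm] x by auto
  ultimately show "(p \<circ> Transposition.transpose a c) y = p y" if "y \<in> Orbits.orbit p x" for y
    using that by (metis comp_apply transpose_apply_other)
qed

text \<open>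
  Undoing the splicing: a permutation that sends a to c is determined by the permutation of the
  remaining elements in which c has been cut out of the cycle of a.
\<close>

lemma pointed_perms_fibre:
  assumes A: "finite A" and a: "a \<in> A" and c: "c \<in> A" "c \<noteq> a"
  shows "{\<sigma> \<in> pointed_perms r A a (Suc j). \<sigma> a = c}
       = (\<lambda>p. p \<circ> Transposition.transpose a c) ` pointed_perms r (A - {c}) a j" (is "?L = ?F ` ?R")
proof (intro equalityI subsetI)
  have key: "(p \<circ> Transposition.transpose a c) \<in> pointed_perms r A a (Suc j) \<longleftrightarrow> p \<in> pointed_perms r (A - {c}) a j"
    if p: "p permutes (A - {c})" for p
  proof -
    let ?s = "p \<circ> Transposition.transpose a c"
    have pc: "p c = c" using p by (simp add: permutes_not_in)
    have s: "?s permutes A"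
      by (intro permutes_compose permutes_swap_id a c permutes_subset[OF p]) auto
    have oa: "Orbits.orbit ?s a = insert c (Orbits.orbit p a)"
      using c by (intro orbit_insert pc) auto
    have sub: "Orbits.orbit p a \<subseteq> A - {c}" using permutes_orbit_subset[OF p] a c by auto
    then have "card (Orbits.orbit ?s a) = Suc (card (Orbits.orbit p a))"
      unfolding oa using A finite_subset by (subst card_insert_disjoint) auto
    moreover have "Orbits.orbit ?s x = Orbits.orbit p x" if "x \<in> A - {c}" "x \<notin> Orbits.orbit p a" for x
      using orbit_insert_other[OF p A that] c by metis
    ultimately show ?thesis
      unfolding pointed_perms_def mem_Collect_eq using s p oa by auto
  qed
  fix \<sigma>
  { assume "\<sigma> \<in> ?F ` ?R"
    then obtain p where p: "p \<in> ?R" "\<sigma> = ?F p" by auto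
    then have pp: "p permutes (A - {c})" by (auto simp: pointed_perms_def)
    then have "p c = c" by (simp add: permutes_not_in)
    with p pp key show "\<sigma> \<in> ?L" by auto }
  assume s: "\<sigma> \<in> ?L"
  define p where "p = \<sigma> \<circ> Transposition.transpose a c"
  have sp: "\<sigma> = ?F p" unfolding p_def by (simp add: comp_assoc)
  have "p permutes A" unfolding p_def
    using s by (intro permutes_compose permutes_swap_id a c) (auto simp: pointed_perms_def)
  moreover have "p c = c" using s by (simp add: p_def)
  ultimately have pp: "p permutes (A - {c})"
    by (metis Diff_iff permutes_superset singletonD)
  show "\<sigma> \<in> ?F ` ?R" using key[OF pp] s sp by auto
qed

lemma finite_pointed_perms: "finite A \<Longrightarrow> finite (pointed_perms r A a j)"
  unfolding pointed_perms_def using finite_permutations[of A] by (rule rev_finite_subset) auto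

lemma card_pointed_perms_Suc:
  assumes A: "finite A" and a: "a \<in> A" and j: "j \<ge> 1"
  shows "card (pointed_perms r A a (Suc j)) = (\<Sum>c\<in>A - {a}. card (pointed_perms r (A - {c}) a j))"
proof -
  let ?Q = "\<lambda>c. {\<sigma> \<in> pointed_perms r A a (Suc j). \<sigma> a = c}"
  have "pointed_perms r A a (Suc j) = (\<Union>c\<in>A - {a}. ?Q c)"
  proof -
    have "\<sigma> a \<in> A - {a}" if "\<sigma> \<in> pointed_perms r A a (Suc j)" for \<sigma>
    proof -
      have "\<sigma> a \<noteq> a"
      proof
        assume "\<sigma> a = a"
        then have "Orbits.orbit \<sigma> a = {a}" by (simp add: orbit_eq_singleton_iff)
        then show False using that j by (simp add: pointed_perms_def)
      qed
      moreover have "\<sigma> a \<in> A" using that a by (auto simp: pointed_perms_def permutes_in_image)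
      ultimately show ?thesis by auto
    qed
    then show ?thesis by auto
  qed
  then have "card (pointed_perms r A a (Suc j)) = card (\<Union>c\<in>A - {a}. ?Q c)" by simp
  also have "\<dots> = (\<Sum>c\<in>A - {a}. card (?Q c))"
    using A finite_pointed_perms[OF A] by (intro card_UN_disjoint) auto
  also have "\<dots> = (\<Sum>c\<in>A - {a}. card (pointed_perms r (A - {c}) a j))"
  proof (rule sum.cong[OF refl])
    fix c assume c: "c \<in> A - {a}"
    have "inj_on (\<lambda>p. p \<circ> Transposition.transpose a c) X" for X :: "('a \<Rightarrow> 'a) set"
    proof (rule inj_onI)
      fix p q :: "'a \<Rightarrow> 'a" assume "p \<circ> Transposition.transpose a c = q \<circ> Transposition.transpose a c"
      then have "(p \<circ> Transposition.transpose a c) \<circ> Transposition.transpose a c = (q \<circ> Transposition.transpose a c) \<circ> Transposition.transpose a c" by simp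
      then show "p = q" by (simp add: comp_assoc)
    qed
    then show "card (?Q c) = card (pointed_perms r (A - {c}) a j)"
      using pointed_perms_fibre[OF A a] c by (subst pointed_perms_fibre[OF A a]) (auto simp: card_image)
  qed
  finally show ?thesis .
qed

lemma pointed_perms_fixed_point:
  assumes A: "finite A" and a: "a \<in> A"
  shows "pointed_perms r A a 1 = bounded_perms r (A - {a})"
proof -
  have "Orbits.orbit \<sigma> a = {a} \<longleftrightarrow> card (Orbits.orbit \<sigma> a) = 1" if "\<sigma> permutes A" for \<sigma>
    using permutation_self_in_orbit[of \<sigma> a] that A
    by (metis One_nat_def card_1_singletonE card.insert card.empty empty_iff finite.emptyI singletonD permutation_permutes)
  moreover have "\<sigma> permutes (A - {a}) \<longleftrightarrow> \<sigma> permutes A \<and> \<sigma> a = a" for \<sigma>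
  proof
    assume h: "\<sigma> permutes (A - {a})"
    have "\<sigma> permutes A" using permutes_subset[OF h] by blast
    then show "\<sigma> permutes A \<and> \<sigma> a = a" using permutes_not_in[OF h] by blast
  next
    assume h: "\<sigma> permutes A \<and> \<sigma> a = a"
    then have "\<forall>x\<in>A - (A - {a}). \<sigma> x = x" by blast
    with h show "\<sigma> permutes (A - {a})" using permutes_superset by blast
  qed
  ultimately have "\<sigma> permutes A \<and> card (Orbits.orbit \<sigma> a) = 1 \<longleftrightarrow> \<sigma> permutes (A - {a})"
      and "\<sigma> permutes (A - {a}) \<Longrightarrow> Orbits.orbit \<sigma> a = {a}" for \<sigma>
    by (metis orbit_eq_singleton_iff)+
  then show ?thesis
    unfolding pointed_perms_def bounded_perms_def by (intro Collect_cong) blast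
qed

lemma bounded_perms_split:
  assumes A: "finite A" and a: "a \<in> A"
  shows "bounded_perms r A = (\<Union>j\<in>{1..min r (card A)}. pointed_perms r A a j)"
proof (intro equalityI subsetI)
  fix \<sigma> assume s: "\<sigma> \<in> bounded_perms r A"
  then have p: "\<sigma> permutes A" by (simp add: bounded_perms_def)
  have sub: "Orbits.orbit \<sigma> a \<subseteq> A" using permutes_orbit_subset[OF p a] .
  have "card (Orbits.orbit \<sigma> a) \<ge> 1"
    using A orbit_nonempty[of \<sigma> a] sub by (metis One_nat_def Suc_leI card_gt_0_iff finite_subset)
  moreover have "card (Orbits.orbit \<sigma> a) \<le> card A" using A sub by (rule card_mono)
  ultimately show "\<sigma> \<in> (\<Union>j\<in>{1..min r (card A)}. pointed_perms r A a j)"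
    using s a unfolding bounded_perms_def pointed_perms_def by auto
next
  fix \<sigma> assume "\<sigma> \<in> (\<Union>j\<in>{1..min r (card A)}. pointed_perms r A a j)"
  then obtain j where j: "j \<le> r" "\<sigma> \<in> pointed_perms r A a j" by auto
  then have p: "\<sigma> permutes A" by (simp add: pointed_perms_def)
  then have perm: "permutation \<sigma>" using A permutation_permutes by metis
  have "Orbits.orbit \<sigma> x = Orbits.orbit \<sigma> a" if "x \<in> Orbits.orbit \<sigma> a" for x
    using that permutation_self_in_orbit[OF perm] orbit_swap orbit_trans by (metis equalityI subsetI)
  then show "\<sigma> \<in> bounded_perms r A"
    using j unfolding bounded_perms_def pointed_perms_def mem_Collect_eq by metis
qed

text \<open>
  The common proportion of permutations with cycles of length at most r, for all sets of size n. It
  is introduced through its recursion so that the recursion can be proved for sets of all sizes in one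
  induction.
\<close>

fun bounded_density :: "nat \<Rightarrow> nat \<Rightarrow> real" where
  "bounded_density r n =
     (if n = 0 then 1 else (\<Sum>j\<in>{1..min r n}. bounded_density r (n - j)) / real n)"

declare bounded_density.simps [simp del]

text \<open>
  The cycle of the marked element has some length j \<le> min r n. Cutting its other elements out one
  after another leaves n-1, n-2, ... choices for the element removed, and finally a permutation of n-j
  elements; the number of permutations for each j is therefore (n-1)! times the proportion for n-j.
\<close>

lemma card_bounded_perms:
  "finite A \<Longrightarrow> real (card (bounded_perms r A)) = fact (card A) * bounded_density r (card A)"
proof (induction "card A" arbitrary: A rule: less_induct)
  case less
  show ?case
  proof (cases "A = {}")
    case True
    then have "bounded_perms r A = {id}" by (auto simp: bounded_perms_def)
    then show ?thesis using True by (simp add: bounded_density.simps)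
  next
    case False
    then obtain a where a: "a \<in> A" by auto
    have pt: "real (card (pointed_perms r B b j)) = fact (card B - 1) * bounded_density r (card B - j)"
      if "finite B" "b \<in> B" "card B \<le> card A" "1 \<le> j" "j \<le> card B" for B :: "'a set" and b j
      using that(4,1-3,5)
    proof (induction j arbitrary: B rule: dec_induct)
      case base
      then have "card (B - {b}) < card A"
        by (metis card_Diff1_less less_le_trans)
      then have "real (card (bounded_perms r (B - {b}))) = fact (card (B - {b})) * bounded_density r (card (B - {b}))"
        using base by (intro less.hyps) auto
      then show ?case using base pointed_perms_fixed_point[of B b r] by simp
    next
      case (step j)
      have "real (card (pointed_perms r B b (Suc j)))
          = (\<Sum>c\<in>B - {b}. real (card (pointed_perms r (B - {c}) b j)))"
        using card_pointed_perms_Suc[of B b j r] step by simp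
      also have "\<dots> = (\<Sum>c\<in>B - {b}. fact (card B - 2) * bounded_density r (card B - Suc j))"
      proof (rule sum.cong[OF refl])
        fix c assume c: "c \<in> B - {b}"
        then have "card (B - {c}) = card B - 1" using step by simp
        then show "real (card (pointed_perms r (B - {c}) b j)) = fact (card B - 2) * bounded_density r (card B - Suc j)"
          using step c step.IH[of "B - {c}"] by (auto simp: numeral_2_eq_2)
      qed
      also have "\<dots> = real (card B - 1) * fact (card B - 2) * bounded_density r (card B - Suc j)"
        using step by simp
      also have "real (card B - 1) * fact (card B - 2) = fact (card B - 1)"
      proof -
        have "card B - 1 = Suc (card B - 2)" using step by linarith
        then show ?thesis by (metis fact_Suc of_nat_fact of_nat_mult)
      qed
      finally show ?case .
    qed
    have nz: "card A > 0" using less False by auto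
    have "real (card (bounded_perms r A)) = (\<Sum>j\<in>{1..min r (card A)}. real (card (pointed_perms r A a j)))"
      unfolding bounded_perms_split[OF less.prems a]
      using finite_pointed_perms[OF less.prems]
      by (subst card_UN_disjoint) (auto simp: pointed_perms_def)
    also have "\<dots> = (\<Sum>j\<in>{1..min r (card A)}. fact (card A - 1) * bounded_density r (card A - j))"
      using less.prems a by (intro sum.cong pt) auto
    also have "\<dots> = fact (card A - 1) * (real (card A) * bounded_density r (card A))"
      using nz by (simp add: bounded_density.simps[of r "card A"] flip: sum_distrib_left)
    also have "\<dots> = fact (card A) * bounded_density r (card A)"
      using nz by (subst (2) fact_reduce) auto
    finally show ?thesis .
  qed
qed

lemma cycle_count_eq_0_iff:
  "cycle_count n j \<sigma> = 0 \<longleftrightarrow> (\<forall>x\<in>{1..n}. card (Orbits.orbit \<sigma> x) \<noteq> j)"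
proof -
  have "finite {c \<in> Orbits.orbit \<sigma> ` {1..n}. card c = j}" by simp
  then show ?thesis unfolding cycle_count_def by (simp only: card_0_eq) blast
qed

lemma nu_eq_bounded_density: "\<nu> n r = bounded_density r n"
proof -
  have "(\<forall>j\<in>{r+1..n}. cycle_count n j \<sigma> = 0) \<longleftrightarrow> (\<forall>x\<in>{1..n}. card (Orbits.orbit \<sigma> x) \<le> r)"
    if s: "\<sigma> permutes {1..n}" for \<sigma>
  proof -
    have le: "card (Orbits.orbit \<sigma> x) \<le> n" if "x \<in> {1..n}" for x
      using card_mono[OF finite_atLeastAtMost permutes_orbit_subset[OF s that]] by simp
    have "(\<forall>j\<in>{r+1..n}. cycle_count n j \<sigma> = 0) \<longleftrightarrow>
        (\<forall>x\<in>{1..n}. card (Orbits.orbit \<sigma> x) \<notin> {r+1..n})"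
      unfolding cycle_count_eq_0_iff by blast
    also have "\<dots> \<longleftrightarrow> (\<forall>x\<in>{1..n}. card (Orbits.orbit \<sigma> x) \<le> r)"
    proof (intro ball_cong refl)
      fix x assume "x \<in> {1..n}"
      from le[OF this] show "card (Orbits.orbit \<sigma> x) \<notin> {r+1..n} \<longleftrightarrow> card (Orbits.orbit \<sigma> x) \<le> r"
        by (simp add: not_less_eq_eq)
    qed
    finally show ?thesis .
  qed
  then have "{\<sigma>. \<sigma> permutes {1..n} \<and> (\<forall>j\<in>{r+1..n}. cycle_count n j \<sigma> = 0)} = bounded_perms r {1..n}"
    unfolding bounded_perms_def by blast
  then show ?thesis unfolding \<nu>_def using card_bounded_perms[of "{1..n}" r] by simp
qed

lemma nu_0: "\<nu> 0 r = 1"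
  by (simp add: nu_eq_bounded_density bounded_density.simps)

lemma nu_rec: "real n * \<nu> n r = (\<Sum>j\<in>{1..min r n}. \<nu> (n - j) r)"
  by (cases "n = 0") (simp_all add: nu_eq_bounded_density bounded_density.simps[of r n])

lemma nu_nonneg: "\<nu> n r \<ge> 0"
  by (simp add: \<nu>_def)

lemma nu_le_1: "\<nu> n r \<le> 1"
proof -
  have "card {\<sigma>. \<sigma> permutes {1..n} \<and> (\<forall>j\<in>{r+1..n}. cycle_count n j \<sigma> = 0)} \<le> card {\<sigma>. \<sigma> permutes {1..n}}"
    by (rule card_mono) (auto intro: finite_permutations)
  also have "\<dots> = fact n" using card_permutations[of "{1..n}" n] by simp
  finally have "real (card {\<sigma>. \<sigma> permutes {1..n} \<and> (\<forall>j\<in>{r+1..n}. cycle_count n j \<sigma> = 0)}) \<le> real (fact n)"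
    by (simp only: of_nat_le_iff)
  then show ?thesis unfolding \<nu>_def of_nat_fact by (simp add: divide_le_eq_1)
qed

section \<open>The generating function and Cauchy's formula\<close>

lemma exp_cycle_polynomial_deriv:
  "((\<lambda>z::complex. exp (\<Sum>j=1..r. z ^ j / of_nat j)) has_field_derivative
     (\<Sum>j=1..r. z ^ (j - 1)) * exp (\<Sum>j=1..r. z ^ j / of_nat j)) (at z)"
proof -
  have "((\<lambda>z::complex. \<Sum>j=1..r. z ^ j / of_nat j) has_field_derivative
     (\<Sum>j=1..r. of_nat j * z ^ (j - 1) / of_nat j)) (at z)"
    by (intro DERIV_sum) (auto intro!: derivative_eq_intros)
  also have "(\<Sum>j=1..r. of_nat j * z ^ (j - 1) / of_nat j) = (\<Sum>j=1..r. z ^ (j - 1))"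
    by (intro sum.cong) auto
  finally show ?thesis by (auto intro!: derivative_eq_intros)
qed

text \<open>
  With f = exp(P) the equation f' = P' f, read off coefficientwise, is the recursion of \<nu>.
\<close>

lemma exp_cycle_polynomial_expansion:
  fixes r :: nat
  defines "f \<equiv> \<lambda>z::complex. exp (\<Sum>j=1..r. z ^ j / of_nat j)"
  shows "f has_fps_expansion Abs_fps (\<lambda>n. of_real (\<nu> n r))"
proof -
  define F where "F = fps_expansion f 0"
  have hol: "f holomorphic_on UNIV"
    unfolding f_def by (intro holomorphic_intros) auto
  have F: "f has_fps_expansion F"
    unfolding F_def by (rule has_fps_expansion_fps_expansion[OF open_UNIV _ hol]) auto
  have "deriv f has_fps_expansion fps_deriv F"
    by (rule has_fps_expansion_deriv[OF F])
  moreover have "deriv f = (\<lambda>z. (\<Sum>j=1..r. z ^ (j - 1)) * f z)"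
    using exp_cycle_polynomial_deriv[of r] unfolding f_def by (intro ext DERIV_imp_deriv)
  moreover have "(\<lambda>z. (\<Sum>j=1..r. z ^ (j - 1)) * f z) has_fps_expansion (\<Sum>j=1..r. fps_X ^ (j - 1)) * F"
    by (intro has_fps_expansion_mult has_fps_expansion_sum has_fps_expansion_fps_X_power F)
  ultimately have eq: "fps_deriv F = (\<Sum>j=1..r. fps_X ^ (j - 1)) * F"
    using fps_expansion_unique_complex by metis
  have "fps_nth F n = of_real (\<nu> n r)" for n
  proof (induction n rule: less_induct)
    case (less n)
    show ?case
    proof (cases n)
      case 0
      have "fps_nth F 0 = f 0" using has_fps_expansion_imp_0_eq_fps_nth_0[OF F] by simp
      also have "(\<Sum>j=1..r. (0::complex) ^ j / of_nat j) = 0" by (intro sum.neutral) auto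
      then have "f 0 = 1" by (simp add: f_def)
      finally show ?thesis by (simp add: 0 nu_0)
    next
      case (Suc m)
      have "of_nat n * fps_nth F n = fps_nth (fps_deriv F) m" by (simp add: Suc)
      also have "\<dots> = (\<Sum>j=1..r. if m < j - 1 then 0 else fps_nth F (m - (j - 1)))"
        unfolding eq sum_distrib_right fps_sum_nth by (intro sum.cong refl) (simp add: fps_X_power_mult_nth)
      also have "\<dots> = (\<Sum>j=1..r. if n < j then 0 else of_real (\<nu> (n - j) r))"
        using Suc by (intro sum.cong refl) (auto simp: less.IH)
      also have "\<dots> = (\<Sum>j\<in>{1..min r n}. of_real (\<nu> (n - j) r))"
        by (intro sum.mono_neutral_cong_right) auto
      also have "\<dots> = of_real (real n * \<nu> n r)" by (simp add: nu_rec)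
      finally show ?thesis by (simp add: Suc del: of_nat_Suc)
    qed
  qed
  then have "F = Abs_fps (\<lambda>n. of_real (\<nu> n r))" by (simp add: fps_eq_iff)
  with F show ?thesis by simp
qed

lemma has_integral_fold_symmetric:
  fixes G :: "real \<Rightarrow> real"
  assumes G: "continuous_on UNIV G" and sym: "\<And>t. G (2 * c - t) = G t" and c: "c \<ge> 0"
    and I: "(G has_integral I) {0..2 * c}"
  shows "(G has_integral (I / 2)) {0..c}"
proof -
  have int: "G integrable_on {a..b}" for a b
    by (intro integrable_continuous_interval continuous_on_subset[OF G]) auto
  obtain i where i: "(G has_integral i) {0..c}" using int by blast
  have "((\<lambda>x. G (- 1 *\<^sub>R x + 2 * c)) has_integral (1 / \<bar>- 1\<bar> ^ DIM(real)) *\<^sub>R i)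
         ((\<lambda>x. (1 / - 1) *\<^sub>R x + - ((1 / - 1) *\<^sub>R (2 * c))) ` cbox 0 c)"
    by (rule has_integral_affinity) (use i in auto)
  moreover have "(\<lambda>x. (1 / - 1) *\<^sub>R x + - ((1 / - 1) *\<^sub>R (2 * c))) ` cbox 0 c = {c..2 * c}"
  proof -
    have "(\<lambda>x. (1 / - 1) *\<^sub>R x + - ((1 / - 1) *\<^sub>R (2 * c))) = (\<lambda>x. 2 * c - x)" by auto
    then show ?thesis using image_diff_atLeastAtMost[of "2 * c" 0 c] by simp
  qed
  moreover have "G (- 1 *\<^sub>R x + 2 * c) = G x" for x
    using sym[of x] by (simp add: algebra_simps)
  ultimately have "(G has_integral i) {c..2 * c}" by simp
  from has_integral_combine[OF _ _ i this] c have "(G has_integral (i + i)) {0..2 * c}" by simp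
  with I have "I = i + i" by (rule has_integral_unique)
  with i show ?thesis by simp
qed

text \<open>
  Cauchy's formula for the n-th coefficient of z f'(z) = zP'(z) f(z), where f = exp(P). The integrands
  at t and at 2\<pi>-t are complex conjugates, so that the integral over the circle is twice the real part
  of the integral over the upper half.
\<close>

lemma nu_integral:
  fixes x :: real
  assumes x: "x > 0"
  shows "((\<lambda>t. Re (exp (\<Sum>j=1..r. (of_real x * cis t) ^ j / of_nat j) *
            (\<Sum>j=1..r. (of_real x * cis t) ^ j) * cis (- (real n * t))))
          has_integral pi * (real n * \<nu> n r * x ^ n)) {0..pi}"
proof -
  define f where "f = (\<lambda>z::complex. exp (\<Sum>j=1..r. z ^ j / of_nat j))"
  define g where "g = (\<lambda>z::complex. \<Sum>j=1..r. z ^ j)"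
  define H where "H = (\<lambda>t. f (of_real x * cis t) * g (of_real x * cis t) * cis (- (real n * t)))"
  have inv: "cis (- (real n * s)) = inverse (cis s ^ n)" for s
    using cis_inverse[of "real n * s"] Complex.DeMoivre[of s n] by simp
  have f': "deriv f = (\<lambda>z. (\<Sum>j=1..r. z ^ (j - 1)) * f z)"
    using exp_cycle_polynomial_deriv[of r] unfolding f_def by (intro ext DERIV_imp_deriv)
  have "z * (\<Sum>j=1..r. z ^ (j - 1)) = g z" for z
    unfolding g_def sum_distrib_left by (intro sum.cong refl) (auto simp flip: power_Suc)
  then have h: "(\<lambda>z. z * deriv f z) = (\<lambda>z. f z * g z)"
    unfolding f' by (metis mult.assoc mult.commute)
  have "f has_fps_expansion Abs_fps (\<lambda>n. of_real (\<nu> n r))"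
    unfolding f_def by (rule exp_cycle_polynomial_expansion)
  then have "(\<lambda>z. z * deriv f z) has_fps_expansion fps_X * fps_deriv (Abs_fps (\<lambda>n. of_real (\<nu> n r)))"
    by (intro has_fps_expansion_mult has_fps_expansion_fps_X has_fps_expansion_deriv)
  from fps_nth_fps_expansion[OF this, of n]
  have coeff: "(deriv ^^ n) (\<lambda>z. f z * g z) 0 / fact n = of_nat n * of_real (\<nu> n r)"
    unfolding h by (cases n) (auto simp: fps_X_mult_nth)
  have "((\<lambda>u. (f u * g u) / (u - 0) ^ (Suc n)) has_contour_integral
      ((2 * pi * \<i>) / (fact n) * (deriv ^^ n) (\<lambda>z. f z * g z) 0)) (circlepath 0 x)"
    unfolding f_def g_def using x
    by (intro Cauchy_has_contour_integral_higher_derivative_circlepath continuous_intros holomorphic_intros) auto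
  then have "((\<lambda>t. f (x * cis t) * g (x * cis t) / (x * cis t) ^ Suc n * x * \<i> * cis t) has_integral
      ((2 * pi * \<i>) * (of_nat n * of_real (\<nu> n r)))) {0..2 * pi}"
    unfolding circlepath_def by (simp add: has_contour_integral_part_circlepath_iff flip: coeff)
  from has_integral_mult_right[OF this, of "- \<i> * of_real x ^ n"]
  have "((\<lambda>t. (- \<i> * of_real x ^ n) * (f (x * cis t) * g (x * cis t) / (x * cis t) ^ Suc n * x * \<i> * cis t)) has_integral
      (of_real (2 * pi * (real n * \<nu> n r * x ^ n)))) {0..2 * pi}" by (simp add: mult_ac)
  moreover have "(- \<i> * of_real x ^ n) * (f (x * cis t) * g (x * cis t) / (x * cis t) ^ Suc n * x * \<i> * cis t) = H t" for t
    using x unfolding H_def inv by (simp add: field_simps power_mult_distrib)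
  ultimately have "(H has_integral (of_real (2 * pi * (real n * \<nu> n r * x ^ n)))) {0..2 * pi}" by simp
  from has_integral_linear[OF this bounded_linear_Re]
  have "((\<lambda>t. Re (H t)) has_integral (2 * pi * (real n * \<nu> n r * x ^ n))) {0..2 * pi}" by (simp add: o_def)
  moreover have "Re (H (2 * pi - t)) = Re (H t)" for t
  proof -
    have c: "cis (2 * pi - t) = cnj (cis t)" by (simp add: complex_eq_iff)
    have "cis (- (real n * (2 * pi - t))) = cnj (cis (- (real n * t)))"
      unfolding inv c by simp
    moreover have "f (of_real x * cis (2 * pi - t)) = cnj (f (of_real x * cis t))"
      unfolding f_def c by (simp add: exp_cnj)
    moreover have "g (of_real x * cis (2 * pi - t)) = cnj (g (of_real x * cis t))"
      unfolding g_def c by simp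
    ultimately have "H (2 * pi - t) = cnj (H t)" unfolding H_def by simp
    then show ?thesis by simp
  qed
  moreover have "continuous_on UNIV (\<lambda>t. Re (H t))"
    unfolding H_def f_def g_def by (intro continuous_intros ballI) auto
  ultimately have "((\<lambda>t. Re (H t)) has_integral (2 * pi * (real n * \<nu> n r * x ^ n)) / 2) {0..pi}"
    by (intro has_integral_fold_symmetric) auto
  moreover have "(2 * pi * (real n * \<nu> n r * x ^ n)) / 2 = pi * (real n * \<nu> n r * x ^ n)" by simp
  ultimately show ?thesis unfolding H_def f_def g_def by (simp only:)
qed

section \<open>The saddle point\<close>

text \<open>
  The first moment of the weights x^j, and the second derivative of P(e^y) with respect to
  y = log x: the reciprocal of the variance of the Gaussian that approximates the integrand.
\<close>

definition first_moment :: "nat \<Rightarrow> real \<Rightarrow> real" where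
  "first_moment r x = (\<Sum>j=1..r. real j * x ^ j)"

locale saddle_point =
  fixes n r :: nat and x u :: real
  assumes u_eq: "u = real n / real r" and r_ge_1: "1 \<le> r" and r_le_n: "r \<le> n" and x_pos: "x > 0"
    and saddle: "(\<Sum>j=1..r. x ^ j) = real n"
begin

abbreviation \<Lambda> :: real where "\<Lambda> \<equiv> first_moment r x"

lemma n_ge_1: "n \<ge> 1" using r_ge_1 r_le_n by linarith

lemma u_ge_1: "u \<ge> 1"
  using r_ge_1 r_le_n by (simp add: u_eq)

lemma x_ge_1: "x \<ge> 1"
proof (rule ccontr)
  assume "\<not> x \<ge> 1"
  then have "x < 1" by simp
  have "(\<Sum>j=1..r. x ^ j) < (\<Sum>j=1..r. 1)"
    using r_ge_1 x_pos \<open>x < 1\<close> by (intro sum_strict_mono power_Suc_less_one) (auto simp: power_less_one_iff)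
  then show False using saddle r_le_n by simp
qed

lemma x_power_exp: "x ^ j = exp (real j * ln x)"
  using x_pos by (simp add: exp_of_nat_mult)

lemma sum_centred: "(\<Sum>j=1..r. real j - (real r + 1) / 2) = 0"
proof -
  have "(\<Sum>j=1..m. real j) = real m * (real m + 1) / 2" for m
    by (induction m) (auto simp: field_simps)
  moreover have "(\<Sum>j=1..r. real j - (real r + 1) / 2) = (\<Sum>j=1..r. real j) - real r * ((real r + 1) / 2)"
    by (simp add: sum_subtractf)
  ultimately show ?thesis by simp
qed

text \<open>
  The weights x^j have arithmetic mean u and geometric mean x^((r+1)/2). The inequality between the
  means, proved here with e^a \<ge> 1+a, bounds x by about u^(2/r), also when r is small.
\<close>

lemma geometric_mean_le: "exp ((real r + 1) * ln x / 2) \<le> u"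
proof -
  define m where "m = (real r + 1) / 2"
  have "exp (m * ln x) * (1 + (real j - m) * ln x) \<le> x ^ j" for j
  proof -
    have "exp (m * ln x) * (1 + (real j - m) * ln x) \<le> exp (m * ln x) * exp ((real j - m) * ln x)"
      by (intro mult_left_mono exp_ge_add_one_self) auto
    also have "\<dots> = x ^ j" unfolding x_power_exp by (simp add: algebra_simps flip: exp_add)
    finally show ?thesis .
  qed
  then have "(\<Sum>j=1..r. exp (m * ln x) * (1 + (real j - m) * ln x)) \<le> real n"
    unfolding saddle[symmetric] by (intro sum_mono)
  also have "(\<Sum>j=1..r. exp (m * ln x) * (1 + (real j - m) * ln x))
      = exp (m * ln x) * (real r + (\<Sum>j=1..r. real j - m) * ln x)"
    by (simp add: sum.distrib flip: sum_distrib_left sum_distrib_right)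
  also have "\<dots> = exp (m * ln x) * real r" using sum_centred by (simp add: m_def)
  finally show ?thesis using r_ge_1 by (simp add: m_def u_eq field_simps)
qed

text \<open>
  Both j and x^j increase with j, so that their average product is at least the product of their
  averages (Chebyshev). Together with the trivial upper bound this fixes the size of the first moment
  as rn up to a factor of 2.
\<close>

lemma first_moment_lower: "\<Lambda> \<ge> real r * real n / 2"
proof -
  define m where "m = (real r + 1) / 2"
  have "(real j - m) * exp (m * ln x) \<le> (real j - m) * x ^ j" for j
  proof (cases "real j \<ge> m")
    case True
    then show ?thesis unfolding x_power_exp using x_ge_1
      by (intro mult_left_mono) (auto intro!: mult_right_mono)
  next
    case False
    then show ?thesis unfolding x_power_exp using x_ge_1
      by (intro mult_left_mono_neg) (auto intro!: mult_right_mono)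
  qed
  then have "(\<Sum>j=1..r. (real j - m) * exp (m * ln x)) \<le> (\<Sum>j=1..r. (real j - m) * x ^ j)"
    by (intro sum_mono)
  also have "(\<Sum>j=1..r. (real j - m) * exp (m * ln x)) = 0"
    using sum_centred by (simp add: m_def flip: sum_distrib_right)
  also have "(\<Sum>j=1..r. (real j - m) * x ^ j) = \<Lambda> - m * real n"
    unfolding first_moment_def saddle[symmetric] by (simp add: left_diff_distrib sum_subtractf sum_distrib_left)
  finally have "\<Lambda> \<ge> m * real n" by simp
  moreover have "m * real n \<ge> real r * real n / 2" by (simp add: m_def field_simps)
  ultimately show ?thesis by linarith
qed

lemma first_moment_upper: "\<Lambda> \<le> real r * real n"
  unfolding first_moment_def saddle[symmetric] sum_distrib_left
  using x_pos by (intro sum_mono mult_right_mono) auto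

lemma first_moment_pos: "\<Lambda> > 0"
proof -
  have "real r * real n / 2 > 0" using r_ge_1 n_ge_1 by simp
  with first_moment_lower show ?thesis by linarith
qed

text \<open>
  With z = x e^(it), the phase is P(z) - P(x) - int, and the weight is zP'(z). The integrand is thus the
  real part of that of Cauchy's formula, divided by the value at t = 0.
\<close>

definition phase :: "real \<Rightarrow> complex" where
  "phase t = (\<Sum>j=1..r. of_real (x ^ j / real j) * (cis (real j * t) - 1)) - \<i> * of_real (real n * t)"

definition weight :: "real \<Rightarrow> complex" where
  "weight t = (\<Sum>j=1..r. of_real (x ^ j) * cis (real j * t))"

definition integrand :: "real \<Rightarrow> real" where
  "integrand t = Re (exp (phase t) * weight t) / real n"

lemma norm_weight_le: "norm (weight t) \<le> real n"
  unfolding weight_def saddle[symmetric] using x_pos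
  by (intro sum_norm_le) (simp add: norm_mult norm_power)

lemma Re_phase: "Re (phase t) = - (\<Sum>j=1..r. x ^ j / real j * (1 - cos (real j * t)))"
proof -
  have "Re (phase t) = (\<Sum>j=1..r. x ^ j / real j * (cos (real j * t) - 1))"
    unfolding phase_def by (simp del: of_real_divide of_real_power)
  also have "\<dots> = (\<Sum>j=1..r. - (x ^ j / real j * (1 - cos (real j * t))))"
    by (intro sum.cong refl) (simp only: mult_minus_right[symmetric] minus_diff_eq)
  finally show ?thesis by (simp only: sum_negf)
qed

end

section \<open>The integrand near the positive real axis\<close>

lemma Re_of_real_mult: "Re (of_real a * z) = a * Re z"
  by simp

lemma cis_Taylor_1: "norm (cis a - 1 - \<i> * of_real a) \<le> a\<^sup>2"
  using Taylor_exp[of "\<i> * of_real a" 1] by (simp add: cis_conv_exp norm_mult algebra_simps power2_eq_square abs_mult_self_eq)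

lemma cis_Taylor_2: "norm (cis a - 1 - \<i> * of_real a + of_real (a\<^sup>2 / 2)) \<le> \<bar>a\<bar> ^ 3 / 2"
  using Taylor_exp[of "\<i> * of_real a" 2]
  by (simp add: cis_conv_exp norm_mult algebra_simps power_mult_distrib eval_nat_numeral)

lemma cis_Taylor_3: "norm (cis a - 1 - \<i> * of_real a + of_real (a\<^sup>2 / 2) + \<i> * of_real (a ^ 3 / 6)) \<le> a ^ 4 / 6"
  using Taylor_exp[of "\<i> * of_real a" 3]
  by (simp add: cis_conv_exp norm_mult algebra_simps power_mult_distrib eval_nat_numeral)

text \<open>
  The sine is concave on [0,\<pi>], so that it lies above its chord from 0 to \<pi>/2.
\<close>

lemma sin_half_ge:
  assumes "0 \<le> t" "t \<le> pi"
  shows "sin (t / 2) \<ge> t / pi"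
proof -
  have "concave_on {0..pi} sin"
    by (rule f''_le0_imp_concave) (auto intro!: derivative_eq_intros sin_ge_zero)
  from concave_onD[OF this, of "t / pi" 0 "pi / 2"] show ?thesis using assms by (simp add: field_simps)
qed

lemma one_minus_cos_ge:
  assumes "\<bar>a\<bar> \<le> pi"
  shows "1 - cos a \<ge> a\<^sup>2 / 8"
proof -
  have "sin (\<bar>a\<bar> / 2) \<ge> \<bar>a\<bar> / pi" using assms by (intro sin_half_ge) auto
  moreover have "\<bar>a\<bar> / pi \<ge> \<bar>a\<bar> / 4" using pi_less_4 by (intro divide_left_mono) auto
  ultimately have "sin (\<bar>a\<bar> / 2) \<ge> \<bar>a\<bar> / 4" by linarith
  then have "(sin (\<bar>a\<bar> / 2))\<^sup>2 \<ge> (\<bar>a\<bar> / 4)\<^sup>2" by (intro power_mono) auto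
  moreover have "cos a = 1 - 2 * (sin (\<bar>a\<bar> / 2))\<^sup>2"
    using cos_double_sin[of "\<bar>a\<bar> / 2"] by simp
  ultimately show ?thesis by (simp add: power2_eq_square)
qed

text \<open>
  A single term of the exponential series. It absorbs a power of s into an arbitrarily slow exponential,
  at the cost of a constant.
\<close>

lemma power_le_fact_exp:
  assumes "(s::real) \<ge> 0" "c > 0"
  shows "s ^ k \<le> fact k * c ^ k * exp (s / c)"
proof -
  have "(s / c) ^ k / fact k \<le> exp (s / c)"
  proof -
    have "(\<Sum>n\<in>{k}. (s / c) ^ n /\<^sub>R fact n) \<le> exp (s / c)"
      unfolding exp_def using assms by (intro sum_le_suminf summable_exp_generic) auto
    then show ?thesis by (simp add: field_simps)
  qed
  then show ?thesis using assms by (simp add: field_simps)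
qed

lemma fourth_power_weight:
  fixes a t X :: real
  assumes "a > 0"
  shows "X / a * ((a * t) ^ 4 / 6) = (a\<^sup>2 * t ^ 4 / 6) * (a * X)"
proof -
  have "(a * t) ^ 4 = a * (a\<^sup>2 * t ^ 4 * a)" by algebra
  then show ?thesis using assms by simp
qed

lemma norm_of_real_mult_le:
  fixes z :: complex
  assumes "p \<ge> 0" "norm z \<le> q"
  shows "norm (of_real p * z) \<le> p * q"
  using assms by (simp add: norm_mult mult_left_mono)

context saddle_point
begin

text \<open>
  The linear term of the phase vanishes because x is the saddle point. The cubic term of the phase and
  the linear term of the weight are purely imaginary, so that in the real part they contribute only
  through their product. In terms of s, every remaining error is a power of s times r/n or r^2 divided
  by the first moment; the latter is at most 2r/n.
\<close>

lemma integrand_near_0: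
  assumes t: "0 \<le> t" "t \<le> pi / real r"
  shows "\<bar>integrand t - exp (- (\<Lambda> * t\<^sup>2 / 2))\<bar> \<le> 2000000 * (real r / real n) * exp (- (\<Lambda> * t\<^sup>2 / 16))"
proof -
  define s where "s = \<Lambda> * t\<^sup>2"
  \<comment> \<open>The phase is - s/2 + h, where h is the imaginary cubic term \<i>c up to an error of fourth order.\<close>
  define \<mu> where "\<mu> = (\<Sum>j=1..r. real j ^ 2 * x ^ j)"
  define \<delta> where "\<delta> = real r / real n"
  define b where "b = (real r)\<^sup>2 / \<Lambda>"
  define c where "c = - (\<mu> * t ^ 3 / 6)"
  define h where "h = phase t + of_real (s / 2)"
  have n: "real n > 0" and r: "real r > 0" using n_ge_1 r_ge_1 by auto
  have lam: "\<Lambda> > 0" by (rule first_moment_pos)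
  have s0: "s \<ge> 0" using lam by (simp add: s_def)
  have d: "0 < \<delta>" "\<delta> \<le> 1" using r n r_le_n by (auto simp: \<delta>_def)
  have b: "0 \<le> b" "b \<le> 2 * \<delta>"
  proof -
    have "b \<le> (real r)\<^sup>2 / (real r * real n / 2)"
      unfolding b_def using first_moment_lower r n lam by (intro divide_left_mono mult_pos_pos) auto
    then show "b \<le> 2 * \<delta>" using r n by (simp add: \<delta>_def power2_eq_square field_simps)
    show "0 \<le> b" using lam by (simp add: b_def)
  qed
  have mu: "0 \<le> \<mu>" "\<mu> \<le> real r * \<Lambda>"
  proof -
    show "0 \<le> \<mu>" using x_pos by (auto simp: \<mu>_def intro!: sum_nonneg)
    show "\<mu> \<le> real r * \<Lambda>" unfolding \<mu>_def first_moment_def sum_distrib_left using x_pos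
      by (intro sum_mono) (auto simp: power2_eq_square intro!: mult_right_mono)
  qed
  have hsum: "h = (\<Sum>j=1..r. of_real (x ^ j / real j) *
      (cis (real j * t) - 1 - \<i> * of_real (real j * t) + of_real ((real j * t)\<^sup>2 / 2)))"
  proof -
    have "of_real (x ^ j / real j) * (\<i> * of_real (real j * t)) = \<i> * of_real (x ^ j * t)"
      and "of_real (x ^ j / real j) * (of_real ((real j * t)\<^sup>2 / 2)) = (of_real (real j * x ^ j * t\<^sup>2 / 2) :: complex)"
      if "j \<in> {1..r}" for j
      using that by (auto simp: power2_eq_square)
    then have "(\<Sum>j=1..r. of_real (x ^ j / real j) *
        (cis (real j * t) - 1 - \<i> * of_real (real j * t) + of_real ((real j * t)\<^sup>2 / 2)))
      = (\<Sum>j=1..r. of_real (x ^ j / real j) * (cis (real j * t) - 1) - \<i> * of_real (x ^ j * t)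
          + of_real (real j * x ^ j * t\<^sup>2 / 2))"
      by (intro sum.cong refl) (simp only: distrib_left right_diff_distrib)
    also have "\<dots> = (\<Sum>j=1..r. of_real (x ^ j / real j) * (cis (real j * t) - 1))
        - \<i> * of_real ((\<Sum>j=1..r. x ^ j) * t) + of_real ((\<Sum>j=1..r. real j * x ^ j) * t\<^sup>2 / 2)"
      by (simp add: sum.distrib sum_subtractf sum_distrib_left sum_distrib_right sum_divide_distrib)
    also have "\<dots> = h"
      unfolding h_def phase_def s_def first_moment_def saddle by simp
    finally show ?thesis ..
  qed
  have h_norm: "norm h \<le> real r * \<Lambda> * t ^ 3 / 2"
  proof -
    have "norm h \<le> (\<Sum>j=1..r. (x ^ j / real j) * ((real j * t) ^ 3 / 2))"
      unfolding hsum
    proof (intro sum_norm_le)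
      fix j assume "j \<in> {1..r}"
      show "norm (of_real (x ^ j / real j) *
        (cis (real j * t) - 1 - \<i> * of_real (real j * t) + of_real ((real j * t)\<^sup>2 / 2)))
        \<le> (x ^ j / real j) * ((real j * t) ^ 3 / 2)"
        using norm_of_real_mult_le[OF _ cis_Taylor_2[of "real j * t"], of "x ^ j / real j"] x_pos t(1)
        by (simp only: abs_of_nonneg mult_nonneg_nonneg of_nat_0_le_iff zero_le_power divide_nonneg_nonneg less_imp_le)
    qed
    also have "\<dots> = \<mu> * t ^ 3 / 2"
      unfolding \<mu>_def sum_distrib_right sum_divide_distrib
      by (intro sum.cong refl) (simp add: field_simps power2_eq_square power3_eq_cube)
    also have "\<dots> \<le> real r * \<Lambda> * t ^ 3 / 2" using mu t by (intro divide_right_mono mult_right_mono) auto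
    finally show ?thesis .
  qed
  have h_sq: "(norm h)\<^sup>2 \<le> b * s ^ 3 / 4"
  proof -
    have "(norm h)\<^sup>2 \<le> (real r * \<Lambda> * t ^ 3 / 2)\<^sup>2" using h_norm by (intro power_mono) auto
    also have "\<dots> = b * s ^ 3 / 4" using lam
      by (simp add: b_def s_def field_simps power2_eq_square eval_nat_numeral)
    finally show ?thesis .
  qed
  have h4: "norm (h - \<i> * of_real c) \<le> b * s\<^sup>2 / 6"
  proof -
    have eq: "h - \<i> * of_real c = (\<Sum>j=1..r. of_real (x ^ j / real j) *
      (cis (real j * t) - 1 - \<i> * of_real (real j * t) + of_real ((real j * t)\<^sup>2 / 2)
        + \<i> * of_real ((real j * t) ^ 3 / 6)))"
    proof -
      have "\<i> * of_real c = - (\<Sum>j=1..r. of_real (x ^ j / real j) * (\<i> * of_real ((real j * t) ^ 3 / 6)))"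
        unfolding c_def \<mu>_def sum_distrib_right sum_divide_distrib of_real_minus of_real_sum
          mult_minus_right sum_distrib_left neg_equal_iff_equal
        by (intro sum.cong refl) (auto simp: power2_eq_square power3_eq_cube)
      then show ?thesis unfolding hsum by (simp add: sum.distrib distrib_left)
    qed
    have "norm (h - \<i> * of_real c) \<le> (\<Sum>j=1..r. (x ^ j / real j) * ((real j * t) ^ 4 / 6))"
      unfolding eq
    proof (intro sum_norm_le)
      fix j assume "j \<in> {1..r}"
      show "norm (of_real (x ^ j / real j) * (cis (real j * t) - 1 - \<i> * of_real (real j * t)
          + of_real ((real j * t)\<^sup>2 / 2) + \<i> * of_real ((real j * t) ^ 3 / 6)))
        \<le> (x ^ j / real j) * ((real j * t) ^ 4 / 6)"
        using x_pos by (intro norm_of_real_mult_le[OF _ cis_Taylor_3]) simp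
    qed
    also have "\<dots> \<le> (\<Sum>j=1..r. ((real r)\<^sup>2 * t ^ 4 / 6) * (real j * x ^ j))"
    proof (intro sum_mono)
      fix j assume j: "j \<in> {1..r}"
      have "(x ^ j / real j) * ((real j * t) ^ 4 / 6) = ((real j)\<^sup>2 * t ^ 4 / 6) * (real j * x ^ j)"
        using j by (intro fourth_power_weight) simp
      also have "\<dots> \<le> ((real r)\<^sup>2 * t ^ 4 / 6) * (real j * x ^ j)"
        using j x_pos t by (intro mult_right_mono divide_right_mono power_mono) auto
      finally show "(x ^ j / real j) * ((real j * t) ^ 4 / 6) \<le> ((real r)\<^sup>2 * t ^ 4 / 6) * (real j * x ^ j)" .
    qed
    also have "\<dots> = ((real r)\<^sup>2 * t ^ 4 / 6) * \<Lambda>"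
      by (simp only: first_moment_def sum_distrib_left)
    also have "\<dots> = b * s\<^sup>2 / 6"
    proof -
      have "s\<^sup>2 = \<Lambda> * (\<Lambda> * t ^ 4)" unfolding s_def by algebra
      then show ?thesis using lam by (simp add: b_def)
    qed
    finally show ?thesis .
  qed
  \<comment> \<open>Since jt \<le> \<pi> for all j \<le> r, the bound for 1 - cos holds in every term. It is what keeps the
      errors below multiplied by a Gaussian, although h itself need not be small.\<close>
  have Re_f: "Re (phase t) \<le> - s / 8"
  proof -
    have "(\<Sum>j=1..r. x ^ j / real j * ((real j * t)\<^sup>2 / 8)) \<le> (\<Sum>j=1..r. x ^ j / real j * (1 - cos (real j * t)))"
    proof (intro sum_mono mult_left_mono one_minus_cos_ge)
      fix j assume j: "j \<in> {1..r}"
      have "real j * t \<le> real r * (pi / real r)" using j t by (intro mult_mono) auto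
      then show "\<bar>real j * t\<bar> \<le> pi" using t(1) r by simp
    qed (use x_pos in auto)
    also have "(\<Sum>j=1..r. x ^ j / real j * ((real j * t)\<^sup>2 / 8)) = s / 8"
      unfolding s_def first_moment_def sum_distrib_right sum_divide_distrib
      by (intro sum.cong refl) (simp add: field_simps power2_eq_square)
    finally show ?thesis by (simp add: Re_phase)
  qed
  \<comment> \<open>Hence the remainder of the exponential series at h, which involves exp |Re h|, is dominated by
      exp (Re h); this cancels against exp (- s/2) to give exp (Re (phase t)).\<close>
  have Re_h: "Re h \<ge> 0"
  proof -
    have "1 - cos a \<le> a\<^sup>2 / 2" for a :: real
    proof -
      have "(sin (a / 2))\<^sup>2 \<le> (a / 2)\<^sup>2"
        using abs_sin_x_le_abs_x[of "a / 2"] by (simp only: abs_le_square_iff)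
      moreover have "cos a = 1 - 2 * (sin (a / 2))\<^sup>2" using cos_double_sin[of "a / 2"] by simp
      ultimately show ?thesis by (simp add: power2_eq_square)
    qed
    then have "0 \<le> (a\<^sup>2 / 2 - (1 - cos a))" for a :: real by (simp add: field_simps)
    then have "0 \<le> (\<Sum>j=1..r. x ^ j / real j * ((real j * t)\<^sup>2 / 2 - (1 - cos (real j * t))))"
      using x_pos by (intro sum_nonneg mult_nonneg_nonneg) auto
    also have "\<dots> = Re h"
      unfolding hsum Re_sum by (intro sum.cong refl) (simp add: algebra_simps)
    finally show ?thesis .
  qed
  have E1: "norm (exp (phase t) - of_real (exp (- s / 2)) * (1 + \<i> * of_real c)) \<le> exp (- s / 8) * (b * s ^ 3 / 4 + b * s\<^sup>2 / 6)"
  proof -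
    have "exp (phase t) = of_real (exp (- s / 2)) * exp h"
      unfolding h_def exp_of_real[symmetric] exp_add[symmetric] by simp
    then have "exp (phase t) - of_real (exp (- s / 2)) * (1 + \<i> * of_real c)
      = of_real (exp (- s / 2)) * ((exp h - (1 + h)) + (h - \<i> * of_real c))"
      by (simp only: right_diff_distrib[symmetric]) (simp add: algebra_simps)
    then have "norm (exp (phase t) - of_real (exp (- s / 2)) * (1 + \<i> * of_real c))
      = exp (- s / 2) * norm ((exp h - (1 + h)) + (h - \<i> * of_real c))"
      by (simp only: norm_mult norm_of_real abs_exp_cancel)
    also have "\<dots> \<le> exp (- s / 2) * (exp (Re h) * (b * s ^ 3 / 4) + exp (Re h) * (b * s\<^sup>2 / 6))"
    proof (intro mult_left_mono norm_triangle_le add_mono)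
      have "norm (exp h - (1 + h)) \<le> exp (Re h) * (norm h)\<^sup>2"
        using Taylor_exp[of h 1] Re_h by (simp add: power2_eq_square)
      also have "\<dots> \<le> exp (Re h) * (b * s ^ 3 / 4)" using h_sq by (intro mult_left_mono) auto
      finally show "norm (exp h - (1 + h)) \<le> exp (Re h) * (b * s ^ 3 / 4)" .
      have "1 * (b * s\<^sup>2 / 6) \<le> exp (Re h) * (b * s\<^sup>2 / 6)"
        using Re_h b by (intro mult_right_mono) auto
      then show "norm (h - \<i> * of_real c) \<le> exp (Re h) * (b * s\<^sup>2 / 6)" using h4 by simp
    qed auto
    also have "\<dots> = exp (Re (phase t)) * (b * s ^ 3 / 4 + b * s\<^sup>2 / 6)"
    proof -
      have "exp (Re (phase t)) = exp (- s / 2) * exp (Re h)" by (simp add: h_def flip: exp_add)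
      then show ?thesis by (simp only: distrib_left mult.assoc)
    qed
    also have "\<dots> \<le> exp (- s / 8) * (b * s ^ 3 / 4 + b * s\<^sup>2 / 6)"
      using Re_f b s0 by (intro mult_right_mono) auto
    finally show ?thesis .
  qed
  \<comment> \<open>The same for the weight, of which only the constant and the linear term are kept.\<close>
  define g2 where "g2 = weight t - of_real (real n) - \<i> * of_real (\<Lambda> * t)"
  have g2: "norm g2 \<le> real r * s"
  proof -
    have eq: "g2 = (\<Sum>j=1..r. of_real (x ^ j) * (cis (real j * t) - 1 - \<i> * of_real (real j * t)))"
      unfolding g2_def weight_def saddle[symmetric] first_moment_def
      by (simp add: sum_subtractf sum_distrib_left sum_distrib_right right_diff_distrib mult_ac)
    have "norm g2 \<le> (\<Sum>j=1..r. x ^ j * (real j * t)\<^sup>2)"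
      unfolding eq
    proof (intro sum_norm_le)
      fix j assume "j \<in> {1..r}"
      show "norm (of_real (x ^ j) * (cis (real j * t) - 1 - \<i> * of_real (real j * t))) \<le> x ^ j * (real j * t)\<^sup>2"
        using x_pos by (intro norm_of_real_mult_le[OF _ cis_Taylor_1]) simp
    qed
    also have "\<dots> = \<mu> * t\<^sup>2" unfolding \<mu>_def sum_distrib_right
      by (intro sum.cong refl) (simp add: power_mult_distrib)
    also have "\<dots> \<le> real r * s" using mu by (simp add: s_def mult_right_mono flip: mult.assoc)
    finally show ?thesis .
  qed
  have c1: "\<bar>c\<bar> \<le> real r * \<Lambda> * t ^ 3 / 6"
    using mu t unfolding c_def by (auto simp: abs_mult intro!: divide_right_mono mult_right_mono)
  have c2: "\<bar>c * (\<Lambda> * t)\<bar> \<le> real r * s\<^sup>2 / 6"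
  proof -
    have "\<bar>c * (\<Lambda> * t)\<bar> \<le> (real r * \<Lambda> * t ^ 3 / 6) * (\<Lambda> * t)"
      unfolding abs_mult using c1 lam t by (intro mult_mono) auto
    also have "\<dots> = real r * s\<^sup>2 / 6" unfolding s_def by algebra
    finally show ?thesis .
  qed
  have c3: "\<bar>c\<bar> \<le> 1 + s ^ 3"
  proof -
    have "c\<^sup>2 \<le> (real r * \<Lambda> * t ^ 3 / 6)\<^sup>2" using c1 power_mono[of "\<bar>c\<bar>" _ 2] by simp
    also have "\<dots> = b * (s ^ 3 / 36)" using lam
      by (simp add: b_def s_def field_simps power2_eq_square eval_nat_numeral)
    also have "\<dots> \<le> 2 * (s ^ 3 / 36)" using b d s0 by (intro mult_right_mono) auto
    also have "\<dots> \<le> s ^ 3" using s0 by simp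
    finally have "c\<^sup>2 \<le> s ^ 3" .
    moreover have "0 \<le> (\<bar>c\<bar> - 1)\<^sup>2" by simp
    then have "2 * \<bar>c\<bar> \<le> 1 + c\<^sup>2" by (simp add: power2_eq_square algebra_simps)
    ultimately show ?thesis by linarith
  qed
  have split: "integrand t - exp (- s / 2) =
      Re ((exp (phase t) - of_real (exp (- s / 2)) * (1 + \<i> * of_real c)) * weight t) / real n
      + exp (- s / 2) * (Re ((1 + \<i> * of_real c) * g2) - c * (\<Lambda> * t)) / real n"
  proof -
    have w: "weight t = of_real (real n) + \<i> * of_real (\<Lambda> * t) + g2" by (simp add: g2_def)
    have "Re ((1 + \<i> * of_real c) * weight t) = real n - c * (\<Lambda> * t) + Re ((1 + \<i> * of_real c) * g2)"
      unfolding w by (simp add: algebra_simps)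
    then have "Re ((1 + \<i> * of_real c) * g2) - c * (\<Lambda> * t) = Re ((1 + \<i> * of_real c) * weight t) - real n"
      by linarith
    then have "exp (- s / 2) * (Re ((1 + \<i> * of_real c) * g2) - c * (\<Lambda> * t))
      = exp (- s / 2) * Re ((1 + \<i> * of_real c) * weight t) - exp (- s / 2) * real n"
      by (simp only: right_diff_distrib)
    also have "exp (- s / 2) * Re ((1 + \<i> * of_real c) * weight t)
      = Re (of_real (exp (- s / 2)) * (1 + \<i> * of_real c) * weight t)" 
      by (simp only: mult.assoc Re_of_real_mult)
    finally have "exp (- s / 2) * (Re ((1 + \<i> * of_real c) * g2) - c * (\<Lambda> * t))
      = Re (of_real (exp (- s / 2)) * (1 + \<i> * of_real c) * weight t) - exp (- s / 2) * real n" .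
    then have "Re ((exp (phase t) - of_real (exp (- s / 2)) * (1 + \<i> * of_real c)) * weight t)
      + exp (- s / 2) * (Re ((1 + \<i> * of_real c) * g2) - c * (\<Lambda> * t))
      = Re (exp (phase t) * weight t) - exp (- s / 2) * real n"
      by (simp only: left_diff_distrib minus_complex.sel)
    moreover have "integrand t - exp (- s / 2) = (Re (exp (phase t) * weight t) - exp (- s / 2) * real n) / real n"
      unfolding integrand_def using n by (simp add: diff_divide_distrib)
    ultimately show ?thesis unfolding add_divide_distrib[symmetric] by (simp only:)
  qed
  have A: "\<bar>Re ((exp (phase t) - of_real (exp (- s / 2)) * (1 + \<i> * of_real c)) * weight t) / real n\<bar>
      \<le> exp (- s / 8) * (b * s ^ 3 / 4 + b * s\<^sup>2 / 6)"
  proof -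
    have "\<bar>Re ((exp (phase t) - of_real (exp (- s / 2)) * (1 + \<i> * of_real c)) * weight t)\<bar>
       \<le> norm (exp (phase t) - of_real (exp (- s / 2)) * (1 + \<i> * of_real c)) * norm (weight t)"
      unfolding norm_mult[symmetric] by (rule abs_Re_le_cmod)
    also have "\<dots> \<le> (exp (- s / 8) * (b * s ^ 3 / 4 + b * s\<^sup>2 / 6)) * real n"
      using E1 norm_weight_le b s0 by (intro mult_mono) auto
    finally show ?thesis using n by (simp add: field_simps)
  qed
  have B: "\<bar>exp (- s / 2) * (Re ((1 + \<i> * of_real c) * g2) - c * (\<Lambda> * t)) / real n\<bar>
     \<le> exp (- s / 8) * (\<delta> * ((2 + s ^ 3) * s + s\<^sup>2 / 6))"
  proof -
    have "\<bar>Re ((1 + \<i> * of_real c) * g2)\<bar> \<le> norm (1 + \<i> * of_real c) * norm g2"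
      unfolding norm_mult[symmetric] by (rule abs_Re_le_cmod)
    also have "norm (1 + \<i> * of_real c) \<le> 1 + \<bar>c\<bar>"
      by (rule order_trans[OF norm_triangle_ineq]) (simp add: norm_mult)
    also have "(1 + \<bar>c\<bar>) * norm g2 \<le> (2 + s ^ 3) * (real r * s)"
      using c3 g2 s0 by (intro mult_mono) auto
    finally have "\<bar>Re ((1 + \<i> * of_real c) * g2)\<bar> \<le> (2 + s ^ 3) * (real r * s)"
      by (simp add: mult_right_mono)
    then have "\<bar>Re ((1 + \<i> * of_real c) * g2) - c * (\<Lambda> * t)\<bar> \<le> (2 + s ^ 3) * (real r * s) + real r * s\<^sup>2 / 6"
      using c2 by linarith
    then have "exp (- s / 2) * \<bar>Re ((1 + \<i> * of_real c) * g2) - c * (\<Lambda> * t)\<bar>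
        \<le> exp (- s / 8) * ((2 + s ^ 3) * (real r * s) + real r * s\<^sup>2 / 6)"
      using s0 by (intro mult_mono) auto
    then have "exp (- s / 2) * \<bar>Re ((1 + \<i> * of_real c) * g2) - c * (\<Lambda> * t)\<bar> / real n
        \<le> exp (- s / 8) * ((2 + s ^ 3) * (real r * s) + real r * s\<^sup>2 / 6) / real n"
      by (rule divide_right_mono) simp
    also have "\<dots> = exp (- s / 8) * (\<delta> * ((2 + s ^ 3) * s + s\<^sup>2 / 6))"
      using n by (simp add: \<delta>_def field_simps)
    finally show ?thesis by (simp add: abs_mult)
  qed
  have "\<bar>integrand t - exp (- s / 2)\<bar> \<le> exp (- s / 8) * (b * s ^ 3 / 4 + b * s\<^sup>2 / 6)
      + exp (- s / 8) * (\<delta> * ((2 + s ^ 3) * s + s\<^sup>2 / 6))"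
    unfolding split using A B by linarith
  also have "\<dots> \<le> exp (- s / 8) * (2 * \<delta> * s ^ 3 / 4 + 2 * \<delta> * s\<^sup>2 / 6)
      + exp (- s / 8) * (\<delta> * ((2 + s ^ 3) * s + s\<^sup>2 / 6))"
    using b s0 by (intro add_mono mult_left_mono divide_right_mono mult_right_mono) auto
  also have "\<dots> = exp (- s / 8) * (\<delta> * (s ^ 4 + s ^ 3 / 2 + s ^ 2 / 2 + 2 * s))"
    by (simp add: algebra_simps eval_nat_numeral)
  also have "\<dots> \<le> exp (- s / 8) * (\<delta> * (2000000 * exp (s / 16)))"
  \<comment> \<open>The constant exceeds the sum of the coefficients times k! 16^k; for k = 4 this is 1572864.\<close>
  proof (intro mult_left_mono)
    show "s ^ 4 + s ^ 3 / 2 + s ^ 2 / 2 + 2 * s \<le> 2000000 * exp (s / 16)"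
    proof -
      have "s ^ 4 \<le> 1572864 * exp (s / 16)" "s ^ 3 \<le> 24576 * exp (s / 16)"
        "s\<^sup>2 \<le> 512 * exp (s / 16)" "s \<le> 16 * exp (s / 16)"
        using power_le_fact_exp[OF s0, of 16 4] power_le_fact_exp[OF s0, of 16 3]
          power_le_fact_exp[OF s0, of 16 2] power_le_fact_exp[OF s0, of 16 1]
        by (simp_all add: fact_numeral)
      with exp_ge_zero[of "s / 16"] show ?thesis by linarith
    qed
  qed (use d in auto)
  also have "\<dots> = 2000000 * \<delta> * (exp (- s / 8) * exp (s / 16))" by simp
  also have "exp (- s / 8) * exp (s / 16) = exp (- (s / 16))" by (simp flip: exp_add)
  finally show ?thesis by (simp add: s_def \<delta>_def)
qed

end

section \<open>The integrand away from the real axis\<close>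

text \<open>
  After multiplication by 2 sin(t/2), the cosine sum telescopes. Summation by parts against 1/j is
  carried out by induction; the subtracted 1/m in the bound is what makes the induction step close.
\<close>

lemma sin_sum_bound:
  fixes t :: real
  assumes J: "J \<ge> 1" and m: "J \<le> m"
  shows "(\<Sum>j=Suc J..m. 2 * sin (t / 2) * cos (real j * t) / real j)
      \<le> (sin ((real m + 1 / 2) * t) - 1) / real m + 2 / real J"
  using m
proof (induction m rule: dec_induct)
  case base
  have "sin ((real J + 1 / 2) * t) - 1 \<ge> - 2" using sin_ge_minus_one[of "(real J + 1 / 2) * t"] by linarith
  then have "(sin ((real J + 1 / 2) * t) - 1) / real J \<ge> - 2 / real J"
    by (rule divide_right_mono) simp
  then show ?case by simp
next
  case (step m)
  define a where "a = sin ((real m + 1 / 2) * t)"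
  define b where "b = sin ((real (Suc m) + 1 / 2) * t)"
  have m0: "real m > 0" using step J by simp
  have "2 * sin (t / 2) * cos (real (Suc m) * t) = b - a"
  proof -
    have "(real (Suc m) + 1 / 2) * t = real (Suc m) * t + t / 2" "(real m + 1 / 2) * t = real (Suc m) * t - t / 2"
      by (simp_all add: algebra_simps)
    then show ?thesis by (simp only: a_def b_def sin_add sin_diff) simp
  qed
  then have "(\<Sum>j=Suc J..Suc m. 2 * sin (t / 2) * cos (real j * t) / real j)
     = (\<Sum>j=Suc J..m. 2 * sin (t / 2) * cos (real j * t) / real j) + (b - a) / real (Suc m)"
    using step by simp
  also have "\<dots> \<le> (a - 1) / real m + 2 / real J + (b - a) / real (Suc m)"
    using step.IH by (simp add: a_def)
  also have "(a - 1) / real m \<le> (a - 1) / real (Suc m)"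
    using m0 sin_le_one[of "(real m + 1 / 2) * t"]
    by (intro divide_left_mono_neg) (auto simp: a_def)
  finally show ?case by (simp add: b_def diff_divide_distrib)
qed

lemma ln_le_harm_diff:
  assumes J: "J \<ge> 1" "J \<le> m"
  shows "ln (real (Suc m) / real (Suc J)) \<le> (\<Sum>j=Suc J..m. 1 / real j)"
  using J(2)
proof (induction m rule: dec_induct)
  case base
  then show ?case by simp
next
  case (step m)
  have "ln (real (Suc (Suc m)) / real (Suc m)) \<le> real (Suc (Suc m)) / real (Suc m) - 1"
    by (intro ln_le_minus_one) auto
  also have "\<dots> = 1 / real (Suc m)" by (simp add: field_simps)
  finally have "ln (real (Suc (Suc m)) / real (Suc m)) \<le> 1 / real (Suc m)" .
  moreover have "ln (real (Suc (Suc m)) / real (Suc J)) = ln (real (Suc (Suc m)) / real (Suc m)) + ln (real (Suc m) / real (Suc J))"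
    by (simp add: ln_div del: of_nat_Suc)
  ultimately show ?case using step by (simp del: of_nat_Suc)
qed

text \<open>
  The terms with j \<le> \<pi>/t are dropped. In the others the cosines cancel up to a bounded amount, and the
  sum of 1/j over them is log(rt) up to a constant.
\<close>

lemma exp_minus_sum_one_minus_cos_le:
  assumes r: "r \<ge> 1" and t: "0 < t" "t \<le> pi"
  shows "exp (- (\<Sum>j=1..r. (1 - cos (real j * t)) / real j)) \<le> 36 / (real r * t)"
proof -
  define J where "J = nat \<lceil>pi / t\<rceil>"
  have J: "real J \<ge> pi / t" "real J \<le> pi / t + 1"
  proof -
    have "pi / t \<ge> 0" using t by simp
    then show "real J \<ge> pi / t" "real J \<le> pi / t + 1" unfolding J_def by linarith+
  qed
  have pt: "1 \<le> pi / t" using t by simp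
  have J1: "J \<ge> 1" using J(1) pt by linarith
  let ?S = "\<Sum>j=1..r. (1 - cos (real j * t)) / real j"
  have S_nonneg: "?S \<ge> 0" by (intro sum_nonneg divide_nonneg_nonneg) auto
  have pi4: "pi < 4" by (rule pi_less_4)
  show ?thesis
  proof (cases "J \<le> r")
    case False
    then have "real r \<le> pi / t" using J_def by linarith
    then have "real r * t \<le> pi" using t by (simp add: field_simps)
    then have "1 \<le> 36 / (real r * t)" using pi4 t r by (simp add: field_simps)
    moreover have "exp (- ?S) \<le> 1" using S_nonneg by simp
    ultimately show ?thesis by linarith
  next
    case True
    have sin: "sin (t / 2) \<ge> t / pi" using t by (intro sin_half_ge) auto
    then have sin0: "sin (t / 2) > 0" using t by (smt (verit) divide_pos_pos pi_gt_zero)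
    have "(\<Sum>j=Suc J..r. 2 * sin (t / 2) * cos (real j * t) / real j) \<le> 2 / real J"
    proof -
      have "(sin ((real r + 1 / 2) * t) - 1) / real r \<le> 0"
        using sin_le_one[of "(real r + 1 / 2) * t"] by (intro divide_nonpos_nonneg) auto
      then show ?thesis using sin_sum_bound[OF J1 True, of t] by linarith
    qed
    then have "2 * sin (t / 2) * (\<Sum>j=Suc J..r. cos (real j * t) / real j) \<le> 2 / real J"
      by (simp add: sum_distrib_left)
    then have "(\<Sum>j=Suc J..r. cos (real j * t) / real j) \<le> 1 / (real J * sin (t / 2))"
      using sin0 J1 by (simp add: field_simps)
    also have "\<dots> \<le> 1 / (pi / t * (t / pi))"
      using J sin t sin0 J1 by (intro divide_left_mono mult_mono mult_pos_pos) auto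
    also have "\<dots> = 1" using t by simp
    finally have cosum: "(\<Sum>j=Suc J..r. cos (real j * t) / real j) \<le> 1" .
    have "ln (real (Suc r) / real (Suc J)) - 1 \<le> (\<Sum>j=Suc J..r. 1 / real j) - (\<Sum>j=Suc J..r. cos (real j * t) / real j)"
      using ln_le_harm_diff[OF J1 True] cosum by linarith
    also have "\<dots> = (\<Sum>j=Suc J..r. (1 - cos (real j * t)) / real j)"
      by (simp add: sum_subtractf diff_divide_distrib)
    also have "\<dots> \<le> ?S"
      by (intro sum_mono2 divide_nonneg_nonneg) auto
    finally have "- ?S \<le> 1 - ln (real (Suc r) / real (Suc J))" by linarith
    then have "exp (- ?S) \<le> exp (1 - ln (real (Suc r) / real (Suc J)))" by simp
    also have "\<dots> = exp 1 * (real (Suc J) / real (Suc r))" by (simp add: exp_diff field_simps del: of_nat_Suc)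
    also have "\<dots> \<le> 3 * ((12 / t) / real r)"
    proof (intro mult_mono frac_le)
      show "real (Suc J) \<le> 12 / t"
      proof -
        have "real (Suc J) \<le> 3 * (pi / t)" using J pt by simp
        also have "\<dots> \<le> 12 / t" using pi4 t by (simp add: field_simps)
        finally show ?thesis .
      qed
      show "exp 1 \<le> (3::real)" using exp_le by simp
    qed (use t r in auto)
    also have "\<dots> = 36 / (real r * t)" using t by simp
    finally show ?thesis .
  qed
qed

text \<open>
  The function sinh(s)/s increases for s \<ge> 0.
\<close>

lemma sinh_mult_le:
  fixes s :: real
  assumes "s \<ge> 0" "\<theta> \<ge> 1"
  shows "\<theta> * sinh s \<le> sinh (\<theta> * s)"
proof -
  have "sinh (\<theta> * 0) - \<theta> * sinh 0 \<le> sinh (\<theta> * s) - \<theta> * sinh s"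
  proof (rule DERIV_nonneg_imp_nondecreasing[OF assms(1)])
    fix y :: real assume y: "0 \<le> y" "y \<le> s"
    have "y \<le> \<theta> * y" using y assms mult_right_mono[of 1 \<theta> y] by simp
    then have "cosh y \<le> cosh (\<theta> * y)" using y by (subst cosh_real_nonneg_le_iff) auto
    then have "\<theta> * cosh (\<theta> * y) - \<theta> * cosh y \<ge> 0" using assms by simp
    moreover have "((\<lambda>s. sinh (\<theta> * s) - \<theta> * sinh s) has_real_derivative \<theta> * cosh (\<theta> * y) - \<theta> * cosh y) (at y)"
      by (auto intro!: derivative_eq_intros)
    ultimately show "\<exists>d. ((\<lambda>s. sinh (\<theta> * s) - \<theta> * sinh s) has_real_derivative d) (at y) \<and> 0 \<le> d" by blast
  qed
  then show ?thesis by simp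
qed

context saddle_point
begin

text \<open>
  The cube root of u is the scale on which the decay of the integrand is measured; see
  \<open>spread_bound\<close> for its origin.
\<close>

definition v :: real where "v = u powr (1 / 3)"

lemma n_eq_r_mult_u: "real n = real r * u"
  using r_ge_1 by (simp add: u_eq)

lemma v_cubed: "v ^ 3 = u"
proof -
  have "v ^ 3 = u powr (real 3 * (1 / 3))" unfolding v_def by (rule powr_power) (use u_ge_1 in auto)
  then show ?thesis using u_ge_1 by simp
qed

lemma u_eq_v: "u = v * v\<^sup>2"
  using v_cubed by (simp add: power3_eq_cube power2_eq_square)

lemma v_ge_1: "v \<ge> 1"
  unfolding v_def using u_ge_1 by (intro ge_one_powr_ge_zero) auto

lemma norm_circle_point_minus_1: "(norm (of_real x * cis t - 1))\<^sup>2 = (x - 1)\<^sup>2 + 4 * x * (sin (t / 2))\<^sup>2"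
proof -
  have c: "cos t = 1 - 2 * (sin (t / 2))\<^sup>2" using cos_double_sin[of "t / 2"] by simp
  have "(norm (of_real x * cis t - 1))\<^sup>2 = (x * cos t - 1)\<^sup>2 + (x * sin t)\<^sup>2"
    by (simp add: cmod_power2)
  also have "\<dots> = x\<^sup>2 * ((cos t)\<^sup>2 + (sin t)\<^sup>2) - 2 * x * cos t + 1" by algebra
  also have "\<dots> = (x - 1)\<^sup>2 + 2 * x * (1 - cos t)" unfolding sin_cos_squared_add2 by algebra
  finally show ?thesis unfolding c by simp
qed

text \<open>
  With x = e^(2y), the quantity (x-1)/sqrt(x) is 2 sinh y. The growth of sinh(s)/s allows replacing
  (r+1) sinh y by 3 sinh((r+1)y/3), so that r = 2 is the extreme case, and the bound for the geometric mean
  says that e^((r+1)y) is at most u. This is where the exponent 1/3 comes from.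
\<close>

lemma spread_bound:
  assumes "r \<ge> 2"
  shows "real r * (x - 1) \<le> 3 * v * sqrt x"
proof -
  define y where "y = ln x / 2"
  have y0: "y \<ge> 0" using x_ge_1 by (simp add: y_def)
  have sx: "sqrt x = exp y" using x_pos by (simp add: y_def ln_sqrt[symmetric])
  have xx: "x = exp y * exp y" using sx x_pos by (metis abs_of_pos real_sqrt_mult_self)
  have "x - 1 = 2 * sinh y * exp y" unfolding xx sinh_def by (simp add: algebra_simps flip: exp_add)
  moreover have "real r * (2 * sinh y) \<le> 3 * v"
  proof -
    define \<theta> where "\<theta> = (real r + 1) / 3"
    have th: "\<theta> \<ge> 1" using assms by (simp add: \<theta>_def)
    have "real r * (2 * sinh y) \<le> 3 * \<theta> * (2 * sinh y)"
      using y0 by (intro mult_right_mono) (auto simp: \<theta>_def)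
    also have "\<dots> = 6 * (\<theta> * sinh y)" by simp
    also have "\<dots> \<le> 6 * sinh (\<theta> * y)" using sinh_mult_le[OF y0 th] by simp
    also have "\<dots> \<le> 3 * exp (\<theta> * y)" by (simp add: sinh_def)
    also have "exp (\<theta> * y) = exp ((real r + 1) * ln x / 2) powr (1 / 3)"
      by (simp add: powr_def \<theta>_def y_def)
    also have "\<dots> \<le> v" unfolding v_def using geometric_mean_le by (intro powr_mono2) auto
    finally show ?thesis by simp
  qed
  ultimately show ?thesis unfolding sx by (simp add: mult.assoc[symmetric])
qed

lemma x_power_r_ge: "x ^ r \<ge> u"
proof -
  have "real n \<le> (\<Sum>j=1..r. x ^ r)"
    unfolding saddle[symmetric] using x_ge_1 by (intro sum_mono power_increasing) auto
  then show ?thesis using r_ge_1 by (simp add: u_eq field_simps)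
qed

lemma weight_geometric: "weight t = (\<Sum>j=1..r. (of_real x * cis t) ^ j)"
  unfolding weight_def by (intro sum.cong refl) (simp add: power_mult_distrib Complex.DeMoivre)

lemma norm_weight_mult:
  "norm (weight t) * norm (of_real x * cis t - 1) \<le> x * (x ^ r + 1)"
proof -
  let ?z = "of_real x * cis t"
  have "weight t * (?z - 1) = ?z * (?z ^ r - 1)"
  proof -
    have "(\<Sum>j=1..k. z ^ j) * (z - 1) = z * (z ^ k - 1)" for z :: complex and k
      by (induction k) (auto simp: algebra_simps)
    then show ?thesis unfolding weight_geometric .
  qed
  then have "norm (weight t) * norm (?z - 1) = norm ?z * norm (?z ^ r - 1)"
    by (metis norm_mult)
  also have "norm ?z = x" using x_pos by (simp add: norm_mult)
  also have "norm (?z ^ r - 1) \<le> x ^ r + 1"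
    using norm_triangle_ineq4[of "?z ^ r" 1] x_pos by (simp add: norm_mult norm_power)
  finally show ?thesis using x_pos by simp
qed

lemma saddle_geometric: "real n * (x - 1) = x * (x ^ r - 1)"
proof -
  have "(\<Sum>j=1..k. x ^ j) * (x - 1) = x * (x ^ k - 1)" for k
    by (induction k) (auto simp: algebra_simps)
  then show ?thesis unfolding saddle[symmetric] .
qed

text \<open>
  Both the weight and n are geometric sums, so that their quotient is governed by (x-1)/|z-1| with
  z = x e^(it); the remaining factor (x^r+1)/(x^r-1) is close to 1 because x^r \<ge> u.
\<close>

lemma weight_ratio:
  assumes r: "r \<ge> 2" and t: "pi / real r \<le> t" "t \<le> pi" and u2: "u \<ge> 474552"
  shows "(norm (weight t) / real n)\<^sup>2 \<le> (1 + 2 / (u - 1))\<^sup>2 * (9 * v\<^sup>2 / (9 * v\<^sup>2 + 4 * (real r * sin (t / 2))\<^sup>2))"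
proof -
  let ?D = "norm (of_real x * cis t - 1)"
  define \<sigma> where "\<sigma> = sin (t / 2)"
  have n: "real n > 0" "real r > 0" using n_ge_1 r by auto
  have t0: "t > 0" using t n pi_gt_zero by (smt (verit) divide_pos_pos)
  have s0: "\<sigma> > 0" unfolding \<sigma>_def using t t0 by (intro sin_gt_zero) auto
  have x1: "x > 1" 
  proof (rule ccontr)
    assume "\<not> x > 1"
    then have "x = 1" using x_ge_1 by simp
    then have "real n = real r" using saddle by simp
    then show False using u2 n by (simp add: u_eq)
  qed
  have D2: "?D\<^sup>2 = (x - 1)\<^sup>2 + 4 * x * \<sigma>\<^sup>2" unfolding norm_circle_point_minus_1 \<sigma>_def ..
  have D0: "?D\<^sup>2 > 0" unfolding D2 using x1 by (intro add_pos_nonneg) auto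
  have xr: "x ^ r - 1 \<ge> u - 1" using x_power_r_ge by simp
  have "(norm (weight t) / real n)\<^sup>2 * ?D\<^sup>2 = (norm (weight t) * ?D / real n)\<^sup>2"
    by (simp add: power_mult_distrib power_divide)
  also have "\<dots> \<le> (x * (x ^ r + 1) / real n)\<^sup>2"
    using norm_weight_mult by (intro power_mono divide_right_mono) auto
  also have "x * (x ^ r + 1) / real n = (1 + 2 / (x ^ r - 1)) * (x - 1)"
  proof -
    have "x ^ r - 1 > 0" using xr u2 by linarith
    then have "x ^ r + 1 = (1 + 2 / (x ^ r - 1)) * (x ^ r - 1)" by (simp add: field_simps)
    then have "x * (x ^ r + 1) = (1 + 2 / (x ^ r - 1)) * (real n * (x - 1))"
      unfolding saddle_geometric by (simp add: mult_ac)
    then show ?thesis using n by simp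
  qed
  also have "((1 + 2 / (x ^ r - 1)) * (x - 1))\<^sup>2 \<le> ((1 + 2 / (u - 1)) * (x - 1))\<^sup>2"
    using xr u2 x1 by (intro power_mono mult_right_mono add_left_mono divide_left_mono mult_pos_pos) auto
  finally have "(norm (weight t) / real n)\<^sup>2 \<le> ((1 + 2 / (u - 1)) * (x - 1))\<^sup>2 / ?D\<^sup>2"
    using D0 by (simp only: pos_le_divide_eq)
  then have "(norm (weight t) / real n)\<^sup>2 \<le> (1 + 2 / (u - 1))\<^sup>2 * ((x - 1)\<^sup>2 / ?D\<^sup>2)"
    by (simp only: power_mult_distrib times_divide_eq_right)
  moreover have "(x - 1)\<^sup>2 / ?D\<^sup>2 \<le> 9 * v\<^sup>2 / (9 * v\<^sup>2 + 4 * (real r * \<sigma>)\<^sup>2)"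
  proof -
    have "(real r * (x - 1))\<^sup>2 \<le> (3 * v * sqrt x)\<^sup>2"
      using spread_bound[OF r] x1 by (intro power_mono) auto
    then have A: "(real r)\<^sup>2 * (x - 1)\<^sup>2 \<le> 9 * v\<^sup>2 * x"
      using x_pos by (simp add: power_mult_distrib)
    have "(x - 1)\<^sup>2 * (9 * v\<^sup>2 + 4 * (real r * \<sigma>)\<^sup>2) = 9 * v\<^sup>2 * (x - 1)\<^sup>2 + 4 * \<sigma>\<^sup>2 * ((real r)\<^sup>2 * (x - 1)\<^sup>2)"
      by algebra
    also have "\<dots> \<le> 9 * v\<^sup>2 * (x - 1)\<^sup>2 + 4 * \<sigma>\<^sup>2 * (9 * v\<^sup>2 * x)"
      using A by (intro add_left_mono mult_left_mono) auto
    also have "\<dots> = 9 * v\<^sup>2 * ?D\<^sup>2" unfolding D2 by algebra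
    finally have "(x - 1)\<^sup>2 * (9 * v\<^sup>2 + 4 * (real r * \<sigma>)\<^sup>2) \<le> 9 * v\<^sup>2 * ?D\<^sup>2" .
    moreover have "9 * v\<^sup>2 + 4 * (real r * \<sigma>)\<^sup>2 > 0"
      using v_ge_1 by (intro add_pos_nonneg mult_pos_pos zero_less_power) auto
    ultimately show ?thesis using D0 by (simp add: divide_le_eq le_divide_eq mult_ac)
  qed
  ultimately show ?thesis unfolding \<sigma>_def by (meson mult_left_mono order_trans zero_le_power2)
qed

lemma v_ge_78: "u \<ge> 474552 \<Longrightarrow> v \<ge> 78"
proof -
  assume "u \<ge> 474552"
  then have "(78 ^ 3) powr (1 / 3) \<le> v" unfolding v_def by (intro powr_mono2) auto
  then show ?thesis by (simp add: powr_powr flip: powr_numeral)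
qed

text \<open>
  For t \<ge> \<pi>/r the number r sin(t/2) is at least 1, so that the quotient in \<open>weight_ratio\<close> stays below 1 by
  a constant over v^2. The factor (1 + 2/(u-1))^2 eats up a part of this gap; the threshold
  474552 = 78^3 for u leaves the gap 1/(13 v^2) for the square root of the right-hand side.
\<close>

lemma weight_ratio_less_1:
  assumes r: "r \<ge> 2" and t: "pi / real r \<le> t" "t \<le> pi" and u2: "u \<ge> 474552"
  shows "norm (weight t) / real n \<le> 1 - 1 / (13 * v\<^sup>2)"
proof -
  define \<eta> where "\<eta> = 2 / (u - 1)"
  have v: "v \<ge> 78" using v_ge_78[OF u2] .
  have v2: "v\<^sup>2 \<ge> 1" using v by (simp add: one_le_power)
  have r0: "real r > 0" using r by simp
  have t0: "t > 0" using t r0 pi_gt_zero by (smt (verit) divide_pos_pos)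
  have "1 / real r \<le> t / pi" using t r0 by (simp add: field_simps)
  also have "\<dots> \<le> sin (t / 2)" using t t0 by (intro sin_half_ge) auto
  finally have "1 \<le> real r * sin (t / 2)" using r0 by (simp add: field_simps)
  then have rs: "1 \<le> (real r * sin (t / 2))\<^sup>2" by simp
  have eta: "0 \<le> \<eta>" "\<eta> \<le> 1" "3 * \<eta> \<le> 2 / (13 * v\<^sup>2)"
  proof -
    have u1: "u - 1 \<ge> 2" "u - 1 \<ge> u / 2" "u > 0" using u2 by linarith+
    show "0 \<le> \<eta>" unfolding \<eta>_def using u1 by (intro divide_nonneg_nonneg) linarith+
    show "\<eta> \<le> 1" unfolding \<eta>_def using u1 by (subst divide_le_eq_1_pos) linarith+
    have "\<eta> \<le> 2 / (u / 2)" unfolding \<eta>_def using u1 by (intro divide_left_mono mult_pos_pos) linarith+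
    also have "2 / (u / 2) = 4 / u" by simp
    finally have "\<eta> \<le> 4 / u" .
    also have "4 / u = 4 / (v * v\<^sup>2)" by (rule arg_cong[OF u_eq_v])
    also have "\<dots> \<le> 4 / (78 * v\<^sup>2)" using v v2 by (intro divide_left_mono mult_right_mono mult_pos_pos) auto
    finally show "3 * \<eta> \<le> 2 / (13 * v\<^sup>2)" by simp
  qed
  have "(norm (weight t) / real n)\<^sup>2 \<le> (1 + \<eta>)\<^sup>2 * (9 * v\<^sup>2 / (9 * v\<^sup>2 + 4 * (real r * sin (t / 2))\<^sup>2))"
    unfolding \<eta>_def by (rule weight_ratio) (use assms in auto)
  also have "\<dots> \<le> (1 + 3 * \<eta>) * (9 * v\<^sup>2 / (9 * v\<^sup>2 + 4 * 1))"
  proof (intro mult_mono)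
    have "\<eta> * \<eta> \<le> 1 * \<eta>" using eta by (intro mult_right_mono) auto
    then show "(1 + \<eta>)\<^sup>2 \<le> 1 + 3 * \<eta>" by (simp add: power2_eq_square algebra_simps)
    show "9 * v\<^sup>2 / (9 * v\<^sup>2 + 4 * (real r * sin (t / 2))\<^sup>2) \<le> 9 * v\<^sup>2 / (9 * v\<^sup>2 + 4 * 1)"
      using rs v2 by (intro divide_left_mono mult_pos_pos) auto
  qed (use eta in auto)
  also have "9 * v\<^sup>2 / (9 * v\<^sup>2 + 4 * 1) \<le> 1 - 4 / (13 * v\<^sup>2)"
  proof -
    have "9 * v\<^sup>2 / (9 * v\<^sup>2 + 4 * 1) = 1 - 4 / (9 * v\<^sup>2 + 4)" using v2 by (simp add: field_simps)
    also have "\<dots> \<le> 1 - 4 / (13 * v\<^sup>2)" using v2 by (intro diff_left_mono divide_left_mono mult_pos_pos) auto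
    finally show ?thesis .
  qed
  then have "(1 + 3 * \<eta>) * (9 * v\<^sup>2 / (9 * v\<^sup>2 + 4 * 1)) \<le> (1 + 2 / (13 * v\<^sup>2)) * (1 - 4 / (13 * v\<^sup>2))"
    using eta v2 by (intro mult_mono) auto
  also have "\<dots> \<le> (1 - 1 / (13 * v\<^sup>2))\<^sup>2"
  proof -
    define q where "q = 1 / (13 * v\<^sup>2)"
    have "(1 + 2 * q) * (1 - 4 * q) \<le> (1 - q)\<^sup>2" by (simp add: power2_eq_square algebra_simps)
    then show ?thesis by (simp add: q_def)
  qed
  finally have "(norm (weight t) / real n)\<^sup>2 \<le> (1 - 1 / (13 * v\<^sup>2))\<^sup>2" by simp
  moreover have "0 \<le> 1 - 1 / (13 * v\<^sup>2)"
    using v2 divide_le_eq_1_pos[of "13 * v\<^sup>2" 1] by linarith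
  ultimately show ?thesis by (rule power2_le_imp_le)
qed

lemma weight_ratio_decay:
  assumes r: "r \<ge> 2" and t: "pi / real r \<le> t" "t \<le> pi" and u2: "u \<ge> 474552"
  shows "norm (weight t) / real n \<le> 12 * v / (real r * t)"
proof -
  define \<sigma> where "\<sigma> = real r * sin (t / 2)"
  have v: "v \<ge> 78" using v_ge_78[OF u2] .
  have r0: "real r > 0" using r by simp
  have t0: "t > 0" using t r0 pi_gt_zero by (smt (verit) divide_pos_pos)
  have "t / pi \<le> sin (t / 2)" using t t0 by (intro sin_half_ge) auto
  moreover have "t / 4 \<le> t / pi" using t0 pi_less_4 by (intro divide_left_mono) auto
  ultimately have "t / 4 \<le> sin (t / 2)" by linarith
  then have sg: "real r * (t / 4) \<le> \<sigma>" unfolding \<sigma>_def using r0 by (intro mult_left_mono) auto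
  then have s0: "\<sigma> > 0" using r0 t0 by (smt (verit) divide_pos_pos mult_pos_pos)
  have eta: "(1 + 2 / (u - 1))\<^sup>2 \<le> 2\<^sup>2" using u2 by (intro power_mono) auto
  have "(norm (weight t) / real n)\<^sup>2 \<le> (1 + 2 / (u - 1))\<^sup>2 * (9 * v\<^sup>2 / (9 * v\<^sup>2 + 4 * \<sigma>\<^sup>2))"
    unfolding \<sigma>_def by (rule weight_ratio) (use assms in auto)
  also have "\<dots> \<le> 2\<^sup>2 * (9 * v\<^sup>2 / (4 * \<sigma>\<^sup>2))"
    using eta v s0 by (intro mult_mono divide_left_mono mult_pos_pos add_nonneg_pos) auto
  also have "\<dots> = (3 * v / \<sigma>)\<^sup>2" by (simp add: power_divide power_mult_distrib)
  finally have "norm (weight t) / real n \<le> 3 * v / \<sigma>"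
    by (rule power2_le_imp_le) (use v s0 in auto)
  also have "\<dots> \<le> 3 * v / (real r * (t / 4))" using sg r0 t0 v s0 by (intro divide_left_mono mult_pos_pos) auto
  finally show ?thesis by simp
qed

text \<open>
  With S = - Re (phase t), the integrand is at most exp(-S) times the relative weight. There are two lower
  bounds for S: v/13, because replacing 1/j by 1/r bounds rS from below by n minus the real part of the
  weight, and log(rt) up to a constant, because x \<ge> 1. Using each for one half of S gives exp(-v/26), which
  outweighs every power of u, and (rt)^(-1/2), which makes the factor 1/(rt) from the weight integrable
  with a constant independent of r.
\<close>

lemma integrand_tail:
  assumes r: "r \<ge> 2" and t: "pi / real r \<le> t" "t \<le> pi" and u2: "u \<ge> 474552"
  shows "\<bar>integrand t\<bar> \<le> (72 * fact 6 * 26 ^ 6) / (u * sqrt u) * (1 / (real r * t * sqrt (real r * t)))"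
proof -
  define S where "S = (\<Sum>j=1..r. x ^ j / real j * (1 - cos (real j * t)))"
  have n: "real n > 0" "real r > 0" using n_ge_1 r by auto
  have v: "v \<ge> 78" using v_ge_78[OF u2] .
  have t0: "t > 0" using t n pi_gt_zero by (smt (verit) divide_pos_pos)
  have rt: "real r * t > 0" using n t0 by simp
  have S_ge_root: "S \<ge> v / 13"
  proof -
    have "real n * (1 / (13 * v\<^sup>2)) \<le> real n * (1 - norm (weight t) / real n)"
      using weight_ratio_less_1[OF assms] n by (intro mult_left_mono) auto
    also have "\<dots> = real n - norm (weight t)" using n by (simp add: field_simps)
    also have "\<dots> \<le> real n - Re (weight t)" using complex_Re_le_cmod[of "weight t"] by simp
    also have "\<dots> = (\<Sum>j=1..r. x ^ j * (1 - cos (real j * t)))"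
      unfolding weight_def saddle[symmetric] Re_sum Re_of_real_mult
      by (simp add: sum_subtractf right_diff_distrib)
    also have "\<dots> \<le> (\<Sum>j=1..r. real r * (x ^ j / real j * (1 - cos (real j * t))))"
    proof (intro sum_mono)
      fix j assume j: "j \<in> {1..r}"
      have "x ^ j * (1 - cos (real j * t)) = real j * (x ^ j / real j * (1 - cos (real j * t)))" using j by simp
      also have "\<dots> \<le> real r * (x ^ j / real j * (1 - cos (real j * t)))"
        using j x_pos by (intro mult_right_mono mult_nonneg_nonneg) auto
      finally show "x ^ j * (1 - cos (real j * t)) \<le> real r * (x ^ j / real j * (1 - cos (real j * t)))" .
    qed
    also have "\<dots> = real r * S" unfolding S_def by (simp only: sum_distrib_left)
    finally have "real r * (u * (1 / (13 * v\<^sup>2))) \<le> real r * S"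
      using n by (simp only: n_eq_r_mult_u mult.assoc)
    then have "u * (1 / (13 * v\<^sup>2)) \<le> S" using n by (simp only: mult_le_cancel_left_pos)
    moreover have "u * (1 / (13 * v\<^sup>2)) = v * v\<^sup>2 * (1 / (13 * v\<^sup>2))"
      by (rule arg_cong[OF u_eq_v])
    moreover have "v * v\<^sup>2 * (1 / (13 * v\<^sup>2)) = v / 13" using v by simp
    ultimately show ?thesis by simp
  qed
  have S_ge_log: "exp (- S) \<le> 36 / (real r * t)"
  proof -
    have "(\<Sum>j=1..r. (1 - cos (real j * t)) / real j) \<le> S"
      unfolding S_def
    proof (intro sum_mono)
      fix j assume j: "j \<in> {1..r}"
      have "1 * ((1 - cos (real j * t)) / real j) \<le> x ^ j * ((1 - cos (real j * t)) / real j)"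
        using x_ge_1 by (intro mult_right_mono) auto
      then show "(1 - cos (real j * t)) / real j \<le> x ^ j / real j * (1 - cos (real j * t))" by simp
    qed
    then have "exp (- S) \<le> exp (- (\<Sum>j=1..r. (1 - cos (real j * t)) / real j))" by simp
    also have "\<dots> \<le> 36 / (real r * t)" using t t0 r by (intro exp_minus_sum_one_minus_cos_le) auto
    finally show ?thesis .
  qed
  have E: "exp (- S) \<le> exp (- v / 26) * (6 / sqrt (real r * t))"
  proof -
    have "sqrt (exp (- S)) = exp (- S / 2)"
      by (rule real_sqrt_unique) (simp_all add: power2_eq_square flip: exp_add)
    then have "exp (- S) = exp (- S / 2) * sqrt (exp (- S))"
      by (simp flip: exp_add)
    also have "\<dots> \<le> exp (- v / 26) * sqrt (36 / (real r * t))"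
      using S_ge_root S_ge_log by (intro mult_mono) auto
    also have "sqrt (36 / (real r * t)) = 6 / sqrt (real r * t)"
      by (simp add: real_sqrt_divide)
    finally show ?thesis .
  qed
  have V: "exp (- v / 26) * v \<le> fact 6 * 26 ^ 6 / (u * sqrt u)"
  proof -
    have "v ^ 6 \<le> fact 6 * 26 ^ 6 * exp (v / 26)" using v by (intro power_le_fact_exp) auto
    then have "exp (- v / 26) * v ^ 6 \<le> fact 6 * 26 ^ 6" by (simp add: exp_minus field_simps)
    moreover have "u * sqrt u \<le> v ^ 5"
    proof -
      have "sqrt u \<le> v ^ 2"
      proof (rule real_le_lsqrt)
        have "u = v ^ 3" by (simp add: v_cubed)
        also have "\<dots> \<le> v ^ 4" using v by (intro power_increasing) auto
        finally show "u \<le> (v\<^sup>2)\<^sup>2" by simp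
      qed (use v in auto)
      then have "u * sqrt u \<le> v ^ 3 * v\<^sup>2" unfolding v_cubed using u2 by (intro mult_left_mono) auto
      then show ?thesis by (simp flip: power_add)
    qed
    then have "(exp (- v / 26) * v) * (u * sqrt u) \<le> (exp (- v / 26) * v) * v ^ 5"
      using v by (intro mult_left_mono) auto
    moreover have "(exp (- v / 26) * v) * v ^ 5 = exp (- v / 26) * v ^ 6" by (simp add: eval_nat_numeral)
    ultimately have "(exp (- v / 26) * v) * (u * sqrt u) \<le> fact 6 * 26 ^ 6" by linarith
    moreover have "u * sqrt u > 0" using u2 by (intro mult_pos_pos) auto
    ultimately show ?thesis by (simp add: pos_le_divide_eq)
  qed
  have "\<bar>integrand t\<bar> \<le> norm (exp (phase t) * weight t) / real n"
    unfolding integrand_def abs_divide abs_of_nat by (rule divide_right_mono[OF abs_Re_le_cmod]) simp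
  also have "\<dots> = exp (- S) * (norm (weight t) / real n)"
    by (simp add: norm_mult Re_phase S_def)
  also have "\<dots> \<le> (exp (- v / 26) * (6 / sqrt (real r * t))) * (12 * v / (real r * t))"
    using E weight_ratio_decay[OF assms] n rt by (intro mult_mono) auto
  also have "\<dots> = (exp (- v / 26) * v) * (72 / (real r * t * sqrt (real r * t)))" by (simp add: mult_ac)
  also have "\<dots> \<le> (fact 6 * 26 ^ 6 / (u * sqrt u)) * (72 / (real r * t * sqrt (real r * t)))"
    using V rt by (intro mult_right_mono) auto
  finally show ?thesis by (simp add: mult_ac)
qed

end

section \<open>The saddle-point estimate\<close>

lemma has_integral_half_gaussian:
  fixes a :: real
  assumes a: "a > 0"
  shows "((\<lambda>t. exp (- (a * t\<^sup>2))) has_integral sqrt (pi / a) / 2) {0..}"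
proof -
  let ?f = "\<lambda>x::real. indicator {0..} x *\<^sub>R exp (- x\<^sup>2)"
  have "has_bochner_integral lborel (\<lambda>x. ?f (0 + sqrt a * x)) ((sqrt pi / 2) /\<^sub>R \<bar>sqrt a\<bar>)"
    using gaussian_moment_0 a by (subst lborel_has_bochner_integral_real_affine_iff[symmetric]) auto
  also have "(\<lambda>x. ?f (0 + sqrt a * x)) = (\<lambda>x. if x \<in> {0..} then exp (- (a * x\<^sup>2)) else 0)"
    using a by (auto simp: fun_eq_iff indicator_def power_mult_distrib zero_le_mult_iff)
  also have "(sqrt pi / 2) /\<^sub>R \<bar>sqrt a\<bar> = sqrt (pi / a) / 2"
    using a by (simp add: real_sqrt_divide field_simps)
  finally have "has_bochner_integral lborel (\<lambda>x. if x \<in> {0..} then exp (- (a * x\<^sup>2)) else 0) (sqrt (pi / a) / 2)" .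
  then have "integrable lborel (\<lambda>x. if x \<in> {0..} then exp (- (a * x\<^sup>2)) else 0)"
    and val: "integral\<^sup>L lborel (\<lambda>x. if x \<in> {0..} then exp (- (a * x\<^sup>2)) else 0) = sqrt (pi / a) / 2"
    by (simp_all only: has_bochner_integral_iff)
  from has_integral_integral_lborel[OF this(1)] show ?thesis
    unfolding val has_integral_restrict_UNIV .
qed

lemma has_integral_inverse_three_halves:
  fixes c :: real
  assumes c: "c > 0" and ab: "0 < a" "a \<le> b"
  shows "((\<lambda>t. 1 / (c * t * sqrt (c * t))) has_integral (2 / (c * sqrt (c * a)) - 2 / (c * sqrt (c * b)))) {a..b}"
proof -
  have "((\<lambda>t. 1 / (c * t * sqrt (c * t))) has_integral ((- 2 / (c * sqrt (c * b))) - (- 2 / (c * sqrt (c * a))))) {a..b}"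
  proof (rule fundamental_theorem_of_calculus[OF ab(2)])
    fix t assume "t \<in> {a..b}"
    then have t: "t > 0" using ab by auto
    then have ct: "c * t > 0" using c by simp
    define q where "q = sqrt (c * t)"
    have q: "q > 0" "c * t = q * q" using ct by (auto simp: q_def)
    have q': "((\<lambda>t. sqrt (c * t)) has_real_derivative c / (2 * q)) (at t within {a..b})"
    proof -
      have d: "((\<lambda>t. c * t) has_real_derivative c * 1) (at t within {a..b})"
        by (intro DERIV_cmult DERIV_ident)
      have e: "inverse (sqrt (c * t)) / 2 * (c * 1) = c / (2 * q)"
        unfolding q_def[symmetric] using q(1) by (simp add: field_simps)
      show ?thesis
        using DERIV_chain2[of sqrt "inverse (sqrt (c * t)) / 2" "\<lambda>t. c * t" t, OF DERIV_real_sqrt[OF ct] d]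
        unfolding e .
    qed
    have "((\<lambda>t. (- 2 / c) * inverse (sqrt (c * t))) has_real_derivative
        (- 2 / c) * - (inverse q * (c / (2 * q)) * inverse q)) (at t within {a..b})"
      using q' q(1) unfolding q_def by (intro DERIV_cmult DERIV_inverse') auto
    also have "(\<lambda>t. (- 2 / c) * inverse (sqrt (c * t))) = (\<lambda>t. - 2 / (c * sqrt (c * t)))"
      by (simp add: fun_eq_iff field_simps)
    also have "(- 2 / c) * - (inverse q * (c / (2 * q)) * inverse q) = 1 / (c * t * sqrt (c * t))"
      unfolding q_def[symmetric] q(2) using c q(1) by (simp add: field_simps)
    finally have "((\<lambda>t. - 2 / (c * sqrt (c * t))) has_real_derivative 1 / (c * t * sqrt (c * t))) (at t within {a..b})" .
    then show "((\<lambda>t. - 2 / (c * sqrt (c * t))) has_vector_derivative 1 / (c * t * sqrt (c * t))) (at t within {a..b})"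
      by (simp add: has_real_derivative_iff_has_vector_derivative)
  qed
  then show ?thesis by simp
qed

definition saddle_value :: "nat \<Rightarrow> nat \<Rightarrow> real \<Rightarrow> real" where
  "saddle_value n r x = exp (\<Sum>j=1..r. x ^ j / real j) / (x ^ n * sqrt (2 * pi * first_moment r x))"

context saddle_point
begin

lemma saddle_value_pos: "saddle_value n r x > 0"
  unfolding saddle_value_def using x_pos first_moment_pos by simp

lemma has_integral_integrand:
  "(integrand has_integral pi * (\<nu> n r * x ^ n / exp (\<Sum>j=1..r. x ^ j / real j))) {0..pi}"
proof -
  define E where "E = exp (\<Sum>j=1..r. x ^ j / real j)"
  have E0: "E > 0" by (simp add: E_def)
  have n: "real n > 0" using n_ge_1 by simp
  have eq: "exp (\<Sum>j=1..r. (of_real x * cis t) ^ j / of_nat j) * (\<Sum>j=1..r. (of_real x * cis t) ^ j) * cis (- (real n * t))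
      = of_real E * (exp (phase t) * weight t)" for t
  proof -
    have "(\<Sum>j=1..r. (of_real x * cis t) ^ j / of_nat j) + (- (\<i> * of_real (real n * t)))
      = of_real (\<Sum>j=1..r. x ^ j / real j) + phase t"
      unfolding phase_def of_real_sum
      by (simp add: power_mult_distrib Complex.DeMoivre right_diff_distrib sum_subtractf)
    then have "exp (\<Sum>j=1..r. (of_real x * cis t) ^ j / of_nat j) * exp (- (\<i> * of_real (real n * t)))
      = of_real E * exp (phase t)"
      unfolding E_def exp_of_real[symmetric] exp_add[symmetric] by simp
    moreover have "exp (- (\<i> * of_real (real n * t))) = cis (- (real n * t))" by (simp add: cis_conv_exp)
    ultimately have EP: "exp (\<Sum>j=1..r. (of_real x * cis t) ^ j / of_nat j) * cis (- (real n * t)) = of_real E * exp (phase t)"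
      by (simp only:)
    have swap: "a * b * c = (a * c) * b" for a b c :: complex by simp
    show ?thesis unfolding weight_geometric by (subst swap) (simp only: EP mult.assoc)
  qed
  have "((\<lambda>t. Re (of_real E * (exp (phase t) * weight t))) has_integral pi * (real n * \<nu> n r * x ^ n)) {0..pi}"
    using nu_integral[OF x_pos, of r n] unfolding eq .
  from has_integral_mult_right[OF this, of "1 / (E * real n)"]
  have "((\<lambda>t. 1 / (E * real n) * Re (of_real E * (exp (phase t) * weight t))) has_integral
      1 / (E * real n) * (pi * (real n * \<nu> n r * x ^ n))) {0..pi}" .
  moreover have "1 / (E * real n) * Re (of_real E * (exp (phase t) * weight t)) = integrand t" for t
    unfolding integrand_def Re_of_real_mult using E0 by simp
  moreover have "1 / (E * real n) * (pi * (real n * \<nu> n r * x ^ n)) = pi * (\<nu> n r * x ^ n / E)"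
    using n E0 by simp
  ultimately show ?thesis unfolding E_def by simp
qed

lemma sqrt_first_moment_le: "sqrt \<Lambda> \<le> real r * sqrt u"
proof -
  have "sqrt \<Lambda> \<le> sqrt ((real r)\<^sup>2 * u)"
    using first_moment_upper by (simp add: n_eq_r_mult_u power2_eq_square mult_ac)
  then show ?thesis by (simp add: real_sqrt_mult)
qed

text \<open>
  The integrand is compared pointwise, on the half line, with the Gaussian. Up to \<pi>/r the expansion near 0
  applies; beyond, both functions are small separately. The tail integral is of order 1/(r u sqrt u), and
  r sqrt u is at least the square root of the first moment.
\<close>

lemma integral_estimate:
  assumes u2: "u \<ge> 474552"
  shows "\<bar>pi * (\<nu> n r * x ^ n / exp (\<Sum>j=1..r. x ^ j / real j)) - sqrt (2 * pi / \<Lambda>) / 2\<bar>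
     \<le> (2000000 * sqrt (16 * pi) / 2 + 2 * (72 * fact 6 * 26 ^ 6)) * (1 / u) / sqrt \<Lambda>"
proof -
  define K :: real where "K = 72 * fact 6 * 26 ^ 6"
  have K0: "K > 0" by (simp add: K_def)
  have r: "real r > 0" and lam: "\<Lambda> > 0" and u0: "u > 0" using r_ge_1 first_moment_pos u2 by auto
  have du: "real r / real n = 1 / u" using u_eq by simp
  define V where "V = pi * (\<nu> n r * x ^ n / exp (\<Sum>j=1..r. x ^ j / real j))"
  define F where "F = (\<lambda>t. if t \<in> {0..pi} then integrand t else 0)"
  define G where "G = (\<lambda>t. exp (- (\<Lambda> / 2 * t\<^sup>2)))"
  define T where "T = (\<lambda>t. if t \<in> {pi / real r..pi} then K / (u * sqrt u) * (1 / (real r * t * sqrt (real r * t))) else 0)"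
  define D where "D = (\<lambda>t. 2000000 * (1 / u) * exp (- (\<Lambda> / 16 * t\<^sup>2)) + T t)"
  define IT where "IT = K / (u * sqrt u) * (2 / (real r * sqrt (real r * (pi / real r))) - 2 / (real r * sqrt (real r * pi)))"
  have pir: "0 < pi / real r" "pi / real r \<le> pi" using r_ge_1 by (auto simp: field_simps)
  have F: "(F has_integral V) {0..}"
    unfolding F_def V_def using has_integral_integrand by (subst has_integral_restrict) auto
  have G: "(G has_integral sqrt (2 * pi / \<Lambda>) / 2) {0..}"
    unfolding G_def using has_integral_half_gaussian[of "\<Lambda> / 2"] lam by (simp add: mult.commute)
  have T: "(T has_integral IT) {0..}"
  proof -
    have sub: "{pi / real r..pi} \<subseteq> {0..}" using pir by auto
    show ?thesis unfolding T_def IT_def has_integral_restrict[OF sub]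
      by (intro has_integral_mult_right has_integral_inverse_three_halves r pir)
  qed
  have D: "(D has_integral 2000000 * (1 / u) * (sqrt (pi / (\<Lambda> / 16)) / 2) + IT) {0..}"
    unfolding D_def using lam by (intro has_integral_add has_integral_mult_right has_integral_half_gaussian T) auto
  have pointwise: "norm (F t - G t) \<le> D t" if t: "t \<in> {0..}" for t
  proof (cases "t \<le> pi / real r")
    case True
    then have "F t = integrand t" using t pir by (auto simp: F_def)
    moreover have "T t \<ge> 0" unfolding T_def using K0 u0 r t by auto
    ultimately show ?thesis
      using integrand_near_0[of t] t True unfolding D_def G_def du by simp
  next
    case False
    have Fb: "\<bar>F t\<bar> \<le> T t"
    proof (cases "t \<le> pi")
      case le: True
      have "r \<ge> 2"
      proof (rule ccontr)
        assume "\<not> r \<ge> 2"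
        then have "r = 1" using r_ge_1 by simp
        then show False using False le by simp
      qed
      then have "\<bar>integrand t\<bar> \<le> K / (u * sqrt u) * (1 / (real r * t * sqrt (real r * t)))"
        unfolding K_def using False le u2 by (intro integrand_tail) auto
      then show ?thesis using False le t unfolding F_def T_def by auto
    qed (auto simp: F_def T_def)
    define s where "s = \<Lambda> * t\<^sup>2"
    have s: "s \<ge> 2 * u"
    proof -
      have "2 * u = real r * real n / 2 * (2 / real r)\<^sup>2" using r by (simp add: n_eq_r_mult_u power2_eq_square)
      also have "\<dots> \<le> \<Lambda> * t\<^sup>2"
      proof (intro mult_mono power_mono)
        have "2 / real r \<le> pi / real r" using pi_ge_two r by (intro divide_right_mono) auto
        then show "2 / real r \<le> t" using False by linarith
      qed (use first_moment_lower lam r in auto)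
      finally show ?thesis by (simp add: s_def)
    qed
    have "G t = exp (- (s / 16)) * exp (- (7 / 16 * s))"
      unfolding G_def s_def by (simp flip: exp_add)
    also have "exp (- (7 / 16 * s)) \<le> 2000000 * (1 / u)"
    proof -
      have "u / 2 \<le> exp (7 / 16 * s)" using s u0 exp_ge_add_one_self[of "7 / 16 * s"] by linarith
      then have "inverse (exp (7 / 16 * s)) \<le> inverse (u / 2)" using u0 by (intro le_imp_inverse_le) auto
      then have "exp (- (7 / 16 * s)) \<le> 2 * (1 / u)" by (simp add: exp_minus field_simps)
      also have "\<dots> \<le> 2000000 * (1 / u)" using u0 by (intro mult_right_mono) auto
      finally show ?thesis .
    qed
    finally have "G t \<le> 2000000 * (1 / u) * exp (- (s / 16))" by (simp add: mult_ac)
    moreover have "G t \<ge> 0" by (simp add: G_def)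
    ultimately show ?thesis using Fb unfolding D_def s_def by simp
  qed
  have "norm (V - sqrt (2 * pi / \<Lambda>) / 2) \<le> 2000000 * (1 / u) * (sqrt (pi / (\<Lambda> / 16)) / 2) + IT"
    using integral_norm_bound_integral[of "\<lambda>t. F t - G t" "{0..}" D] has_integral_diff[OF F G] D pointwise
    by (simp add: has_integral_iff)
  also have "sqrt (pi / (\<Lambda> / 16)) / 2 = sqrt (16 * pi) / 2 / sqrt \<Lambda>"
    by (simp add: real_sqrt_divide real_sqrt_mult mult.commute)
  also have "IT \<le> 2 * K * (1 / u) / sqrt \<Lambda>"
  proof -
    have "2 / (real r * sqrt (real r * (pi / real r))) - 2 / (real r * sqrt (real r * pi)) \<le> 2 / (real r * sqrt pi)"
      using r by simp
    also have "\<dots> \<le> 2 / (real r * 1)"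
      using r pi_ge_two by (intro divide_left_mono mult_left_mono mult_pos_pos) auto
    finally have "IT \<le> K / (u * sqrt u) * (2 / (real r * 1))"
      unfolding IT_def using K0 u0 by (intro mult_left_mono) auto
    also have "\<dots> = 2 * K * (1 / u) / (real r * sqrt u)" by (simp add: mult_ac)
    also have "\<dots> \<le> 2 * K * (1 / u) / sqrt \<Lambda>"
      using sqrt_first_moment_le lam K0 u0 r by (intro divide_left_mono mult_pos_pos) auto
    finally show ?thesis .
  qed
  also have "2000000 * (1 / u) * (sqrt (16 * pi) / 2 / sqrt \<Lambda>) + 2 * K * (1 / u) / sqrt \<Lambda>
     = (2000000 * sqrt (16 * pi) / 2 + 2 * K) * (1 / u) / sqrt \<Lambda>"
    using u0 lam by (simp add: field_simps)
  finally show ?thesis by (simp add: V_def K_def)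
qed

lemma nu_div_saddle_value: 
  "\<nu> n r / saddle_value n r x = (\<nu> n r * x ^ n / exp (\<Sum>j=1..r. x ^ j / real j)) * sqrt (2 * pi * \<Lambda>)"
  unfolding saddle_value_def by simp

lemma saddle_estimate_large_u:
  assumes u2: "u \<ge> 474552"
  shows "\<bar>\<nu> n r / saddle_value n r x - 1\<bar>
    \<le> (2000000 * sqrt (16 * pi) / 2 + 2 * (72 * fact 6 * 26 ^ 6)) * sqrt (2 * pi) / pi / u"
proof -
  define W where "W = \<nu> n r * x ^ n / exp (\<Sum>j=1..r. x ^ j / real j)"
  define K :: real where "K = 2000000 * sqrt (16 * pi) / 2 + 2 * (72 * fact 6 * 26 ^ 6)"
  have lam: "\<Lambda> > 0" by (rule first_moment_pos)
  have "(pi * W - sqrt (2 * pi / \<Lambda>) / 2) * (sqrt (2 * pi * \<Lambda>) / pi) = W * sqrt (2 * pi * \<Lambda>) - 1"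
  proof -
    have "sqrt (2 * pi / \<Lambda>) * sqrt (2 * pi * \<Lambda>) = 2 * pi"
    proof -
      have "sqrt (2 * pi / \<Lambda>) * sqrt (2 * pi * \<Lambda>) = sqrt ((2 * pi)\<^sup>2)"
        using lam by (simp add: power2_eq_square flip: real_sqrt_mult)
      also have "\<dots> = 2 * pi" unfolding real_sqrt_abs by simp
      finally show ?thesis .
    qed
    then show ?thesis by (simp add: left_diff_distrib diff_divide_distrib)
  qed
  then have "\<bar>W * sqrt (2 * pi * \<Lambda>) - 1\<bar> = \<bar>pi * W - sqrt (2 * pi / \<Lambda>) / 2\<bar> * (sqrt (2 * pi * \<Lambda>) / pi)"
  proof -
    assume eq: "(pi * W - sqrt (2 * pi / \<Lambda>) / 2) * (sqrt (2 * pi * \<Lambda>) / pi) = W * sqrt (2 * pi * \<Lambda>) - 1"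
    have "sqrt (2 * pi * \<Lambda>) / pi \<ge> 0" using lam by simp
    then show ?thesis unfolding eq[symmetric] abs_mult by (simp only: abs_of_nonneg)
  qed
  also have "\<dots> \<le> (K * (1 / u) / sqrt \<Lambda>) * (sqrt (2 * pi * \<Lambda>) / pi)"
    using integral_estimate[OF u2] lam unfolding W_def K_def by (intro mult_right_mono) auto
  also have "\<dots> = K * sqrt (2 * pi) / pi / u"
    using lam by (simp add: real_sqrt_mult)
  finally show ?thesis unfolding nu_div_saddle_value W_def K_def .
qed

text \<open>
  The three bounds used are exp(P(x)) \<ge> exp(H_r) \<ge> r with the harmonic number H_r, x^n \<le> u^(2u) from
  the geometric mean, and the upper bound for the first moment. The factors r cancel, so that the result
  depends on u only.
\<close>

lemma saddle_value_lower: "saddle_value n r x \<ge> 1 / (exp (2 * u * ln u) * sqrt (2 * pi * u))"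
proof -
  have r: "real r > 0" and lam: "\<Lambda> > 0" and u1: "u \<ge> 1" using r_ge_1 first_moment_pos u_ge_1 by auto
  have "real r \<le> exp (\<Sum>j=1..r. x ^ j / real j)"
  proof -
    have "ln (real r) \<le> harm r" using ln_le_harm[of r] r by (smt (verit) ln_le_cancel_iff)
    also have "\<dots> \<le> (\<Sum>j=1..r. x ^ j / real j)"
      unfolding harm_def using x_ge_1 by (intro sum_mono) (auto simp: field_simps)
    finally have "exp (ln (real r)) \<le> exp (\<Sum>j=1..r. x ^ j / real j)" by simp
    then show ?thesis using r by simp
  qed
  moreover have "x ^ n \<le> exp (2 * u * ln u)"
  proof -
    have "(real r + 1) * ln x / 2 \<le> ln u"
      by (rule iffD2[OF ln_ge_iff geometric_mean_le]) (use u1 in simp)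
    moreover have "real r * ln x \<le> (real r + 1) * ln x" using x_ge_1 by (intro mult_right_mono) auto
    ultimately have "real r * ln x \<le> 2 * ln u" by linarith
    then have "u * (real r * ln x) \<le> u * (2 * ln u)" using u1 by (intro mult_left_mono) auto
    then have "real n * ln x \<le> 2 * u * ln u" by (simp add: n_eq_r_mult_u mult_ac)
    then show ?thesis unfolding x_power_exp by simp
  qed
  moreover have "sqrt (2 * pi * \<Lambda>) \<le> real r * sqrt (2 * pi * u)"
  proof -
    have "sqrt (2 * pi) * sqrt \<Lambda> \<le> sqrt (2 * pi) * (real r * sqrt u)"
      using sqrt_first_moment_le by (intro mult_left_mono) auto
    then show ?thesis by (simp add: real_sqrt_mult mult_ac)
  qed
  ultimately have "real r / (exp (2 * u * ln u) * (real r * sqrt (2 * pi * u))) \<le> saddle_value n r x"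
    unfolding saddle_value_def using x_pos lam r u1
    by (intro frac_le mult_mono mult_pos_pos) auto
  then show ?thesis using r by simp
qed

text \<open>
  For bounded u the assertion is merely that the quotient is bounded, and \<nu> is at most 1.
\<close>

lemma saddle_estimate_small_u:
  assumes u2: "u \<le> U"
  shows "\<bar>\<nu> n r / saddle_value n r x - 1\<bar> \<le> (exp (2 * U * ln U) * sqrt (2 * pi * U) + 1) * U / u"
proof -
  have u1: "u \<ge> 1" by (rule u_ge_1)
  have "\<nu> n r / saddle_value n r x \<le> 1 / (1 / (exp (2 * u * ln u) * sqrt (2 * pi * u)))"
    using saddle_value_lower nu_le_1 u1 nu_nonneg by (intro frac_le) auto
  also have "\<dots> = exp (2 * u * ln u) * sqrt (2 * pi * u)" by simp
  also have "\<dots> \<le> exp (2 * U * ln U) * sqrt (2 * pi * U)"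
  proof (intro mult_mono)
    have "u * ln u \<le> U * ln U" using u1 u2 by (intro mult_mono) auto
    then show "exp (2 * u * ln u) \<le> exp (2 * U * ln U)" by simp
  qed (use u1 u2 in auto)
  finally have "\<nu> n r / saddle_value n r x \<le> exp (2 * U * ln U) * sqrt (2 * pi * U)" .
  moreover have "\<nu> n r / saddle_value n r x \<ge> 0" using nu_nonneg[of n r] saddle_value_pos by simp
  ultimately have "\<bar>\<nu> n r / saddle_value n r x - 1\<bar> \<le> exp (2 * U * ln U) * sqrt (2 * pi * U) + 1"
    unfolding abs_le_iff by linarith
  then have "\<bar>\<nu> n r / saddle_value n r x - 1\<bar> \<le> (exp (2 * U * ln U) * sqrt (2 * pi * U) + 1) * 1" by simp
  also have "\<dots> \<le> (exp (2 * U * ln U) * sqrt (2 * pi * U) + 1) * (U / u)"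
    using u1 u2 by (intro mult_left_mono) (auto intro!: add_nonneg_nonneg mult_nonneg_nonneg)
  finally show ?thesis by simp
qed

end

theorem nu_saddle_point_estimate:
  obtains C where "C > 0"
    and "\<And>n r x u. saddle_point n r x u \<Longrightarrow> \<bar>\<nu> n r / saddle_value n r x - 1\<bar> \<le> C / u"
proof -
  define K1 where "K1 = (2000000 * sqrt (16 * pi) / 2 + 2 * (72 * fact 6 * 26 ^ 6)) * sqrt (2 * pi) / pi"
  define K2 where "K2 = (exp (2 * 474552 * ln 474552) * sqrt (2 * pi * 474552) + 1) * (474552 :: real)"
  have K: "K1 > 0" "K2 > 0" by (auto simp: K1_def K2_def intro!: divide_pos_pos mult_pos_pos add_pos_pos)
  have "\<bar>\<nu> n r / saddle_value n r x - 1\<bar> \<le> max K1 K2 / u" if h: "saddle_point n r x u" for n r x u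
  proof -
    interpret saddle_point n r x u by (rule h)
    have "\<bar>\<nu> n r / saddle_value n r x - 1\<bar> \<le> K1 / u \<or> \<bar>\<nu> n r / saddle_value n r x - 1\<bar> \<le> K2 / u"
      using saddle_estimate_large_u saddle_estimate_small_u[of 474552] unfolding K1_def K2_def by linarith
    moreover have "K1 / u \<le> max K1 K2 / u" "K2 / u \<le> max K1 K2 / u"
      using u_ge_1 by (auto intro!: divide_right_mono)
    ultimately show ?thesis by linarith
  qed
  with K show ?thesis by (intro that[of "max K1 K2"]) auto
qed

section \<open>The Dickman function as a limit\<close>

lemma nu_eq_1: "n \<le> r \<Longrightarrow> \<nu> n r = 1"
proof (induction n rule: less_induct)
  case (less n)
  show ?case
  proof (cases "n = 0")
    case False
    have "real n * \<nu> n r = (\<Sum>j\<in>{1..n}. \<nu> (n - j) r)" using nu_rec[of n r] less.prems by simp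
    also have "\<dots> = (\<Sum>j\<in>{1..n}. 1)" using less by (intro sum.cong refl) auto
    finally show ?thesis using False by simp
  qed (simp add: nu_0)
qed

text \<open>
  The discrete counterpart of v \<rho>'(v) = - \<rho>(v-1), obtained by subtracting the recursion for n-1 from the
  one for n.
\<close>

lemma nu_difference_equation:
  assumes "r < n"
  shows "real n * (\<nu> n r - \<nu> (n - 1) r) = - \<nu> (n - 1 - r) r"
proof -
  have shift: "(\<Sum>j=1..k. f (Suc j)) = (\<Sum>j=1..k. f j) + f (Suc k) - f 1" for f :: "nat \<Rightarrow> real" and k
    by (induction k) auto
  have "real (n - 1) * \<nu> (n - 1) r = (\<Sum>j=1..r. \<nu> (n - Suc j) r)"
    using nu_rec[of "n - 1" r] assms by (simp add: min_absorb1)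
  also have "\<dots> = (\<Sum>j=1..r. \<nu> (n - j) r) + \<nu> (n - Suc r) r - \<nu> (n - 1) r"
    by (rule shift[of "\<lambda>j. \<nu> (n - j) r"])
  also have "(\<Sum>j=1..r. \<nu> (n - j) r) = real n * \<nu> n r"
    using nu_rec[of n r] assms by (simp add: min_absorb1)
  finally show ?thesis using assms by (simp add: algebra_simps of_nat_diff)
qed

lemma nu_antimono: "m \<le> n \<Longrightarrow> \<nu> n r \<le> \<nu> m r"
proof (induction n rule: dec_induct)
  case (step n)
  have "\<nu> (Suc n) r \<le> \<nu> n r"
  proof (cases "r < Suc n")
    case True
    have "real (Suc n) * (\<nu> (Suc n) r - \<nu> n r) \<le> 0"
      using nu_difference_equation[OF True] nu_nonneg[of "n - r" r] by simp
    then show ?thesis by (simp add: mult_le_0_iff)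
  qed (simp add: nu_eq_1)
  with step show ?case by simp
qed simp

text \<open>
  In the recursion only the terms with j \<ge> r/2 are kept; by monotonicity each of them is at least the
  first.
\<close>

lemma nu_lower_step:
  assumes "1 \<le> r" "r \<le> n"
  shows "real n * \<nu> n r \<ge> real r / 2 * \<nu> (n - (r + 1) div 2) r"
proof -
  define h where "h = (r + 1) div 2"
  have h: "1 \<le> h" "h \<le> r" "real r / 2 \<le> real (card {h..r})" using assms by (auto simp: h_def)
  have "real r / 2 * \<nu> (n - h) r \<le> real (card {h..r}) * \<nu> (n - h) r"
    using h nu_nonneg by (intro mult_right_mono) auto
  also have "\<dots> = (\<Sum>j\<in>{h..r}. \<nu> (n - h) r)" by simp
  also have "\<dots> \<le> (\<Sum>j\<in>{h..r}. \<nu> (n - j) r)" by (intro sum_mono nu_antimono) auto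
  also have "\<dots> \<le> (\<Sum>j\<in>{1..r}. \<nu> (n - j) r)" using h nu_nonneg by (intro sum_mono2) auto
  also have "\<dots> = real n * \<nu> n r" using nu_rec[of n r] assms by (simp add: min_absorb1)
  finally show ?thesis by (simp add: h_def)
qed

text \<open>
  At most 2U steps of length r/2 lead from n \<le> Ur down to r, where \<nu> is 1, and each of them costs a
  factor of at most 2U. The bound does not depend on r and hence passes to the limit \<rho>.
\<close>

lemma nu_lower:
  assumes r: "1 \<le> r" and U: "1 \<le> U" and n: "n \<le> U * r"
  shows "\<nu> n r \<ge> (1 / (2 * real U)) ^ (2 * U)"
proof -
  define h where "h = (r + 1) div 2"
  define c where "c = 1 / (2 * real U)"
  have c: "0 < c" "c \<le> 1" using U by (auto simp: c_def)
  have *: "\<nu> n r \<ge> c ^ k" if "n \<le> r + k * h" "n \<le> U * r" for k n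
    using that
  proof (induction k arbitrary: n)
    case 0
    then show ?case by (simp add: nu_eq_1)
  next
    case (Suc k)
    show ?case
    proof (cases "n \<le> r")
      case True
      have "c ^ Suc k \<le> 1" using c by (intro power_le_one) auto
      with True show ?thesis by (simp add: nu_eq_1)
    next
      case False
      have IH: "c ^ k \<le> \<nu> (n - h) r" using Suc by (intro Suc.IH) auto
      have n0: "real n > 0" using False by simp
      have "real n \<le> real U * real r" using Suc.prems(2) by (metis of_nat_le_iff of_nat_mult)
      then have "c * real n \<le> real r / 2" using U by (simp add: c_def field_simps)
      then have "c * real n * \<nu> (n - h) r \<le> real r / 2 * \<nu> (n - h) r"
        using nu_nonneg by (intro mult_right_mono) auto
      also have "\<dots> \<le> real n * \<nu> n r" using nu_lower_step[of r n] False r by (simp add: h_def)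
      finally have "real n * (c * \<nu> (n - h) r) \<le> real n * \<nu> n r" by (simp add: mult_ac)
      then have "c * \<nu> (n - h) r \<le> \<nu> n r" using n0 by simp
      moreover have "c * c ^ k \<le> c * \<nu> (n - h) r" using IH c by (intro mult_left_mono) auto
      ultimately show ?thesis by simp
    qed
  qed
  have "r \<le> 2 * h" by (auto simp: h_def)
  then have "U * r \<le> U * (2 * h)" by (intro mult_le_mono2)
  also have "\<dots> = (2 * U) * h" by simp
  finally have "n \<le> r + (2 * U) * h" using n by linarith
  from *[OF this n] show ?thesis by (simp add: c_def)
qed

lemma rho_cont: "continuous_on {0..} \<rho>"
  using is_dickman_rho by (simp add: is_dickman_def)

lemma rho_eq_1: "0 \<le> v \<Longrightarrow> v \<le> 1 \<Longrightarrow> \<rho> v = 1"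
  using is_dickman_rho by (simp add: is_dickman_def)

lemma rho_deriv:
  assumes v: "v > 1"
  shows "(\<rho> has_real_derivative - (\<rho> (v - 1) / v)) (at v)"
proof -
  have d: "\<rho> differentiable (at v)" "v * deriv \<rho> v + \<rho> (v - 1) = 0"
    using is_dickman_rho v by (auto simp: is_dickman_def)
  from d(2) have "deriv \<rho> v = - (\<rho> (v - 1) / v)" using v by (simp add: field_simps)
  with d(1) show ?thesis by (metis DERIV_deriv_iff_real_differentiable)
qed

lemma rho_mvt:
  assumes "1 \<le> a" "a < b"
  obtains v where "a < v" "v < b" "\<rho> b - \<rho> a = (b - a) * - (\<rho> (v - 1) / v)"
proof -
  have "continuous_on {a..b} \<rho>" using assms by (intro continuous_on_subset[OF rho_cont]) auto
  moreover have "(\<rho> has_derivative (\<lambda>h. - (\<rho> (v - 1) / v) * h)) (at v)" if "a < v" "v < b" for v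
  proof -
    have "v > 1" using that assms by simp
    from rho_deriv[OF this] show ?thesis by (simp only: has_field_derivative_def)
  qed
  ultimately obtain v where "a < v" "v < b" "\<rho> b - \<rho> a = (- (\<rho> (v - 1) / v)) * (b - a)"
    using mvt[OF assms(2), of \<rho> "\<lambda>v h. - (\<rho> (v - 1) / v) * h"] by blast
  then show ?thesis by (intro that[of v]) (simp_all add: mult.commute)
qed

lemma rho_bounded:
  obtains B where "B \<ge> 0" "\<And>v. 0 \<le> v \<Longrightarrow> v \<le> K \<Longrightarrow> \<bar>\<rho> v\<bar> \<le> B"
proof -
  have "compact (\<rho> ` {0..K})"
    by (intro compact_continuous_image continuous_on_subset[OF rho_cont]) auto
  then obtain B where "\<forall>y\<in>\<rho> ` {0..K}. norm y \<le> B" using compact_imp_bounded bounded_iff by blast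
  then show ?thesis by (intro that[of "max B 0"]) (auto intro: max.coboundedI1)
qed

lemma rho_lipschitz:
  assumes B: "B \<ge> 0" "\<And>v. 0 \<le> v \<Longrightarrow> v \<le> K \<Longrightarrow> \<bar>\<rho> v\<bar> \<le> B"
    and ab: "0 \<le> a" "a \<le> b" "b \<le> K + 1"
  shows "\<bar>\<rho> b - \<rho> a\<bar> \<le> B * (b - a)"
proof (cases "b \<le> 1 \<or> a = b")
  case True
  then show ?thesis using ab B by (auto simp: rho_eq_1)
next
  case False
  define a' where "a' = max a 1"
  have a': "1 \<le> a'" "a \<le> a'" "a' \<le> b" using ab False by (auto simp: a'_def)
  have eq: "\<rho> a' = \<rho> a" using ab by (cases "a \<le> 1") (auto simp: a'_def rho_eq_1 max_def)
  show ?thesis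
  proof (cases "a' = b")
    case True
    then show ?thesis using eq ab B by simp
  next
    case False
    then obtain v where v: "a' < v" "v < b" "\<rho> b - \<rho> a' = (b - a') * - (\<rho> (v - 1) / v)"
      using rho_mvt[of a' b] a' by auto
    have "\<bar>\<rho> (v - 1) / v\<bar> \<le> B / 1"
      unfolding abs_divide using v a' ab B by (intro frac_le) auto
    then have "\<bar>\<rho> b - \<rho> a'\<bar> \<le> (b - a') * B"
      unfolding v(3) abs_mult using a' by (intro mult_mono) auto
    also have "\<dots> \<le> (b - a) * B" using a' B by (intro mult_right_mono) auto
    finally show ?thesis unfolding eq by (simp add: mult.commute)
  qed
qed

text \<open>
  By the mean value theorem, the increment of \<rho> is - \<rho>(v-1)/(rv) for some v between m/r and (m+1)/r, whereas
  the increment of \<nu> is - \<nu>(m-r)/(m+1). The two differ by O(1/r^2): the denominators and the arguments are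
  close, and the values are close by assumption.
\<close>

lemma nu_approx_rho_step:
  assumes B: "B \<ge> 0" "\<And>v. 0 \<le> v \<Longrightarrow> v \<le> K \<Longrightarrow> \<bar>\<rho> v\<bar> \<le> B"
    and r: "1 \<le> r" and m: "r \<le> m" "real (Suc m) \<le> (K + 1) * real r"
    and C: "C \<ge> 0" "\<bar>\<nu> (m - r) r - \<rho> (real (m - r) / real r)\<bar> \<le> C / real r"
  shows "\<bar>(\<nu> (Suc m) r - \<rho> (real (Suc m) / real r)) - (\<nu> m r - \<rho> (real m / real r))\<bar> \<le> (C + 2 * B) / (real r)\<^sup>2"
proof -
  define a where "a = real m / real r"
  define b where "b = real (Suc m) / real r"
  define M where "M = real (Suc m)"
  have r0: "real r > 0" using r by simp
  have a1: "1 \<le> a" using m(1) r0 by (simp add: a_def)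
  have ba: "b - a = 1 / real r" by (simp add: a_def b_def flip: diff_divide_distrib)
  have bK: "b \<le> K + 1" using m(2) r0 by (simp add: b_def field_simps)
  have ab: "a < b" using ba r0 by (smt (verit) divide_pos_pos)
  have MM: "M \<ge> real r" "M > 0" using m(1) by (auto simp: M_def)
  obtain v where v: "a < v" "v < b" "\<rho> b - \<rho> a = (b - a) * - (\<rho> (v - 1) / v)"
    using rho_mvt[OF a1 ab] by blast
  have v1: "v > 1" using v a1 by simp
  have w: "real (m - r) / real r = a - 1" using m(1) r0 by (simp add: a_def of_nat_diff diff_divide_distrib)
  have nu: "\<nu> (Suc m) r - \<nu> m r = - \<nu> (m - r) r / M"
    using nu_difference_equation[of r "Suc m"] m(1) by (simp add: M_def field_simps)
  have "(\<nu> (Suc m) r - \<rho> b) - (\<nu> m r - \<rho> a) = \<rho> (v - 1) / (real r * v) - \<nu> (m - r) r / M"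
    using nu v(3) unfolding ba by simp
  also have "\<dots> = \<rho> (v - 1) * (1 / (real r * v) - 1 / M) + (\<rho> (v - 1) - \<rho> (a - 1)) / M + (\<rho> (a - 1) - \<nu> (m - r) r) / M"
    by (simp add: right_diff_distrib diff_divide_distrib)
  finally have eq: "(\<nu> (Suc m) r - \<rho> b) - (\<nu> m r - \<rho> a) = \<dots>" .
  have rr: "1 / real r / real r = 1 / (real r)\<^sup>2" by (simp add: power2_eq_square)
  have e1: "\<bar>\<rho> (v - 1) * (1 / (real r * v) - 1 / M)\<bar> \<le> B * (1 / real r / real r)"
    unfolding abs_mult
  proof (intro mult_mono)
    have rv: "real r * v \<ge> real r * 1" using v1 r0 by (intro mult_left_mono) auto
    have "1 / (real r * v) - 1 / M = (M - real r * v) / (real r * v) / M"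
      using MM rv r0 v1 by (simp add: field_simps)
    moreover have "\<bar>M - real r * v\<bar> \<le> 1"
    proof -
      have "real r * a \<le> real r * v" "real r * v \<le> real r * b" using v r0 by auto
      then show ?thesis using r0 by (simp add: a_def b_def M_def)
    qed
    ultimately have "\<bar>1 / (real r * v) - 1 / M\<bar> \<le> 1 / (real r * v) / M"
      using MM rv r0 by (simp add: divide_right_mono)
    also have "\<dots> \<le> 1 / real r / real r" using MM rv r0 by (intro frac_le) auto
    finally show "\<bar>1 / (real r * v) - 1 / M\<bar> \<le> 1 / real r / real r" .
  qed (use B v v1 bK in auto)
  have e2: "\<bar>(\<rho> (v - 1) - \<rho> (a - 1)) / M\<bar> \<le> B * (1 / real r) / real r"
    unfolding abs_divide
  proof (rule frac_le)
    have "\<bar>\<rho> (v - 1) - \<rho> (a - 1)\<bar> \<le> B * ((v - 1) - (a - 1))"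
      using a1 v bK by (intro rho_lipschitz[OF B]) auto
    also have "\<dots> \<le> B * (1 / real r)" using v ba B by (intro mult_left_mono) auto
    finally show "\<bar>\<rho> (v - 1) - \<rho> (a - 1)\<bar> \<le> B * (1 / real r)" .
  qed (use MM r0 B in auto)
  have e3: "\<bar>(\<rho> (a - 1) - \<nu> (m - r) r) / M\<bar> \<le> C / real r / real r"
    unfolding abs_divide using C(2) MM r0 C(1) unfolding w by (intro frac_le) auto
  have "\<bar>(\<nu> (Suc m) r - \<rho> b) - (\<nu> m r - \<rho> a)\<bar> \<le> B * (1 / real r / real r) + B * (1 / real r) / real r + C / real r / real r"
    unfolding eq using e1 e2 e3 by linarith
  also have "\<dots> = (C + 2 * B) / (real r)\<^sup>2" by (simp add: power2_eq_square add_divide_distrib)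
  finally show ?thesis by (simp add: a_def b_def)
qed

text \<open>
  Induction over intervals of length r: within each of them r errors of size O(1/r^2) accumulate, starting
  from the error at the end of the preceding one.
\<close>

lemma nu_approx_rho:
  "\<exists>C\<ge>0. \<forall>r\<ge>1. \<forall>m\<le>Suc K * r. \<bar>\<nu> m r - \<rho> (real m / real r)\<bar> \<le> C / real r"
proof (induction K)
  case 0
  show ?case by (intro exI[of _ 0]) (auto simp: nu_eq_1 rho_eq_1)
next
  case (Suc K)
  then obtain C where C: "C \<ge> 0" "\<And>r m. r \<ge> 1 \<Longrightarrow> m \<le> Suc K * r \<Longrightarrow> \<bar>\<nu> m r - \<rho> (real m / real r)\<bar> \<le> C / real r"
    by blast
  obtain B where B: "B \<ge> 0" "\<And>v. 0 \<le> v \<Longrightarrow> v \<le> real (Suc K) \<Longrightarrow> \<bar>\<rho> v\<bar> \<le> B"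
    using rho_bounded[of "real (Suc K)"] by metis
  define D where "D = C + 2 * B"
  have D: "D \<ge> 0" using B C by (simp add: D_def)
  have *: "\<bar>\<nu> (Suc K * r + i) r - \<rho> (real (Suc K * r + i) / real r)\<bar> \<le> C / real r + real i * (D / (real r)\<^sup>2)"
    if r: "r \<ge> 1" and "i \<le> r" for r i
    using that(2)
  proof (induction i)
    case 0
    then show ?case using C(2)[OF r, of "Suc K * r"] by simp
  next
    case (Suc i)
    let ?m = "Suc K * r + i"
    have "\<bar>(\<nu> (Suc ?m) r - \<rho> (real (Suc ?m) / real r)) - (\<nu> ?m r - \<rho> (real ?m / real r))\<bar> \<le> D / (real r)\<^sup>2"
      unfolding D_def
    proof (rule nu_approx_rho_step[OF B r])
      have "Suc ?m \<le> (Suc K + 1) * r" using Suc.prems by simp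
      then show "real (Suc ?m) \<le> (real (Suc K) + 1) * real r" by (metis of_nat_le_iff of_nat_mult of_nat_1 of_nat_add)
      show "\<bar>\<nu> (?m - r) r - \<rho> (real (?m - r) / real r)\<bar> \<le> C / real r"
        using Suc.prems by (intro C(2) r) auto
    qed (use C in auto)
    moreover have "\<bar>\<nu> ?m r - \<rho> (real ?m / real r)\<bar> \<le> C / real r + real i * (D / (real r)\<^sup>2)"
      using Suc by simp
    moreover have "Suc K * r + Suc i = Suc ?m" by simp
    moreover have "real (Suc i) * (D / (real r)\<^sup>2) = real i * (D / (real r)\<^sup>2) + D / (real r)\<^sup>2"
      by (simp add: algebra_simps add_divide_distrib)
    ultimately show ?case by (smt (verit))
  qed
  show ?case
  proof (intro exI[of _ "C + D"] conjI allI impI)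
    fix r m :: nat assume r: "1 \<le> r" and m: "m \<le> Suc (Suc K) * r"
    show "\<bar>\<nu> m r - \<rho> (real m / real r)\<bar> \<le> (C + D) / real r"
    proof (cases "m \<le> Suc K * r")
      case True
      have "\<bar>\<nu> m r - \<rho> (real m / real r)\<bar> \<le> C / real r" using C(2)[OF r True] .
      also have "\<dots> \<le> (C + D) / real r" using D by (intro divide_right_mono) auto
      finally show ?thesis .
    next
      case False
      define i where "i = m - Suc K * r"
      have i: "m = Suc K * r + i" "i \<le> r" using False m by (auto simp: i_def)
      have "real i * (D / (real r)\<^sup>2) \<le> real r * (D / (real r)\<^sup>2)" using i D by (intro mult_right_mono) auto
      also have "\<dots> = D / real r" using r by (simp add: power2_eq_square)
      finally show ?thesis using *[OF r i(2)] unfolding i(1) by (simp add: add_divide_distrib)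
    qed
  qed (use C D in auto)
qed

lemma nu_scaled_tendsto_rho:
  assumes r: "1 \<le> r"
  shows "(\<lambda>k. \<nu> (Suc k * n) (Suc k * r)) \<longlonglongrightarrow> \<rho> (real n / real r)"
proof -
  obtain C where C: "C \<ge> 0" "\<And>r m. r \<ge> 1 \<Longrightarrow> m \<le> Suc n * r \<Longrightarrow> \<bar>\<nu> m r - \<rho> (real m / real r)\<bar> \<le> C / real r"
    using nu_approx_rho[of n] by blast
  have bound: "norm (\<nu> (Suc k * n) (Suc k * r) - \<rho> (real n / real r)) \<le> C / real (Suc k)" for k
  proof -
    have "Suc k * n * 1 \<le> Suc k * n * r" using r by (intro mult_le_mono2)
    then have "Suc k * n \<le> Suc n * (Suc k * r)" by (simp add: algebra_simps)
    then have "\<bar>\<nu> (Suc k * n) (Suc k * r) - \<rho> (real (Suc k * n) / real (Suc k * r))\<bar> \<le> C / real (Suc k * r)"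
      using r by (intro C(2)) auto
    moreover have "real (Suc k * n) / real (Suc k * r) = real n / real r"
      unfolding of_nat_mult by (rule mult_divide_mult_cancel_left) simp
    moreover have "C / real (Suc k * r) \<le> C / real (Suc k)"
    proof (rule frac_le[OF C(1) order_refl])
      show "real (Suc k) \<le> real (Suc k * r)" 
        using mult_le_mono2[OF r, of "Suc k"] by (simp only: of_nat_le_iff mult_1_right)
    qed simp
    ultimately show ?thesis by (simp only: real_norm_def)
  qed
  have "(\<lambda>k. C / real (Suc k)) \<longlonglongrightarrow> 0" using LIMSEQ_Suc[OF lim_const_over_n[of C]] .
  then have "(\<lambda>k. \<nu> (Suc k * n) (Suc k * r) - \<rho> (real n / real r)) \<longlonglongrightarrow> 0"
    by (rule Lim_null_comparison[rotated]) (use bound in auto)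
  then show ?thesis by (simp only: LIM_zero_iff)
qed

lemma rho_lower:
  assumes r: "1 \<le> r" and U: "1 \<le> U" and n: "n \<le> U * r"
  shows "\<rho> (real n / real r) \<ge> (1 / (2 * real U)) ^ (2 * U)"
proof (rule LIMSEQ_le_const[OF nu_scaled_tendsto_rho[OF r]], intro exI allI impI)
  fix k
  have "Suc k * n \<le> Suc k * (U * r)" using n by (intro mult_le_mono2)
  then have "Suc k * n \<le> U * (Suc k * r)" by (simp only: mult.left_commute)
  then show "\<nu> (Suc k * n) (Suc k * r) \<ge> (1 / (2 * real U)) ^ (2 * U)"
    using r U by (intro nu_lower) auto
qed

section \<open>The saddle value under scaling\<close>

text \<open>
  From e^s - 1 = 2 sinh(s/2) e^(s/2) \<ge> s e^(s/2) one gets u \<ge> e^(s/2) for s = \<xi>(u).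
\<close>

lemma xi_le:
  assumes u: "u > 1"
  shows "\<xi> u \<le> 2 * ln u"
proof -
  define s where "s = \<xi> u"
  have s: "s > 0" "exp s = 1 + u * s" using xi_props[OF u] by (auto simp: s_def)
  have "2 * sinh (s / 2) * exp (s / 2) = exp s - 1"
    by (simp add: sinh_def algebra_simps flip: exp_add)
  moreover have "1 * sinh 0 \<le> sinh (s / 2)" using s by simp
  moreover have "sinh (s / 2) \<ge> s / 2"
  proof -
    have "sinh 0 - 0 \<le> sinh (s / 2) - s / 2"
    proof (rule DERIV_nonneg_imp_nondecreasing[where f = "\<lambda>y. sinh y - y"])
      fix y :: real
      have "((\<lambda>y. sinh y - y) has_real_derivative cosh y - 1) (at y)" by (auto intro!: derivative_eq_intros)
      then show "\<exists>d. ((\<lambda>y. sinh y - y) has_real_derivative d) (at y) \<and> 0 \<le> d"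
        using cosh_real_ge_1[of y] by (intro exI[of _ "cosh y - 1"]) auto
    qed (use s in auto)
    then show ?thesis by simp
  qed
  then have "s * exp (s / 2) \<le> 2 * sinh (s / 2) * exp (s / 2)" by simp
  ultimately have "s * exp (s / 2) \<le> s * u" using s by (simp add: mult.commute)
  then have "exp (s / 2) \<le> u" using s by simp
  then have "s / 2 \<le> ln u" using u by (intro iffD2[OF ln_ge_iff]) auto
  then show ?thesis by (simp add: s_def)
qed

lemma saddle_point_exists:
  assumes "1 \<le> r" "r \<le> n"
  obtains x where "saddle_point n r x (real n / real r)"
proof -
  define f where "f = (\<lambda>x::real. \<Sum>j=1..r. x ^ j)"
  have "f 0 = 0" unfolding f_def by (intro sum.neutral) auto
  then have "f 0 \<le> real n" by simp
  moreover have "real n \<le> f (real n)"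
  proof -
    have "(\<Sum>j\<in>{1}. real n ^ j) \<le> f (real n)" unfolding f_def using assms by (intro sum_mono2) auto
    then show ?thesis by simp
  qed
  moreover have "continuous_on {0..real n} f" unfolding f_def by (intro continuous_intros)
  ultimately obtain x where x: "0 \<le> x" "f x = real n" using IVT'[of f 0 "real n" "real n"] by auto
  have "x \<noteq> 0" using x \<open>f 0 = 0\<close> assms by auto
  with x assms have "saddle_point n r x (real n / real r)" by unfold_locales (auto simp: f_def)
  then show ?thesis by (rule that)
qed

text \<open>
  The first terms of the Laurent expansion with Bernoulli numbers. The constant 1/2 is the source of the
  factor exp(u\<xi>(u)/(2r)).
\<close>

lemma inverse_one_minus_exp_bounds:
  fixes w :: real
  assumes w: "w > 0"
  shows "1 / w + 1 / 2 \<le> 1 / (1 - exp (- w))" "1 / (1 - exp (- w)) \<le> 1 / w + 1 / 2 + w / 4"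
proof -
  have e: "exp (- w) < 1" using w by simp
  have "2 * 0 - (2 + 0) * (1 - exp (- 0)) \<le> 2 * w - (2 + w) * (1 - exp (- w))"
  proof (rule DERIV_nonneg_imp_nondecreasing[where f = "\<lambda>y. 2 * y - (2 + y) * (1 - exp (- y))"])
    fix y :: real
    have "(1 + y) * exp (- y) \<le> exp y * exp (- y)" by (intro mult_right_mono exp_ge_add_one_self) auto
    then have "0 \<le> 1 - (1 + y) * exp (- y)" by (simp flip: exp_add)
    moreover have "((\<lambda>y. 2 * y - (2 + y) * (1 - exp (- y))) has_real_derivative 1 - (1 + y) * exp (- y)) (at y)"
      by (auto intro!: derivative_eq_intros simp: algebra_simps)
    ultimately show "\<exists>d. ((\<lambda>y. 2 * y - (2 + y) * (1 - exp (- y))) has_real_derivative d) (at y) \<and> 0 \<le> d" by blast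
  qed (use w in auto)
  then show "1 / w + 1 / 2 \<le> 1 / (1 - exp (- w))" using w e by (simp add: field_simps)
  have "1 + w + w\<^sup>2 / 2 \<le> exp w" using w by (intro exp_lower_Taylor_quadratic) auto
  then have "exp (- w) * (1 + w + w\<^sup>2 / 2) \<le> exp (- w) * exp w" by (intro mult_left_mono) auto
  then have A: "exp (- w) * (1 + w + w\<^sup>2 / 2) \<le> 1" by (simp flip: exp_add)
  have "w * (1 + w / 2) \<le> (1 - exp (- w)) * (1 + w + w\<^sup>2 / 2)"
  proof -
    have "w * (1 + w / 2) = 1 + w + w\<^sup>2 / 2 - 1" by (simp add: power2_eq_square distrib_left)
    also have "\<dots> \<le> 1 + w + w\<^sup>2 / 2 - exp (- w) * (1 + w + w\<^sup>2 / 2)" using A by linarith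
    also have "\<dots> = (1 - exp (- w)) * (1 + w + w\<^sup>2 / 2)" by (simp only: left_diff_distrib mult_1_left)
    finally show ?thesis .
  qed
  then have "1 / (1 - exp (- w)) \<le> (1 + w + w\<^sup>2 / 2) / (w * (1 + w / 2))"
    using w e by (simp add: divide_le_eq le_divide_eq mult_ac)
  also have "\<dots> \<le> 1 / w + 1 / 2 + w / 4"
  proof -
    have "1 + w + w\<^sup>2 / 2 \<le> (1 / w + 1 / 2 + w / 4) * (w * (1 + w / 2))"
    proof -
      have "(1 / w + 1 / 2 + w / 4) * (w * (1 + w / 2)) = (1 + w / 2 + w\<^sup>2 / 4) * (1 + w / 2)"
        using w by (simp add: field_simps power2_eq_square)
      also have "\<dots> = 1 + w + w\<^sup>2 / 2 + w ^ 3 / 8" by (simp add: field_simps power2_eq_square power3_eq_cube)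
      finally show ?thesis using w by simp
    qed
    then show ?thesis using w by (simp only: pos_divide_le_eq mult_pos_pos add_pos_pos zero_less_one half_gt_zero)
  qed
  finally show "1 / (1 - exp (- w)) \<le> 1 / w + 1 / 2 + w / 4" .
qed

text \<open>
  P at the point exp(s/r). With this scaling of the argument, the limit for r \<rightarrow> \<infinity> of the difference
  to the harmonic number exists; for s = \<xi>(u) the argument is the approximate saddle point.
\<close>

definition cycle_sum :: "nat \<Rightarrow> real \<Rightarrow> real" where
  "cycle_sum r s = (\<Sum>j=1..r. exp (real j * (s / real r)) / real j)"

lemma cycle_sum_0: "cycle_sum r 0 = harm r"
  by (simp add: cycle_sum_def harm_def divide_inverse)

lemma exp_geometric_sum:
  fixes w :: real
  assumes "w > 0"
  shows "(\<Sum>j=1..r. exp (real j * w)) = (exp (real r * w) - 1) / (1 - exp (- w))"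
proof -
  have "(\<Sum>j=1..r. exp (real j * w)) * (1 - exp (- w)) = exp (real r * w) - 1"
  proof (induction r)
    case (Suc r)
    have "exp (real (Suc r) * w) * (1 - exp (- w)) = exp (real (Suc r) * w) - exp (real r * w)"
      by (simp add: algebra_simps flip: exp_add)
    with Suc show ?case by (simp add: distrib_right)
  qed simp
  moreover have "1 - exp (- w) > 0" using assms by simp
  ultimately show ?thesis by (simp add: field_simps)
qed

lemma cycle_sum_deriv:
  assumes r: "r \<ge> 1"
  shows "(cycle_sum r has_real_derivative (\<Sum>j=1..r. exp (real j * (s / real r))) / real r) (at s)"
proof -
  have "((\<lambda>s. \<Sum>j=1..r. exp (real j * (s / real r)) / real j) has_real_derivative
      (\<Sum>j=1..r. exp (real j * (s / real r)) * (real j * (1 / real r)) / real j)) (at s)"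
    by (intro DERIV_sum DERIV_cdivide DERIV_fun_exp DERIV_cmult DERIV_ident)
  also have "(\<Sum>j=1..r. exp (real j * (s / real r)) * (real j * (1 / real r)) / real j)
     = (\<Sum>j=1..r. exp (real j * (s / real r))) / real r"
    unfolding sum_divide_distrib by (intro sum.cong refl) auto
  finally show ?thesis unfolding cycle_sum_def[abs_def] .
qed

text \<open>
  The derivative is a geometric sum with factor 1/(1 - exp(-s/r)), expanded to second order. At s = 0 the
  quotient (e^s-1)/s is to be read as its limit 1.
\<close>

lemma cycle_sum_deriv_bounds:
  assumes r: "r \<ge> 1" and s: "s \<ge> 0"
  defines "d \<equiv> (\<Sum>j=1..r. exp (real j * (s / real r))) / real r"
  defines "m \<equiv> (if s = 0 then 1 else (exp s - 1) / s) + (exp s - 1) / (2 * real r)"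
  shows "m \<le> d" "d \<le> m + (exp s - 1) * s / (4 * (real r)\<^sup>2)"
proof -
  have r0: "real r > 0" using r by simp
  have "m \<le> d \<and> d \<le> m + (exp s - 1) * s / (4 * (real r)\<^sup>2)"
  proof (cases "s = 0")
    case True
    then show ?thesis using r0 by (simp add: d_def m_def)
  next
    case False
    define w where "w = s / real r"
    have s0: "s > 0" and w: "w > 0" using False s r0 by (auto simp: w_def)
    have es: "exp s - 1 > 0" using s0 by simp
    have "real r * w = s" using r0 by (simp add: w_def)
    then have d: "d = (exp s - 1) * (1 / (1 - exp (- w)) / real r)"
      unfolding d_def using exp_geometric_sum[OF w, of r] by (simp add: w_def)
    have m: "m = (exp s - 1) * ((1 / w + 1 / 2) / real r)"
      using False r0 by (simp add: m_def w_def field_simps)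
    have "(exp s - 1) * ((1 / w + 1 / 2) / real r) \<le> (exp s - 1) * (1 / (1 - exp (- w)) / real r)"
      using es r0 inverse_one_minus_exp_bounds(1)[OF w] by (intro mult_left_mono divide_right_mono) auto
    moreover have "(exp s - 1) * (1 / (1 - exp (- w)) / real r) \<le> (exp s - 1) * ((1 / w + 1 / 2 + w / 4) / real r)"
      using es r0 inverse_one_minus_exp_bounds(2)[OF w] by (intro mult_left_mono divide_right_mono) auto
    moreover have "(exp s - 1) * ((1 / w + 1 / 2 + w / 4) / real r) = m + (exp s - 1) * s / (4 * (real r)\<^sup>2)"
      unfolding m using r0 by (simp add: w_def add_divide_distrib distrib_left power2_eq_square)
    ultimately show ?thesis unfolding d m by linarith
  qed
  then show "m \<le> d" "d \<le> m + (exp s - 1) * s / (4 * (real r)\<^sup>2)" by auto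
qed

text \<open>
  In the difference of the derivatives for r and R the leading terms, which do not depend on the scale,
  cancel, and the terms of second order integrate to the explicit correction. The error in the derivative
  is at most (e^s-1)s/(4r^2), which is bounded by the derivative of s e^s/(4r^2). The stronger integrated
  bound, without a further factor s, depends on this comparison.
\<close>

lemma cycle_sum_scaling:
  assumes r: "1 \<le> r" "r \<le> R" and s: "s \<ge> 0"
  shows "\<bar>(cycle_sum r s - harm r) - (cycle_sum R s - harm R) - (1 / real r - 1 / real R) / 2 * (exp s - 1 - s)\<bar>
    \<le> s * exp s / (4 * (real r)\<^sup>2)"
proof -
  define D where "D = (\<lambda>s. cycle_sum r s - cycle_sum R s - (1 / real r - 1 / real R) / 2 * (exp s - 1 - s))"
  define d where "d = (\<lambda>s. (\<Sum>j=1..r. exp (real j * (s / real r))) / real r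
      - (\<Sum>j=1..R. exp (real j * (s / real R))) / real R - (1 / real r - 1 / real R) / 2 * (exp s - 1))"
  define b where "b = (\<lambda>s. (exp s + s * exp s) / (4 * (real r)\<^sup>2))"
  have R: "1 \<le> R" using r by simp
  have r0: "real r > 0" using r by simp
  have D': "(D has_real_derivative d y) (at y)" for y
    unfolding D_def d_def
    by (intro DERIV_diff DERIV_cmult cycle_sum_deriv r(1) R) (auto intro!: derivative_eq_intros)
  have b': "((\<lambda>s. s * exp s / (4 * (real r)\<^sup>2)) has_real_derivative b y) (at y)" for y
  proof -
    have "((\<lambda>s. s * exp s) has_real_derivative exp y + y * exp y) (at y)"
      by (auto intro!: derivative_eq_intros)
    then show ?thesis unfolding b_def by (rule DERIV_cdivide)
  qed
  have bound: "\<bar>d y\<bar> \<le> b y" if y: "y \<ge> 0" for y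
  proof -
    have e: "exp y - 1 \<ge> 0" using y by simp
    have "(exp y - 1) * y / (4 * (real R)\<^sup>2) \<le> (exp y - 1) * y / (4 * (real r)\<^sup>2)"
      using e y r by (intro divide_left_mono mult_left_mono power_mono mult_pos_pos) auto
    moreover have "0 \<le> (exp y - 1) * y / (4 * (real R)\<^sup>2)" using e y by simp
    moreover have "(1 / real r - 1 / real R) / 2 * (exp y - 1) = (exp y - 1) / (2 * real r) - (exp y - 1) / (2 * real R)"
      by (simp add: algebra_simps diff_divide_distrib)
    ultimately have "\<bar>d y\<bar> \<le> (exp y - 1) * y / (4 * (real r)\<^sup>2)"
      using cycle_sum_deriv_bounds[OF r(1) y] cycle_sum_deriv_bounds[OF R y] unfolding d_def abs_le_iff
      by linarith
    also have "\<dots> \<le> b y" unfolding b_def using y by (intro divide_right_mono) (auto simp: algebra_simps)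
    finally show ?thesis .
  qed
  have "0 * exp 0 / (4 * (real r)\<^sup>2) - D 0 \<le> s * exp s / (4 * (real r)\<^sup>2) - D s"
  proof (rule DERIV_nonneg_imp_nondecreasing[OF s])
    fix y assume "0 \<le> y" "y \<le> s"
    then show "\<exists>e. ((\<lambda>s. s * exp s / (4 * (real r)\<^sup>2) - D s) has_real_derivative e) (at y) \<and> 0 \<le> e"
      using bound[of y] by (intro exI[of _ "b y - d y"] conjI DERIV_diff b' D') auto
  qed
  moreover have "0 * exp 0 / (4 * (real r)\<^sup>2) + D 0 \<le> s * exp s / (4 * (real r)\<^sup>2) + D s"
  proof (rule DERIV_nonneg_imp_nondecreasing[OF s])
    fix y assume "0 \<le> y" "y \<le> s"
    then show "\<exists>e. ((\<lambda>s. s * exp s / (4 * (real r)\<^sup>2) + D s) has_real_derivative e) (at y) \<and> 0 \<le> e"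
      using bound[of y] by (intro exI[of _ "b y + d y"] conjI DERIV_add b' D') auto
  qed
  ultimately have "\<bar>D s - D 0\<bar> \<le> s * exp s / (4 * (real r)\<^sup>2)" by simp
  moreover have "D s - D 0 = (cycle_sum r s - harm r) - (cycle_sum R s - harm R) - (1 / real r - 1 / real R) / 2 * (exp s - 1 - s)"
    unfolding D_def cycle_sum_0 by simp
  ultimately show ?thesis by simp
qed

lemma harm_ln_scaling:
  assumes r: "1 \<le> r" "r \<le> R"
  shows "\<bar>(harm r - ln (real r)) - (harm R - ln (real R))\<bar> \<le> 1 / real r"
proof -
  have split: "harm R = harm r + (\<Sum>j=Suc r..R. 1 / real j)"
    using r(2) by (induction R rule: dec_induct) (auto simp: harm_Suc inverse_eq_divide)
  have up: "(\<Sum>j=Suc r..R. 1 / real j) \<le> ln (real R) - ln (real r)"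
    using r(2)
  proof (induction R rule: dec_induct)
    case (step R)
    have R0: "real R > 0" using step r by simp
    have "ln (real R / real (Suc R)) \<le> real R / real (Suc R) - 1" using R0 by (intro ln_le_minus_one) auto
    also have "\<dots> = - (1 / real (Suc R))" by (simp add: field_simps)
    finally have "1 / real (Suc R) \<le> ln (real (Suc R)) - ln (real R)" using R0 by (simp add: ln_div del: of_nat_Suc)
    with step show ?case by (simp del: of_nat_Suc)
  qed simp
  have low: "ln (real (Suc R) / real (Suc r)) \<le> (\<Sum>j=Suc r..R. 1 / real j)" by (rule ln_le_harm_diff[OF r])
  have "ln (real (Suc r)) - ln (real r) \<le> 1 / real r"
  proof -
    have "ln (real (Suc r) / real r) \<le> real (Suc r) / real r - 1" using r by (intro ln_le_minus_one) auto
    also have "\<dots> = 1 / real r" using r by (simp add: field_simps)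
    finally show ?thesis using r by (simp add: ln_div del: of_nat_Suc)
  qed
  moreover have "ln (real R) \<le> ln (real (Suc R))" using r by simp
  moreover have "ln (real (Suc R) / real (Suc r)) = ln (real (Suc R)) - ln (real (Suc r))" by (simp add: ln_div del: of_nat_Suc)
  moreover have "0 \<le> 1 / real r" by simp
  ultimately show ?thesis using up low unfolding split abs_le_iff by linarith
qed

text \<open>
  Both sides are upper Riemann sums on [0,1] of the increasing function t e^(st), the left one on a k times
  finer grid. Each cell of the coarse grid bounds the fine sum between its left and right end; the two
  coarse sums differ by e^s/r.
\<close>

lemma first_moment_scaling:
  assumes r: "1 \<le> r" and k: "1 \<le> k" and s: "s \<ge> 0"
  shows "first_moment (k * r) (exp (s / real (k * r))) / (real (k * r))\<^sup>2 \<le> first_moment r (exp (s / real r)) / (real r)\<^sup>2"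
    and "first_moment r (exp (s / real r)) / (real r)\<^sup>2 - exp s / real r
      \<le> first_moment (k * r) (exp (s / real (k * r))) / (real (k * r))\<^sup>2"
proof -
  define F where "F = (\<lambda>t::real. t * exp (s * t))"
  have mono: "F a \<le> F b" if "0 \<le> a" "a \<le> b" for a b
    unfolding F_def using that s by (intro mult_mono) (auto intro: mult_left_mono)
  have A: "first_moment q (exp (s / real q)) / (real q)\<^sup>2 = (\<Sum>i<q. F (real (Suc i) / real q)) / real q"
    if "q \<ge> 1" for q
  proof -
    have "first_moment q (exp (s / real q)) = (\<Sum>i<q. real (Suc i) * exp (s / real q) ^ Suc i)"
      unfolding first_moment_def by (rule sum.reindex_bij_witness[of _ Suc "\<lambda>j. j - 1"]) auto
    also have "\<dots> = (\<Sum>i<q. real q * F (real (Suc i) / real q))"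
      using that by (intro sum.cong refl) (simp add: F_def exp_of_nat_mult[symmetric] mult_ac del: of_nat_Suc power_Suc)
    finally show ?thesis using that by (simp add: power2_eq_square flip: sum_distrib_left)
  qed
  let ?R = "k * r"
  have R: "?R \<ge> 1" using r k by simp
  have k0: "real k > 0" "real r > 0" using k r by auto
  have grp: "(\<Sum>i<?R. F (real (Suc i) / real ?R)) = (\<Sum>m<r. \<Sum>i\<in>{m * k..<m * k + k}. F (real (Suc i) / real ?R))"
    using sum.nat_group[of "\<lambda>i. F (real (Suc i) / real ?R)" k r] by (simp add: mult.commute)
  have cell: "F (real m / real r) \<le> F (real (Suc i) / real ?R)" "F (real (Suc i) / real ?R) \<le> F (real (Suc m) / real r)"
    if "i \<in> {m * k..<m * k + k}" for m i
  proof -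
    have "m * k \<le> Suc i" "Suc i \<le> Suc m * k" using that by auto
    then have "real m * real k \<le> real (Suc i)" "real (Suc i) \<le> real (Suc m) * real k"
      by (simp_all only: of_nat_mult[symmetric] of_nat_le_iff)
    then have "real m / real r \<le> real (Suc i) / real ?R" "real (Suc i) / real ?R \<le> real (Suc m) / real r"
      using k0 by (simp_all add: field_simps del: of_nat_Suc)
    then show "F (real m / real r) \<le> F (real (Suc i) / real ?R)" "F (real (Suc i) / real ?R) \<le> F (real (Suc m) / real r)"
      by (auto intro!: mono divide_nonneg_nonneg)
  qed
  have "(\<Sum>i<?R. F (real (Suc i) / real ?R)) \<le> (\<Sum>m<r. \<Sum>i\<in>{m * k..<m * k + k}. F (real (Suc m) / real r))"
    unfolding grp by (intro sum_mono cell)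
  also have "\<dots> = real k * (\<Sum>m<r. F (real (Suc m) / real r))" by (simp add: sum_distrib_left)
  finally show "first_moment ?R (exp (s / real ?R)) / (real ?R)\<^sup>2 \<le> first_moment r (exp (s / real r)) / (real r)\<^sup>2"
    unfolding A[OF R] A[OF r] using k0 by (simp add: field_simps)
  have "real k * (\<Sum>m<r. F (real m / real r)) = (\<Sum>m<r. \<Sum>i\<in>{m * k..<m * k + k}. F (real m / real r))"
    by (simp add: sum_distrib_left)
  also have "\<dots> \<le> (\<Sum>i<?R. F (real (Suc i) / real ?R))"
    unfolding grp by (intro sum_mono cell)
  finally have B: "(\<Sum>m<r. F (real m / real r)) / real r \<le> (\<Sum>i<?R. F (real (Suc i) / real ?R)) / real ?R"
    using k0 by (simp add: field_simps)
  have "(\<Sum>m<r. F (real (Suc m) / real r)) = (\<Sum>m<r. F (real m / real r)) + F (real r / real r) - F (real 0 / real r)"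
  proof -
    have "(\<Sum>m<q. f (Suc m)) = (\<Sum>m<q. f m) + f q - f 0" for f :: "nat \<Rightarrow> real" and q
      by (induction q) auto
    from this[of "\<lambda>m. F (real m / real r)" r] show ?thesis .
  qed
  then have "(\<Sum>m<r. F (real (Suc m) / real r)) / real r = (\<Sum>m<r. F (real m / real r)) / real r + exp s / real r"
    using k0 by (simp add: F_def add_divide_distrib)
  with B show "first_moment r (exp (s / real r)) / (real r)\<^sup>2 - exp s / real r
      \<le> first_moment ?R (exp (s / real ?R)) / (real ?R)\<^sup>2"
    unfolding A[OF R] A[OF r] by simp
qed

context saddle_point
begin

text \<open>
  Write y = log x for the saddle point, y0 = \<xi>(u)/r for the approximate one, and S(y) for the sum of
  e^(jy), so that S(y) = n. By the equation for \<xi>, S(y0) exceeds n by at most u \<xi>(u). The derivative of S is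
  a first moment and hence at least rn/2 from y on, which bounds y0 - y. Tangents of the convex functions
  e^(jy) then show that P - n log decreases from y0 to y by at most (S(y0) - n)(y0 - y).
\<close>

lemma saddle_shift:
  assumes u1: "u > 1"
  shows "0 \<le> \<xi> u / real r - ln x" "\<xi> u / real r - ln x \<le> 2 * \<xi> u / (real r)\<^sup>2"
    and "\<bar>((\<Sum>j=1..r. x ^ j / real j) - real n * ln x) - (cycle_sum r (\<xi> u) - u * \<xi> u)\<bar>
      \<le> 2 * u * (\<xi> u)\<^sup>2 / (real r)\<^sup>2"
proof -
  define y where "y = ln x"
  define y0 where "y0 = \<xi> u / real r"
  define S where "S = (\<Sum>j=1..r. exp (real j * y0))"
  have r0: "real r > 0" using r_ge_1 by simp
  have xi: "\<xi> u > 0" "exp (\<xi> u) = 1 + u * \<xi> u" using xi_props[OF u1] by auto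
  have y0: "y0 > 0" using xi r0 by (simp add: y0_def)
  have ny0: "real n * y0 = u * \<xi> u" using r0 by (simp add: y0_def n_eq_r_mult_u)
  have Sy: "(\<Sum>j=1..r. exp (real j * y)) = real n"
    unfolding saddle[symmetric] x_power_exp y_def ..
  have SS: "S * (1 - exp (- y0)) = real n * y0"
  proof -
    have "real r * y0 = \<xi> u" using r0 by (simp add: y0_def)
    moreover have "1 - exp (- y0) > 0" using y0 by simp
    ultimately show ?thesis unfolding S_def exp_geometric_sum[OF y0] ny0 using xi by simp
  qed
  have S_lower: "real n \<le> S"
  proof -
    have "1 - exp (- y0) \<le> y0" using exp_ge_add_one_self[of "- y0"] by simp
    moreover have "S \<ge> 0" unfolding S_def by (intro sum_nonneg) auto
    ultimately have "S * (1 - exp (- y0)) \<le> S * y0" by (rule mult_left_mono)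
    then show ?thesis unfolding SS using y0 by simp
  qed
  have S_upper: "S - real n \<le> u * \<xi> u"
  proof -
    have "(1 + y0) * exp (- y0) \<le> exp y0 * exp (- y0)" by (intro mult_right_mono exp_ge_add_one_self) auto
    then have "y0 \<le> (1 + y0) * (1 - exp (- y0))" by (simp add: algebra_simps flip: exp_add)
    then have "real n * y0 \<le> real n * ((1 + y0) * (1 - exp (- y0)))" by (intro mult_left_mono) auto
    then have "S * (1 - exp (- y0)) \<le> (real n * (1 + y0)) * (1 - exp (- y0))" unfolding SS by (simp add: mult_ac)
    moreover have "1 - exp (- y0) > 0" using y0 by simp
    ultimately have "S \<le> real n * (1 + y0)" by (simp only: mult_le_cancel_right_pos)
    then show ?thesis using ny0 by (simp add: distrib_left)
  qed
  have tangent: "exp (real j * a) \<ge> exp (real j * b) + real j * exp (real j * b) * (a - b)" for j a b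
  proof -
    have "exp (real j * b) * (1 + real j * (a - b)) \<le> exp (real j * b) * exp (real j * (a - b))"
      by (intro mult_left_mono exp_ge_add_one_self) auto
    also have "\<dots> = exp (real j * a)" by (simp add: algebra_simps flip: exp_add)
    finally show ?thesis by (simp add: algebra_simps)
  qed
  have yy: "y \<le> y0"
  proof (rule ccontr)
    assume "\<not> y \<le> y0"
    then have "S < (\<Sum>j=1..r. exp (real j * y))"
      unfolding S_def using r_ge_1 by (intro sum_strict_mono) auto
    then show False using Sy S_lower by simp
  qed
  have "\<Lambda> * (y0 - y) \<le> u * \<xi> u"
  proof -
    have "(\<Sum>j=1..r. exp (real j * y) + real j * exp (real j * y) * (y0 - y)) \<le> S"
      unfolding S_def by (intro sum_mono tangent)
    moreover have "(\<Sum>j=1..r. exp (real j * y) + real j * exp (real j * y) * (y0 - y)) = real n + \<Lambda> * (y0 - y)"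
      using Sy unfolding sum.distrib first_moment_def sum_distrib_right x_power_exp y_def by simp
    ultimately show ?thesis using S_upper by linarith
  qed
  moreover have "real r * real n / 2 * (y0 - y) \<le> \<Lambda> * (y0 - y)"
    using first_moment_lower yy by (intro mult_right_mono) auto
  ultimately have "real r * real n / 2 * (y0 - y) \<le> u * \<xi> u" by linarith
  then have "u * ((real r)\<^sup>2 * (y0 - y)) \<le> u * (2 * \<xi> u)"
    by (simp add: n_eq_r_mult_u power2_eq_square mult_ac)
  then have "(real r)\<^sup>2 * (y0 - y) \<le> 2 * \<xi> u" using u1 by simp
  then have gap: "y0 - y \<le> 2 * \<xi> u / (real r)\<^sup>2" using r0 by (simp add: field_simps)
  show "0 \<le> \<xi> u / real r - ln x" "\<xi> u / real r - ln x \<le> 2 * \<xi> u / (real r)\<^sup>2"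
    using yy gap by (simp_all add: y_def y0_def)
  have P: "(\<Sum>j=1..r. x ^ j / real j) = (\<Sum>j=1..r. exp (real j * y) / real j)"
    unfolding x_power_exp y_def ..
  have tangent': "exp (real j * b) / real j + exp (real j * b) * (a - b) \<le> exp (real j * a) / real j"
    if "j \<in> {1..r}" for j a b
  proof -
    have "(exp (real j * b) + real j * exp (real j * b) * (a - b)) / real j \<le> exp (real j * a) / real j"
      by (intro divide_right_mono tangent) auto
    then show ?thesis using that by (simp add: add_divide_distrib)
  qed
  have up: "(\<Sum>j=1..r. exp (real j * y) / real j) + real n * (y0 - y) \<le> cycle_sum r (\<xi> u)"
  proof -
    have "(\<Sum>j=1..r. exp (real j * y) / real j + exp (real j * y) * (y0 - y)) \<le> cycle_sum r (\<xi> u)"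
      unfolding cycle_sum_def y0_def[symmetric] by (intro sum_mono tangent')
    then show ?thesis unfolding sum.distrib sum_distrib_right[symmetric] Sy .
  qed
  have low: "cycle_sum r (\<xi> u) + S * (y - y0) \<le> (\<Sum>j=1..r. exp (real j * y) / real j)"
  proof -
    have "(\<Sum>j=1..r. exp (real j * y0) / real j + exp (real j * y0) * (y - y0)) \<le> (\<Sum>j=1..r. exp (real j * y) / real j)"
      by (intro sum_mono tangent')
    then show ?thesis unfolding sum.distrib sum_distrib_right[symmetric] S_def[symmetric] cycle_sum_def y0_def[symmetric] .
  qed
  have "(S - real n) * (y0 - y) \<le> (u * \<xi> u) * (2 * \<xi> u / (real r)\<^sup>2)"
    using S_lower S_upper gap yy xi u1 by (intro mult_mono) auto
  also have "\<dots> = 2 * u * (\<xi> u)\<^sup>2 / (real r)\<^sup>2" by (simp add: power2_eq_square mult_ac)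
  finally have "(S - real n) * (y0 - y) \<le> 2 * u * (\<xi> u)\<^sup>2 / (real r)\<^sup>2" .
  moreover have "(S - real n) * (y0 - y) = (S * y0 - S * y) - (real n * y0 - real n * y)" by algebra
  ultimately have "(S * y0 - S * y) - (real n * y0 - real n * y) \<le> 2 * u * (\<xi> u)\<^sup>2 / (real r)\<^sup>2" by (simp only:)
  moreover have "(\<Sum>j=1..r. exp (real j * y) / real j) + (real n * y0 - real n * y) \<le> cycle_sum r (\<xi> u)"
    using up by (simp only: right_diff_distrib)
  moreover have "cycle_sum r (\<xi> u) + (S * y - S * y0) \<le> (\<Sum>j=1..r. exp (real j * y) / real j)"
    using low by (simp only: right_diff_distrib)
  moreover have "0 \<le> 2 * u * (\<xi> u)\<^sup>2 / (real r)\<^sup>2" using u1 by simp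
  ultimately show "\<bar>((\<Sum>j=1..r. x ^ j / real j) - real n * ln x) - (cycle_sum r (\<xi> u) - u * \<xi> u)\<bar>
      \<le> 2 * u * (\<xi> u)\<^sup>2 / (real r)\<^sup>2"
    unfolding P y_def[symmetric] abs_le_iff using ny0 by linarith
qed

text \<open>
  Moving y by h changes each weight e^(jy) by a factor between 1 and e^(rh).
\<close>

lemma first_moment_shift:
  assumes u1: "u > 1"
  defines "A \<equiv> first_moment r (exp (\<xi> u / real r)) / (real r)\<^sup>2"
  shows "u / 2 \<le> A" "\<bar>ln \<Lambda> - (ln A + 2 * ln (real r))\<bar> \<le> 2 * \<xi> u / real r"
proof -
  define y0 where "y0 = \<xi> u / real r"
  define h where "h = y0 - ln x"
  have r0: "real r > 0" using r_ge_1 by simp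
  have h: "0 \<le> h" "h \<le> 2 * \<xi> u / (real r)\<^sup>2" using saddle_shift(1,2)[OF u1] by (auto simp: h_def y0_def)
  have pw: "exp y0 ^ j = x ^ j * exp (real j * h)" for j
    unfolding x_power_exp exp_of_nat_mult[symmetric] exp_add[symmetric] h_def by (simp add: algebra_simps)
  have lo: "\<Lambda> \<le> first_moment r (exp y0)"
    unfolding first_moment_def pw
  proof (intro sum_mono mult_left_mono)
    fix j
    have "x ^ j * 1 \<le> x ^ j * exp (real j * h)" using h x_pos by (intro mult_left_mono) auto
    then show "x ^ j \<le> x ^ j * exp (real j * h)" by simp
  qed auto
  have hi: "first_moment r (exp y0) \<le> exp (real r * h) * \<Lambda>"
    unfolding first_moment_def pw sum_distrib_left
  proof (intro sum_mono)
    fix j assume j: "j \<in> {1..r}"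
    have "real j * x ^ j * exp (real j * h) \<le> real j * x ^ j * exp (real r * h)"
      using j h x_pos by (intro mult_left_mono) (auto intro: mult_right_mono)
    then show "real j * (x ^ j * exp (real j * h)) \<le> exp (real r * h) * (real j * x ^ j)" by (simp add: mult_ac)
  qed
  have AA: "first_moment r (exp y0) = A * (real r)\<^sup>2" unfolding A_def y0_def using r0 by simp
  have "real r * real n / 2 \<le> A * (real r)\<^sup>2" using lo first_moment_lower unfolding AA by linarith
  then have "(real r)\<^sup>2 * (u / 2) \<le> (real r)\<^sup>2 * A" by (simp add: n_eq_r_mult_u power2_eq_square mult_ac)
  then show A: "u / 2 \<le> A" using r0 by (simp only: mult_le_cancel_left_pos zero_less_power)
  then have A0: "A > 0" using u1 by simp
  have lnA: "ln (A * (real r)\<^sup>2) = ln A + 2 * ln (real r)" using A0 r0 by (simp add: ln_mult ln_realpow)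
  have "ln \<Lambda> \<le> ln (A * (real r)\<^sup>2)" using lo first_moment_pos unfolding AA by (intro ln_mono) auto
  moreover have "ln (A * (real r)\<^sup>2) \<le> real r * h + ln \<Lambda>"
  proof -
    have "ln (A * (real r)\<^sup>2) \<le> ln (exp (real r * h) * \<Lambda>)"
      using hi first_moment_pos A0 r0 unfolding AA by (intro ln_mono) auto
    then show ?thesis using first_moment_pos by (simp add: ln_mult)
  qed
  moreover have "real r * h \<le> 2 * \<xi> u / real r"
  proof -
    have "real r * h \<le> real r * (2 * \<xi> u / (real r)\<^sup>2)" using h r0 by (intro mult_left_mono) auto
    then show ?thesis using r0 by (simp add: power2_eq_square)
  qed
  moreover have "0 \<le> real r * h" using h r0 by simp
  ultimately show "\<bar>ln \<Lambda> - (ln A + 2 * ln (real r))\<bar> \<le> 2 * \<xi> u / real r"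
    unfolding lnA abs_le_iff by linarith
qed

lemma ln_saddle_value:
  "ln (saddle_value n r x) = ((\<Sum>j=1..r. x ^ j / real j) - real n * ln x) - ln (2 * pi) / 2 - ln \<Lambda> / 2"
  unfolding saddle_value_def using x_pos first_moment_pos
  by (simp add: ln_div ln_mult ln_sqrt ln_realpow add_divide_distrib)

lemma ln_saddle_value_approx:
  assumes u1: "u > 1"
  shows "\<bar>ln (saddle_value n r x) - (cycle_sum r (\<xi> u) - ln (real r) - u * \<xi> u - ln (2 * pi) / 2
      - ln (first_moment r (exp (\<xi> u / real r)) / (real r)\<^sup>2) / 2)\<bar>
    \<le> 2 * u * (\<xi> u)\<^sup>2 / (real r)\<^sup>2 + \<xi> u / real r"
  using saddle_shift(3)[OF u1] first_moment_shift(2)[OF u1] unfolding ln_saddle_value abs_le_iff by linarith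

end

text \<open>
  All terms that depend only on u cancel. The remaining ones are the errors from shifting the saddle
  point, the difference of the harmonic numbers, the difference of the Riemann sums for the first moment
  (divided by their size, which is at least u/2), and the correction from \<open>cycle_sum_scaling\<close>. By the
  equation for \<xi>, that correction is (1/r - 1/(kr))/2 times u\<xi>(u) - \<xi>(u).
\<close>

lemma ln_saddle_value_scaling:
  assumes 1: "saddle_point n r x u" and 2: "saddle_point (k * n) (k * r) X u" and u1: "u > 1" and k: "k \<ge> 1"
  shows "\<bar>(ln (saddle_value n r x) - u * \<xi> u / (2 * real r))
      - (ln (saddle_value (k * n) (k * r) X) - u * \<xi> u / (2 * real (k * r)))\<bar>
    \<le> 2 / real r + 5 * \<xi> u / real r + 5 * u * (\<xi> u)\<^sup>2 / (real r)\<^sup>2"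
proof -
  interpret a: saddle_point n r x u by (rule 1)
  interpret b: saddle_point "k * n" "k * r" X u by (rule 2)
  define R where "R = k * r"
  define s where "s = \<xi> u"
  define A where "A = first_moment r (exp (s / real r)) / (real r)\<^sup>2"
  define B where "B = first_moment R (exp (s / real R)) / (real R)\<^sup>2"
  have r: "1 \<le> r" "r \<le> R" using a.r_ge_1 k by (auto simp: R_def)
  have r0: "real r > 0" "real R > 0" using r by auto
  have rR: "real r \<le> real R" using r by simp
  have s: "s > 0" "exp s = 1 + u * s" using xi_props[OF u1] by (auto simp: s_def)
  have AB: "B \<le> A" "A - exp s / real r \<le> B"
    using first_moment_scaling[OF r(1) k, of s] s unfolding A_def B_def R_def by auto
  have B: "u / 2 \<le> B" using b.first_moment_shift(1)[OF u1] by (simp add: B_def R_def s_def)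
  then have B0: "B > 0" using u1 by simp
  have lnAB: "0 \<le> ln A - ln B" "ln A - ln B \<le> 2 * (1 + s) / real r"
  proof -
    show "0 \<le> ln A - ln B" using AB B0 by simp
    have "ln A - ln B = ln (A / B)" using AB B0 by (simp add: ln_div)
    also have "\<dots> \<le> A / B - 1" using AB B0 by (intro ln_le_minus_one) auto
    also have "\<dots> = (A - B) / B" using B0 by (simp add: field_simps)
    also have "\<dots> \<le> (exp s / real r) / (u / 2)" using AB B u1 r0 by (intro frac_le) auto
    also have "\<dots> \<le> 2 * (1 + s) / real r"
    proof -
      have "exp s \<le> (1 + s) * u" using s u1 by (simp add: algebra_simps)
      then show ?thesis using u1 r0 by (simp add: field_simps)
    qed
    finally show "ln A - ln B \<le> 2 * (1 + s) / real r" .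
  qed
  have E: "\<bar>(cycle_sum r s - harm r) - (cycle_sum R s - harm R) - (1 / real r - 1 / real R) / 2 * (exp s - 1 - s)\<bar>
    \<le> s * exp s / (4 * (real r)\<^sup>2)"
    using cycle_sum_scaling[OF r, of s] s by simp
  have H: "\<bar>(harm r - ln (real r)) - (harm R - ln (real R))\<bar> \<le> 1 / real r" by (rule harm_ln_scaling[OF r])
  have La: "\<bar>ln (saddle_value n r x) - (cycle_sum r s - ln (real r) - u * s - ln (2 * pi) / 2 - ln A / 2)\<bar>
    \<le> 2 * u * s\<^sup>2 / (real r)\<^sup>2 + s / real r"
    using a.ln_saddle_value_approx[OF u1] by (simp add: A_def s_def)
  have Lb: "\<bar>ln (saddle_value (k * n) R X) - (cycle_sum R s - ln (real R) - u * s - ln (2 * pi) / 2 - ln B / 2)\<bar>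
    \<le> 2 * u * s\<^sup>2 / (real r)\<^sup>2 + s / real r"
  proof -
    have "2 * u * s\<^sup>2 / (real R)\<^sup>2 \<le> 2 * u * s\<^sup>2 / (real r)\<^sup>2"
      using rR r0 u1 by (intro divide_left_mono power_mono mult_pos_pos) auto
    moreover have "s / real R \<le> s / real r" using rR r0 s by (intro divide_left_mono) auto
    ultimately show ?thesis using b.ln_saddle_value_approx[OF u1] unfolding B_def s_def R_def by linarith
  qed
  have M: "(1 / real r - 1 / real R) / 2 * (exp s - 1 - s) = u * s / (2 * real r) - u * s / (2 * real R) - (1 / real r - 1 / real R) / 2 * s"
    unfolding s(2) by (simp add: algebra_simps diff_divide_distrib)
  have M': "0 \<le> (1 / real r - 1 / real R) / 2 * s" "(1 / real r - 1 / real R) / 2 * s \<le> s / real r"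
  proof -
    have q: "0 \<le> 1 / real r - 1 / real R" using rR r0 by (simp add: frac_le)
    then show "0 \<le> (1 / real r - 1 / real R) / 2 * s" using s by simp
    have "(1 / real r - 1 / real R) / 2 * s \<le> 1 / real r * s"
    proof (intro mult_right_mono)
      show "(1 / real r - 1 / real R) / 2 \<le> 1 / real r" 
      proof -
        have "(p - q) / 2 \<le> p" if "0 \<le> q" "0 \<le> p - q" for p q :: real using that by simp
        from this[OF _ q] show ?thesis by simp
      qed
    qed (use s in auto)
    then show "(1 / real r - 1 / real R) / 2 * s \<le> s / real r" by simp
  qed
  have X: "s * exp s / (4 * (real r)\<^sup>2) \<le> s / real r + u * s\<^sup>2 / (real r)\<^sup>2"
  proof -
    have "real r \<le> (real r)\<^sup>2" using r by (simp add: power2_eq_square)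
    then have "s / (real r)\<^sup>2 \<le> s / real r" using r0 s by (intro divide_left_mono mult_pos_pos) auto
    moreover have "s * exp s / (4 * (real r)\<^sup>2) = 1 / 4 * (s / (real r)\<^sup>2) + 1 / 4 * (u * s\<^sup>2 / (real r)\<^sup>2)"
    proof -
      have "s * exp s = s + u * s\<^sup>2" unfolding s(2) by algebra
      then show ?thesis by (simp add: add_divide_distrib)
    qed
    moreover have "0 \<le> s / (real r)\<^sup>2" "0 \<le> u * s\<^sup>2 / (real r)\<^sup>2" using s u1 by auto
    ultimately show ?thesis by linarith
  qed
  have combine: "\<bar>(l1 - v1) - (l2 - v2)\<bar> \<le> 2 * p + 5 * a + 5 * b"
    if "\<bar>l1 - (c1 - k1 - us - m - A1 / 2)\<bar> \<le> 2 * b + a" "\<bar>l2 - (c2 - k2 - us - m - B1 / 2)\<bar> \<le> 2 * b + a"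
      "\<bar>(c1 - h1) - (c2 - h2) - W\<bar> \<le> X0" "\<bar>(h1 - k1) - (h2 - k2)\<bar> \<le> p"
      "0 \<le> A1 - B1" "A1 - B1 \<le> 2 * p + 2 * a" "W = v1 - v2 - Z" "0 \<le> Z" "Z \<le> a" "X0 \<le> a + b"
    for l1 v1 l2 v2 p a b c1 k1 us m A1 c2 k2 B1 h1 h2 W X0 Z :: real
    using that unfolding abs_le_iff by linarith
  have "2 * u * s\<^sup>2 / (real r)\<^sup>2 = 2 * (u * s\<^sup>2 / (real r)\<^sup>2)"
    "2 * (1 + s) / real r = 2 * (1 / real r) + 2 * (s / real r)"
    by (simp_all add: distrib_left add_divide_distrib)
  note combine[OF La[unfolded this] Lb[unfolded this] E H lnAB[unfolded this] M M' X]
  then show ?thesis unfolding s_def R_def by (simp add: mult.assoc)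
qed

section \<open>The estimate in terms of the Dickman function\<close>

lemma exp_mult_ratio_bound:
  fixes a b d e D E :: real
  assumes D: "\<bar>d\<bar> \<le> D" and a: "\<bar>a\<bar> \<le> E" and b: "\<bar>b\<bar> \<le> E" and E: "E \<le> 1 / 2"
  shows "\<bar>exp d * (1 + a) / (1 + b) - 1\<bar> \<le> 3 * D * exp D + 4 * E"
proof -
  define w where "w = (1 + a) / (1 + b)"
  have b1: "1 + b \<ge> 1 / 2" and a1: "1 + a \<le> 3 / 2" "1 + a \<ge> 0" using a b E by auto
  have w1: "\<bar>w - 1\<bar> \<le> 4 * E"
  proof -
    have "w - 1 = (a - b) / (1 + b)" using b1 by (simp add: w_def field_simps)
    then have "\<bar>w - 1\<bar> = \<bar>a - b\<bar> / (1 + b)" using b1 by (simp add: abs_divide)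
    also have "\<dots> \<le> (2 * E) / (1 / 2)" using a b b1 by (intro frac_le) auto
    finally show ?thesis by simp
  qed
  have w3: "0 \<le> w" "w \<le> 3"
  proof -
    show "0 \<le> w" using a1 b1 by (simp add: w_def)
    have "w \<le> (3 / 2) / (1 / 2)" unfolding w_def using a1 b1 by (intro frac_le) auto
    then show "w \<le> 3" by simp
  qed
  have D0: "D \<ge> 0" using D by linarith
  have e1: "\<bar>exp d - 1\<bar> \<le> D * exp D"
  proof -
    have "1 + d \<le> exp d" "1 - D \<le> exp (- D)" using exp_ge_add_one_self[of d] exp_ge_add_one_self[of "- D"] by auto
    moreover have "exp d \<le> exp D" using D by simp
    moreover have "exp D - 1 \<le> D * exp D"
    proof -
      have "(1 - D) * exp D \<le> exp (- D) * exp D" using \<open>1 - D \<le> exp (- D)\<close> by (intro mult_right_mono) auto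
      then show ?thesis by (simp add: algebra_simps flip: exp_add)
    qed
    moreover have "D * 1 \<le> D * exp D" using D0 by (intro mult_left_mono) auto
    ultimately show ?thesis using D unfolding abs_le_iff by linarith
  qed
  have eq: "exp d * (1 + a) / (1 + b) - 1 = (exp d - 1) * w + (w - 1)"
  proof -
    have "exp d * (1 + a) / (1 + b) = exp d * w" by (simp add: w_def)
    then show ?thesis by (simp add: left_diff_distrib)
  qed
  have "\<bar>exp d * (1 + a) / (1 + b) - 1\<bar> \<le> \<bar>(exp d - 1) * w\<bar> + \<bar>w - 1\<bar>"
    unfolding eq by (rule abs_triangle_ineq)
  also have "\<bar>(exp d - 1) * w\<bar> = \<bar>exp d - 1\<bar> * w" using w3 by (simp add: abs_mult)
  also have "\<bar>exp d - 1\<bar> * w + \<bar>w - 1\<bar> \<le> (D * exp D) * 3 + 4 * E"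
    using e1 w1 w3 D0 by (intro add_mono mult_mono) auto
  finally show ?thesis by simp
qed

text \<open>
  The mixed term l/R is at most half of the sum of u l^2/R^2 and 1/u, by the inequality between the
  geometric and the arithmetic mean.
\<close>

lemma error_term_bound:
  fixes u R s l :: real
  assumes u: "u \<ge> 2" and R: "R \<ge> 1" and xi: "0 \<le> s" "s \<le> 2 * l" and l: "l \<ge> 1"
  shows "2 / R + 5 * s / R + 5 * u * s\<^sup>2 / R\<^sup>2 \<le> 26 * (u * l\<^sup>2 / R\<^sup>2 + 1 / u)"
proof -
  define q where "q = l / R"
  have q0: "q \<ge> 0" using l R by (simp add: q_def)
  have "2 / R \<le> 2 * q" using l R by (simp add: q_def divide_right_mono)
  moreover have "5 * s / R \<le> 10 * q" using xi R by (simp add: q_def divide_right_mono)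
  moreover have "5 * u * s\<^sup>2 / R\<^sup>2 \<le> 20 * (u * l\<^sup>2 / R\<^sup>2)"
  proof -
    have "s\<^sup>2 \<le> (2 * l)\<^sup>2" using xi by (intro power_mono) auto
    then have "5 * u * s\<^sup>2 / R\<^sup>2 \<le> 5 * u * (2 * l)\<^sup>2 / R\<^sup>2" using u R by (intro divide_right_mono mult_left_mono) auto
    then show ?thesis by (simp add: power_mult_distrib)
  qed
  moreover have "2 * q \<le> u * l\<^sup>2 / R\<^sup>2 + 1 / u"
  proof -
    have "0 \<le> (u * q - 1)\<^sup>2 / u" using u by simp
    also have "\<dots> = u * q\<^sup>2 - 2 * q + 1 / u" using u by (simp add: power2_eq_square field_simps)
    finally show ?thesis by (simp add: q_def power_divide)
  qed
  moreover have "0 \<le> 1 / u" using u by simp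
  moreover have "a + b + c \<le> 26 * (z + w)" if "a \<le> 2 * q" "b \<le> 10 * q" "c \<le> 20 * z" "2 * q \<le> z + w" "0 \<le> w"
    for a b c z w :: real using that unfolding distrib_left by linarith
  ultimately show ?thesis by blast
qed

text \<open>
  The saddle-point estimate for (n,r) is divided by that for (kn,kr), and k tends to infinity. The bound
  is stated with the product instead of a quotient because \<rho>(u) enters only as the limit of the
  approximations.
\<close>

lemma dickman_estimate_large_u:
  assumes C: "C > 0" "\<And>n r x u. saddle_point n r x u \<Longrightarrow> \<bar>\<nu> n r / saddle_value n r x - 1\<bar> \<le> C / u"
    and r: "1 \<le> r" "r \<le> n" and u: "u = real n / real r" and u2: "u \<ge> 3" "u \<ge> 2 * C"
  defines "D \<equiv> 2 / real r + 5 * \<xi> u / real r + 5 * u * (\<xi> u)\<^sup>2 / (real r)\<^sup>2"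
  shows "\<bar>\<nu> n r - \<rho> u * exp (u * \<xi> u / (2 * real r))\<bar>
    \<le> (3 * D * exp D + 4 * (C / u)) * (\<rho> u * exp (u * \<xi> u / (2 * real r)))"
proof -
  define h where "h = u * \<xi> u"
  define B where "B = 3 * D * exp D + 4 * (C / u)"
  have u1: "u > 1" using u2 by simp
  obtain x where x: "saddle_point n r x u" using saddle_point_exists[OF r] u by metis
  \<comment> \<open>The approximation of \<nu> n r that (kn,kr) provides, with k replaced by k + 1.\<close>
  define Y where "Y = (\<lambda>k. \<nu> (Suc k * n) (Suc k * r) * exp (h / (2 * real r) - h / (2 * real (Suc k * r))))"
  have Cu: "C / u \<le> 1 / 2" using u2 u1 by (simp add: field_simps)
  have bound: "\<bar>\<nu> n r - Y k\<bar> \<le> B * Y k" for k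
  proof -
    have "real (Suc k * n) / real (Suc k * r) = u"
      unfolding of_nat_mult u by (rule mult_divide_mult_cancel_left) simp
    moreover have "1 \<le> Suc k * r" "Suc k * r \<le> Suc k * n"
      using r mult_le_mono2[OF r(2), of "Suc k"] by auto
    ultimately obtain X where X: "saddle_point (Suc k * n) (Suc k * r) X u"
      using saddle_point_exists by metis
    define M where "M = saddle_value n r x"
    define M' where "M' = saddle_value (Suc k * n) (Suc k * r) X"
    define a where "a = \<nu> n r / M - 1"
    define b where "b = \<nu> (Suc k * n) (Suc k * r) / M' - 1"
    define d where "d = (ln M - h / (2 * real r)) - (ln M' - h / (2 * real (Suc k * r)))"
    have M: "M > 0" "M' > 0" using saddle_point.saddle_value_pos[OF x] saddle_point.saddle_value_pos[OF X] by (auto simp: M_def M'_def)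
    have d: "\<bar>d\<bar> \<le> D"
      using ln_saddle_value_scaling[OF x X u1] by (simp add: d_def D_def h_def M_def M'_def)
    have ab: "\<bar>a\<bar> \<le> C / u" "\<bar>b\<bar> \<le> C / u"
      using C(2)[OF x] C(2)[OF X] by (auto simp: a_def b_def M_def M'_def)
    have b1: "1 + b > 0" using ab Cu by linarith
    have nu1: "\<nu> n r = M * (1 + a)" using M by (simp add: a_def)
    have nu2: "\<nu> (Suc k * n) (Suc k * r) = M' * (1 + b)" using M by (simp add: b_def)
    have ed: "exp d * (M' * exp (h / (2 * real r) - h / (2 * real (Suc k * r)))) = M"
    proof -
      have "exp d * (exp (ln M') * exp (h / (2 * real r) - h / (2 * real (Suc k * r)))) = exp (ln M)"
        unfolding exp_add[symmetric] d_def by (rule arg_cong[where f = exp]) linarith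
      then show ?thesis using M by simp
    qed
    have Y: "Y k = (1 + b) * (M' * exp (h / (2 * real r) - h / (2 * real (Suc k * r))))"
      unfolding Y_def nu2 by (simp only: mult_ac)
    have Y0: "Y k > 0" unfolding Y using b1 M by simp
    have "exp d * (1 + a) / (1 + b) * Y k = \<nu> n r"
    proof -
      have "exp d * (1 + a) / (1 + b) * Y k = (1 + a) * (exp d * (M' * exp (h / (2 * real r) - h / (2 * real (Suc k * r)))))"
        unfolding Y using b1 by simp
      then show ?thesis unfolding ed nu1 by (simp only: mult.commute)
    qed
    then have "\<nu> n r - Y k = (exp d * (1 + a) / (1 + b) - 1) * Y k" by (simp only: left_diff_distrib mult_1_left)
    then have "\<bar>\<nu> n r - Y k\<bar> = \<bar>exp d * (1 + a) / (1 + b) - 1\<bar> * Y k" using Y0 by (simp only: abs_mult abs_of_pos)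
    also have "\<dots> \<le> B * Y k"
      unfolding B_def using exp_mult_ratio_bound[OF d ab Cu] Y0 by (intro mult_right_mono) auto
    finally show ?thesis .
  qed
  have lim: "Y \<longlonglongrightarrow> \<rho> u * exp (h / (2 * real r))"
  proof -
    have "(\<lambda>k. h / (2 * real r) / real (Suc k)) \<longlonglongrightarrow> 0"
      using LIMSEQ_Suc[OF lim_const_over_n[of "h / (2 * real r)"]] .
    then have "(\<lambda>k. h / (2 * real (Suc k * r))) \<longlonglongrightarrow> 0"
      by (simp only: of_nat_mult divide_divide_eq_left mult_ac)
    from tendsto_diff[OF tendsto_const this, of "h / (2 * real r)"]
    have "(\<lambda>k. exp (h / (2 * real r) - h / (2 * real (Suc k * r)))) \<longlonglongrightarrow> exp (h / (2 * real r) - 0)"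
      by (rule tendsto_exp)
    from tendsto_mult[OF nu_scaled_tendsto_rho[OF r(1)] this, of n] show ?thesis unfolding Y_def u by simp
  qed
  have "\<bar>\<nu> n r - \<rho> u * exp (h / (2 * real r))\<bar> \<le> B * (\<rho> u * exp (h / (2 * real r)))"
  proof (rule LIMSEQ_le)
    show "(\<lambda>k. \<bar>\<nu> n r - Y k\<bar>) \<longlonglongrightarrow> \<bar>\<nu> n r - \<rho> u * exp (h / (2 * real r))\<bar>"
      by (intro tendsto_intros lim)
    show "(\<lambda>k. B * Y k) \<longlonglongrightarrow> B * (\<rho> u * exp (h / (2 * real r)))" by (intro tendsto_intros lim)
  qed (use bound in auto)
  then show ?thesis by (simp add: B_def h_def)
qed

text \<open>
  The lower bound for r says that r^3 \<ge> n log(n)^2, and log(u+1) is at most 2 log n. In this range the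
  exponential of the error of \<open>ln_saddle_value_scaling\<close> is therefore bounded.
\<close>

lemma error_term_in_range:
  fixes n r :: nat
  assumes n: "4 \<le> n" and r: "real n powr (1/3) * ln (real n) powr (2/3) \<le> real r" "r \<le> n"
    and u: "u = real n / real r"
  shows "1 \<le> r" "u * (ln (u + 1))\<^sup>2 / (real r)\<^sup>2 \<le> 4"
proof -
  have ln0: "ln (real n) > 0" using n by simp
  have pos: "real n powr (1/3) * ln (real n) powr (2/3) > 0" using n ln0 by simp
  then show r1: "1 \<le> r" using r by (cases r) auto
  then have r0: "real r > 0" by simp
  have "(real n powr (1/3) * ln (real n) powr (2/3)) ^ 3 \<le> real r ^ 3"
    using r pos by (intro power_mono) auto
  moreover have "(real n powr (1/3) * ln (real n) powr (2/3)) ^ 3 = real n * (ln (real n))\<^sup>2"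
  proof -
    have "(real n powr (1/3)) ^ 3 = real n powr (real 3 * (1/3))" by (rule powr_power) (use n in auto)
    moreover have "(ln (real n) powr (2/3)) ^ 3 = ln (real n) powr (real 3 * (2/3))" by (rule powr_power) (use ln0 in auto)
    moreover have "ln (real n) powr 2 = (ln (real n))\<^sup>2" using ln0 powr_realpow[of "ln (real n)" 2] by simp
    ultimately show ?thesis using n by (simp add: power_mult_distrib)
  qed
  ultimately have r3: "real n * (ln (real n))\<^sup>2 \<le> real r ^ 3" by simp
  have "real n / real r \<le> real n / 1" using r1 by (intro frac_le) auto
  then have "u \<le> real n" by (simp add: u)
  moreover have "real n + 1 \<le> (real n)\<^sup>2"
  proof -
    have n4: "4 \<le> real n" using n by simp
    then have "4 * real n \<le> real n * real n" by (intro mult_right_mono) auto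
    then show ?thesis using n4 unfolding power2_eq_square by linarith
  qed
  moreover have u0: "u \<ge> 1" using r r0 u by simp
  ultimately have "ln (u + 1) \<le> ln ((real n)\<^sup>2)" by (intro ln_mono) auto
  also have "\<dots> = 2 * ln (real n)" using n by (simp add: ln_realpow)
  finally have "(ln (u + 1))\<^sup>2 \<le> (2 * ln (real n))\<^sup>2" using u0 by (intro power_mono) auto
  then have "real n * (ln (u + 1))\<^sup>2 \<le> real n * (2 * ln (real n))\<^sup>2" by (intro mult_left_mono) auto
  also have "\<dots> \<le> 4 * real r ^ 3" using r3 by (simp add: power_mult_distrib)
  finally have "real n * (ln (u + 1))\<^sup>2 / real r ^ 3 \<le> 4" using r0 by (simp add: field_simps)
  moreover have "u * (ln (u + 1))\<^sup>2 / (real r)\<^sup>2 = real n * (ln (u + 1))\<^sup>2 / real r ^ 3"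
    using r0 unfolding u by (simp add: power2_eq_square power3_eq_cube)
  ultimately show "u * (ln (u + 1))\<^sup>2 / (real r)\<^sup>2 \<le> 4" by simp
qed

text \<open>
  The threshold U makes the relative error C/u of the saddle-point estimate at most 1/2. Below it the
  quotient is bounded, which suffices because the error term is at least 1/u.
\<close>

lemma dickman_estimate:
  "\<exists>C::real. \<forall>(n::nat) (r::nat) (u::real).
        4 \<le> n \<longrightarrow> real n powr (1/3) * ln (real n) powr (2/3) \<le> real r \<longrightarrow> r \<le> n \<longrightarrow>
        u = real n / real r \<longrightarrow>
        (\<exists>\<epsilon>::real. \<bar>\<epsilon>\<bar> \<le> C * (u * (ln (u + 1))\<^sup>2 / (real r)\<^sup>2 + 1 / u) \<and>
           \<nu> n r = \<rho> u * exp (u * \<xi> u / (2 * real r)) * (1 + \<epsilon>))"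
proof -
  obtain C where C: "C > 0" "\<And>n r x u. saddle_point n r x u \<Longrightarrow> \<bar>\<nu> n r / saddle_value n r x - 1\<bar> \<le> C / u"
    using nu_saddle_point_estimate by blast
  define U where "U = nat \<lceil>max 3 (2 * C)\<rceil>"
  have U: "real U \<ge> 3" "real U \<ge> 2 * C" "1 \<le> U" unfolding U_def by linarith+
  define c where "c = (1 / (2 * real U)) ^ (2 * U)"
  have c: "c > 0" using U by (simp add: c_def)
  define K1 where "K1 = (1 + 1 / c) * real U"
  \<comment> \<open>78 and 130 are 26 times 3 and 5: 26 comes from \<open>error_term_bound\<close>, 3 from \<open>exp_mult_ratio_bound\<close>,
      and 5 bounds the error term T below.\<close>
  define K2 where "K2 = 78 * exp 130 + 4 * C"
  have K: "K1 > 0" "K2 > 0" using U C c by (auto simp: K1_def K2_def intro!: add_pos_pos mult_pos_pos)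
  show ?thesis
  proof (rule exI[of _ "max K1 K2"], intro allI impI)
    fix n r :: nat and u :: real
    assume n: "4 \<le> n" and r: "real n powr (1/3) * ln (real n) powr (2/3) \<le> real r" "r \<le> n"
      and u: "u = real n / real r"
    define T where "T = u * (ln (u + 1))\<^sup>2 / (real r)\<^sup>2 + 1 / u"
    define N where "N = \<rho> u * exp (u * \<xi> u / (2 * real r))"
    have r1: "1 \<le> r" and T4: "u * (ln (u + 1))\<^sup>2 / (real r)\<^sup>2 \<le> 4" using error_term_in_range[OF n r u] by auto
    have r0: "real r > 0" using r1 by simp
    have u1: "u \<ge> 1" using r r0 u by simp
    have T: "T \<ge> 1 / u" "T \<le> 5" "T > 0"
    proof -
      have "0 \<le> u * (ln (u + 1))\<^sup>2 / (real r)\<^sup>2" using u1 by simp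
      then show "T \<ge> 1 / u" by (simp add: T_def)
      moreover have "1 / u > 0" using u1 by simp
      ultimately show "T > 0" by linarith
      have "1 / u \<le> 1" using u1 by simp
      then show "T \<le> 5" using T4 by (simp add: T_def)
    qed
    have N: "\<bar>\<nu> n r - N\<bar> \<le> max K1 K2 * T * N" and N0: "N \<ge> 0"
    proof -
      have "\<bar>\<nu> n r - N\<bar> \<le> max K1 K2 * T * N \<and> N \<ge> 0"
      proof (cases "u \<ge> real U")
        case False
        have "real n \<le> real U * real r" using False u r0 by (simp add: field_simps)
        then have "n \<le> U * r" by (simp only: of_nat_mult[symmetric] of_nat_le_iff)
        from rho_lower[OF r1 U(3) this] have rho: "\<rho> u \<ge> c" by (simp add: c_def u)
        have xi0: "\<xi> u \<ge> 0" using u1 xi_props(1)[of u] xi_1 by (cases "u = 1") auto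
        have "c * 1 \<le> N" unfolding N_def using rho c xi0 u1 by (intro mult_mono) auto
        then have Nc: "N \<ge> c" by simp
        then have "1 \<le> 1 / c * N" using c by (simp add: field_simps)
        moreover have "\<bar>\<nu> n r - N\<bar> \<le> 1 + N" using nu_le_1[of n r] nu_nonneg[of n r] Nc c by (simp add: abs_le_iff)
        ultimately have "\<bar>\<nu> n r - N\<bar> \<le> (1 + 1 / c) * N * 1" by (simp add: distrib_right)
        also have "\<dots> \<le> (1 + 1 / c) * N * (real U * T)"
        proof (intro mult_left_mono)
          have "1 \<le> real U * (1 / u)" using False u1 by (simp add: field_simps)
          also have "\<dots> \<le> real U * T" using T by (intro mult_left_mono) auto
          finally show "1 \<le> real U * T" .
        qed (use c Nc in \<open>auto intro!: mult_nonneg_nonneg add_nonneg_nonneg\<close>)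
        also have "\<dots> = K1 * (T * N)" by (simp add: K1_def mult_ac)
        also have "\<dots> \<le> max K1 K2 * (T * N)" using T Nc c by (intro mult_right_mono) auto
        finally show ?thesis using Nc c by (simp add: mult.assoc)
      next
        case True
        define D where "D = 2 / real r + 5 * \<xi> u / real r + 5 * u * (\<xi> u)\<^sup>2 / (real r)\<^sup>2"
        have u3: "u \<ge> 3" "u \<ge> 2 * C" using True U by auto
        then have ug: "u > 1" by simp
        have xi: "0 \<le> \<xi> u" "\<xi> u \<le> 2 * ln (u + 1)"
        proof -
          show "0 \<le> \<xi> u" using xi_props(1)[OF ug] by simp
          have "ln u \<le> ln (u + 1)" using u1 by simp
          then show "\<xi> u \<le> 2 * ln (u + 1)" using xi_le[OF ug] by linarith
        qed
        have l1: "ln (u + 1) \<ge> 1"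
        proof (rule iffD2[OF ln_ge_iff])
          show "exp 1 \<le> u + 1" using exp_le u3 by linarith
        qed (use u3 in simp)
        have DT: "D \<le> 26 * T" unfolding D_def T_def using u3 r1 xi l1 by (intro error_term_bound) auto
        have D0: "D \<ge> 0" unfolding D_def using xi u3 by simp
        have N1: "\<bar>\<nu> n r - N\<bar> \<le> (3 * D * exp D + 4 * (C / u)) * N"
          unfolding N_def D_def by (rule dickman_estimate_large_u[OF C r1 r(2) u u3])
        have N0: "N \<ge> 0"
        proof -
          have "(\<lambda>k. \<nu> (Suc k * n) (Suc k * r)) \<longlonglongrightarrow> \<rho> u" unfolding u by (rule nu_scaled_tendsto_rho[OF r1])
          then have "\<rho> u \<ge> 0" by (rule LIMSEQ_le_const) (use nu_nonneg in auto)
          then show ?thesis by (simp add: N_def)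
        qed
        have "3 * D * exp D \<le> 3 * (26 * T) * exp 130" using DT D0 T by (intro mult_mono) auto
        moreover have "4 * (C / u) \<le> 4 * C * T" using mult_left_mono[OF T(1), of "4 * C"] C by simp
        ultimately have "3 * D * exp D + 4 * (C / u) \<le> K2 * T" by (simp add: K2_def algebra_simps)
        also have "\<dots> \<le> max K1 K2 * T" using T by (intro mult_right_mono) auto
        finally have "(3 * D * exp D + 4 * (C / u)) * N \<le> max K1 K2 * T * N" using N0 by (rule mult_right_mono)
        with N1 N0 show ?thesis by linarith
      qed
      then show "\<bar>\<nu> n r - N\<bar> \<le> max K1 K2 * T * N" "N \<ge> 0" by auto
    qed
    have "\<exists>\<epsilon>. \<bar>\<epsilon>\<bar> \<le> max K1 K2 * T \<and> \<nu> n r = N * (1 + \<epsilon>)"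
    proof (cases "N = 0")
      case True
      then show ?thesis using N T K by (intro exI[of _ 0]) auto
    next
      case False
      then have Np: "N > 0" using N0 by simp
      have "\<bar>(\<nu> n r - N) / N\<bar> \<le> max K1 K2 * T"
        using N Np by (simp add: abs_divide pos_divide_le_eq)
      moreover have "\<nu> n r = N * (1 + (\<nu> n r - N) / N)" using Np by (simp add: field_simps)
      ultimately show ?thesis by blast
    qed
    then show "\<exists>\<epsilon>::real. \<bar>\<epsilon>\<bar> \<le> max K1 K2 * (u * (ln (u + 1))\<^sup>2 / (real r)\<^sup>2 + 1 / u) \<and>
           \<nu> n r = \<rho> u * exp (u * \<xi> u / (2 * real r)) * (1 + \<epsilon>)"
      unfolding T_def N_def .
  qed
qed

theorem corollary2p5:
  shows
    "(\<exists>C::real. \<forall>(n::nat) (r::nat) (x::real).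
        4 \<le> n \<longrightarrow> 1 \<le> r \<longrightarrow> r \<le> n \<longrightarrow> x > 0 \<longrightarrow> (\<Sum>j=1..r. x ^ j) = real n \<longrightarrow>
        (\<exists>\<epsilon>::real. \<bar>\<epsilon>\<bar> \<le> C * (real r / real n) \<and>
           \<nu> n r = exp (\<Sum>j=1..r. x ^ j / real j)
                     / (x ^ n * sqrt (2 * pi * (\<Sum>j=1..r. real j * x ^ j))) * (1 + \<epsilon>)))
     \<and>
     (\<exists>C::real. \<forall>(n::nat) (r::nat) (u::real).
        4 \<le> n \<longrightarrow> real n powr (1/3) * ln (real n) powr (2/3) \<le> real r \<longrightarrow> r \<le> n \<longrightarrow>
        u = real n / real r \<longrightarrow>
        (\<exists>\<epsilon>::real. \<bar>\<epsilon>\<bar> \<le> C * (u * (ln (u + 1))\<^sup>2 / (real r)\<^sup>2 + 1 / u) \<and>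
           \<nu> n r = \<rho> u * exp (u * \<xi> u / (2 * real r)) * (1 + \<epsilon>)))"
proof
  obtain C where "C > 0" and C: "\<And>n r x u. saddle_point n r x u \<Longrightarrow> \<bar>\<nu> n r / saddle_value n r x - 1\<bar> \<le> C / u"
    using nu_saddle_point_estimate by blast
  show "\<exists>C::real. \<forall>(n::nat) (r::nat) (x::real).
        4 \<le> n \<longrightarrow> 1 \<le> r \<longrightarrow> r \<le> n \<longrightarrow> x > 0 \<longrightarrow> (\<Sum>j=1..r. x ^ j) = real n \<longrightarrow>
        (\<exists>\<epsilon>::real. \<bar>\<epsilon>\<bar> \<le> C * (real r / real n) \<and>
           \<nu> n r = exp (\<Sum>j=1..r. x ^ j / real j)
                     / (x ^ n * sqrt (2 * pi * (\<Sum>j=1..r. real j * x ^ j))) * (1 + \<epsilon>))"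
  proof (rule exI[of _ C], intro allI impI)
    fix n r :: nat and x :: real
    assume "1 \<le> r" "r \<le> n" "x > 0" "(\<Sum>j=1..r. x ^ j) = real n"
    then have s: "saddle_point n r x (real n / real r)" by unfold_locales auto
    define M where "M = saddle_value n r x"
    have M: "M > 0" using saddle_point.saddle_value_pos[OF s] by (simp add: M_def)
    have "\<bar>\<nu> n r / M - 1\<bar> \<le> C * (real r / real n)" using C[OF s] by (simp add: M_def)
    moreover have "\<nu> n r = M * (1 + (\<nu> n r / M - 1))" using M by simp
    ultimately have "\<exists>\<epsilon>. \<bar>\<epsilon>\<bar> \<le> C * (real r / real n) \<and> \<nu> n r = M * (1 + \<epsilon>)" by blast
    then show "\<exists>\<epsilon>::real. \<bar>\<epsilon>\<bar> \<le> C * (real r / real n) \<and>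
           \<nu> n r = exp (\<Sum>j=1..r. x ^ j / real j)
                     / (x ^ n * sqrt (2 * pi * (\<Sum>j=1..r. real j * x ^ j))) * (1 + \<epsilon>)"
      unfolding M_def saddle_value_def first_moment_def .
  qed
qed (rule dickman_estimate)

end
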